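(* Let $n\geq 1$ be an integer. (i) Let $\vec a=(a_1,\dots,a_n)^t$ and $\vec b=(b_1,\dots,b_n)^t$ be vectors in $\mathbb{C}^n$ with $\sum_{i=1}^n a_ib_i\neq 0$. Then for every $c\in\mathbb{C}$ the representation $\pi_{c,\vec a,\vec b}$ of $o(2n+2,\mathbb{C})$ on $\mathscr{A}_{\vec a,\vec b}$ is irreducible. (ii) Let $n_1,n_2\in\{1,\dots,n\}$ with $n_1\leq n_2$, and let $c\in\mathbb{C}\setminus(\mathbb{Z}/2)$. Then the representation $\pi_c^{n_1,n_2}$ of $o(2n+2,\mathbb{C})$ on $\mathscr{A}=\mathbb{C}[x_1,\dots,x_n,y_1,\dots,y_n]$ is irreducible, and its underlying module $\mathscr{A}$ is an infinite-dimensional irreducible weight $o(2n+2,\mathbb{C})$-module with finite-dimensional weight subspaces.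
   Context: Fix an integer $n\ge 1$. For integers $p\le q$ write $\overline{p,q}=\{p,p+1,\dots,q\}$ (empty index ranges, such as $\overline{n+1,n}$, are the empty set). $\mathbb{Z}/2=\{m/2: m\in\mathbb{Z}\}$. **The Lie algebra.** Let $E_{r,s}$ be the $(2n+2)\times(2n+2)$ matrix with $1$ in the $(r,s)$-entry and $0$ elsewhere. For $i,j\in\overline{1,n+1}$ put $$A_{i,j}=E_{i,j}-E_{n+1+j,n+1+i},\quad B_{i,j}=E_{i,n+1+j}-E_{j,n+1+i},\quad C_{i,j}=E_{n+1+i,j}-E_{n+1+j,i}.$$ Then $o(2n+2,\mathbb{C})=\sum_{i,j=1}^{n+1}(\mathbb{C}A_{i,j}+\mathbb{C}B_{i,j}+\mathbb{C}C_{i,j})$, with the commutator bracket. **The representation $\pi_c$.** Set $$D=\sum_{r=1}^n x_r\partial_{x_r}+\sum_{s=1}^n y_s\partial_{y_s},\qquad \eta=\sum_{i=1}^n x_iy_i .$$ For $c\in\mathbb{C}$, $\pi_c$ is the representation of $o(2n+2,\mathbb{C})$ by differential operators in $x_1,\dots,x_n,y_1,\dots,y_n$ determined, for $i,j\in\overline{1,n}$, by $$\pi_c(A_{i,j})=x_i\partial_{x_j}-y_j\partial_{y_i},\quad \pi_c(B_{i,j})=x_i\partial_{y_j}-x_j\partial_{y_i},\quad \pi_c(C_{i,j})=y_i\partial_{x_j}-y_j\partial_{x_i},$$ $$\pi_c(A_{n+1,i})=\partial_{x_i},\quad \pi_c(A_{n+1,n+1})=-D-c,\quad \pi_c(B_{i,n+1})=-\partial_{y_i},$$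 $$\pi_c(A_{i,n+1})=\eta\partial_{y_i}-x_i(D+c),\quad \pi_c(C_{n+1,i})=y_i(D+c)-\eta\partial_{x_i}.$$ **The representation $\pi_{c,\vec a,\vec b}$.** Let $\mathscr{A}=\mathbb{C}[x_1,\dots,x_n,y_1,\dots,y_n]$. For $\vec a,\vec b\in\mathbb{C}^n$ put $\vec a\cdot\vec x=\sum_{i=1}^n a_ix_i$, $\vec b\cdot\vec y=\sum_{i=1}^n b_iy_i$ and $$\mathscr{A}_{\vec a,\vec b}=\{f e^{\vec a\cdot\vec x+\vec b\cdot\vec y}\mid f\in\mathscr{A}\}.$$ This space is invariant under the differential operators above; $\pi_{c,\vec a,\vec b}$ denotes the representation $\pi_c$ of $o(2n+2,\mathbb{C})$ on $\mathscr{A}_{\vec a,\vec b}$. **The representation $\pi_c^{n_1,n_2}$.** For $n_1,n_2\in\overline{1,n}$ with $n_1\le n_2$, $\pi_c^{n_1,n_2}$ is the representation of $o(2n+2,\mathbb{C})$ on $\mathscr{A}$ obtained from the operators of $\pi_c$ by the replacements $$\partial_{x_r}\mapsto -x_r,\quad x_r\mapsto\partial_{x_r}\quad (r\in\overline{1,n_1}),\qquad \partial_{y_s}\mapsto -y_s,\quad y_s\mapsto\partial_{y_s}\quad (s\in\overline{n_2+1,n}),$$ all other $x_i,\partial_{x_i},y_i,\partial_{y_i}$ being left unchanged; that is, one composes $\pi_c$ (valued in the Weyl algebra of polynomial differential operators in $x_1,\dots,x_n,y_1,\dots,y_n$) with the automorphism of the Weyl algebra given by these replacements. **Weight modules.**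 A module is a weight module if it is the direct sum of its weight subspaces, where weights are taken with respect to the diagonal Cartan subalgebra $\sum_{i=1}^{n+1}\mathbb{C}A_{i,i}$. *)

theory Defs
  imports "HOL-Analysis.Derivative" "HOL-Library.Function_Algebras" "HOL-Library.FuncSet"
    "Jordan_Normal_Form.Matrix"
begin

text \<open>Indices of \<open>Emat\<close>, \<open>Amat\<close>, \<open>Bmat\<close>, \<open>Cmat\<close> and \<open>ent\<close> start at 1, whereas the indices
  of \<^typ>\<open>complex mat\<close> start at 0.\<close>

definition Emat :: "nat \<Rightarrow> nat \<Rightarrow> nat \<Rightarrow> complex mat" where
  "Emat n r s = mat (2*n+2) (2*n+2) (\<lambda>(k, l). if Suc k = r \<and> Suc l = s then 1 else 0)"

definition ent :: "complex mat \<Rightarrow> nat \<Rightarrow> nat \<Rightarrow> complex" where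
  "ent M r s = M $$ (r - 1, s - 1)"

definition Amat :: "nat \<Rightarrow> nat \<Rightarrow> nat \<Rightarrow> complex mat" where
  "Amat n i j = Emat n i j - Emat n (n+1+j) (n+1+i)"

definition Bmat :: "nat \<Rightarrow> nat \<Rightarrow> nat \<Rightarrow> complex mat" where
  "Bmat n i j = Emat n i (n+1+j) - Emat n j (n+1+i)"

definition Cmat :: "nat \<Rightarrow> nat \<Rightarrow> nat \<Rightarrow> complex mat" where
  "Cmat n i j = Emat n (n+1+i) j - Emat n (n+1+j) i"

inductive_set mat_span :: "nat \<Rightarrow> complex mat set \<Rightarrow> complex mat set"
  for N :: nat and S :: "complex mat set" where
  zero: "0\<^sub>m N N \<in> mat_span N S"
| add_smult: "M \<in> mat_span N S \<Longrightarrow> G \<in> S \<Longrightarrow> M + t \<cdot>\<^sub>m G \<in> mat_span N S"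

definition o_alg :: "nat \<Rightarrow> complex mat set" where
  "o_alg n = mat_span (2*n+2)
     (\<Union>i\<in>{1..n+1}. \<Union>j\<in>{1..n+1}. {Amat n i j, Bmat n i j, Cmat n i j})"

definition cartan :: "nat \<Rightarrow> complex mat set" where
  "cartan n = mat_span (2*n+2) ((\<lambda>i. Amat n i i) ` {1..n+1})"

definition bracket :: "complex mat \<Rightarrow> complex mat \<Rightarrow> complex mat" where
  "bracket M N = M * N - N * M"

datatype var = X nat | Y nat

type_synonym point = "var \<Rightarrow> complex"
type_synonym fn = "point \<Rightarrow> complex"

definition cscale :: "complex \<Rightarrow> fn \<Rightarrow> fn" where
  "cscale t f = (\<lambda>p. t * f p)"

interpretation fn: vector_space cscale
  by unfold_locales (auto simp: cscale_def fun_eq_iff algebra_simps)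

definition vars :: "nat \<Rightarrow> var set" where
  "vars n = X ` {1..n} \<union> Y ` {1..n}"

text \<open>The polynomial algebra $\mathbb{C}[x_1,\dots,x_n,y_1,\dots,y_n]$, realised as the algebra
  of polynomial functions; since the field is infinite, a polynomial is determined by its
  function.\<close>

inductive_set polys :: "nat \<Rightarrow> fn set" for n :: nat where
  const: "(\<lambda>p. t) \<in> polys n"
| var: "v \<in> vars n \<Longrightarrow> (\<lambda>p. p v) \<in> polys n"
| add: "f \<in> polys n \<Longrightarrow> g \<in> polys n \<Longrightarrow> (\<lambda>p. f p + g p) \<in> polys n"
| mult: "f \<in> polys n \<Longrightarrow> g \<in> polys n \<Longrightarrow> (\<lambda>p. f p * g p) \<in> polys n"

definition exp_polys :: "nat \<Rightarrow> (nat \<Rightarrow> complex) \<Rightarrow> (nat \<Rightarrow> complex) \<Rightarrow> fn set" where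
  "exp_polys n a b =
     {(\<lambda>p. f p * exp ((\<Sum>i=1..n. a i * p (X i)) + (\<Sum>i=1..n. b i * p (Y i)))) | f. f \<in> polys n}"

definition mult_var :: "var \<Rightarrow> fn \<Rightarrow> fn" where
  "mult_var v f = (\<lambda>p. p v * f p)"

definition pderivative :: "var \<Rightarrow> fn \<Rightarrow> fn" where
  "pderivative v f = (\<lambda>p. deriv (\<lambda>t. f (p(v := t))) (p v))"

text \<open>The operators of the representation are words in the generators of the Weyl algebra. In the
  following definitions \<open>q v\<close> and \<open>d v\<close> are the operators assigned to the generators $v$ and
  $\partial_v$, so that composing with an automorphism of the Weyl algebra amounts to changing
  \<open>q\<close> and \<open>d\<close>. Addition and subtraction of operators are pointwise.\<close>

type_synonym assignment = "var \<Rightarrow> fn \<Rightarrow> fn"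

definition euler_op :: "nat \<Rightarrow> assignment \<Rightarrow> assignment \<Rightarrow> fn \<Rightarrow> fn" where
  "euler_op n q d = (\<Sum>r=1..n. q (X r) \<circ> d (X r)) + (\<Sum>s=1..n. q (Y s) \<circ> d (Y s))"

definition eta_op :: "nat \<Rightarrow> assignment \<Rightarrow> fn \<Rightarrow> fn" where
  "eta_op n q = (\<Sum>i=1..n. q (X i) \<circ> q (Y i))"

definition A_op :: "nat \<Rightarrow> complex \<Rightarrow> assignment \<Rightarrow> assignment \<Rightarrow> nat \<Rightarrow> nat \<Rightarrow> fn \<Rightarrow> fn" where
  "A_op n c q d i j =
     (if i \<le> n \<and> j \<le> n then (q (X i) \<circ> d (X j)) - (q (Y j) \<circ> d (Y i))
      else if j \<le> n then d (X j)
      else if i \<le> n then (eta_op n q \<circ> d (Y i)) - (q (X i) \<circ> (euler_op n q d + cscale c))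
      else - euler_op n q d - cscale c)"

text \<open>\<open>B_op\<close> is used for $i \le n$ and \<open>C_op\<close> for $j \le n$ only; this suffices because
  $B_{i,j} = -B_{j,i}$, $C_{i,j} = -C_{j,i}$ and $B_{n+1,n+1} = C_{n+1,n+1} = 0$.\<close>

definition B_op :: "nat \<Rightarrow> assignment \<Rightarrow> assignment \<Rightarrow> nat \<Rightarrow> nat \<Rightarrow> fn \<Rightarrow> fn" where
  "B_op n q d i j =
     (if j \<le> n then (q (X i) \<circ> d (Y j)) - (q (X j) \<circ> d (Y i)) else - d (Y i))"

definition C_op :: "nat \<Rightarrow> complex \<Rightarrow> assignment \<Rightarrow> assignment \<Rightarrow> nat \<Rightarrow> nat \<Rightarrow> fn \<Rightarrow> fn" where
  "C_op n c q d i j =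
     (if i \<le> n then (q (Y i) \<circ> d (X j)) - (q (Y j) \<circ> d (X i))
      else (q (Y j) \<circ> (euler_op n q d + cscale c)) - (eta_op n q \<circ> d (X j)))"

text \<open>The linear extension to $o(2n+2,\mathbb{C})$: the matrices $A_{i,j}$ for all $i,j$, and
  $B_{i,j}$, $C_{j,i}$ for $i<j$, form a basis, and the coordinates of \<open>M\<close> with respect to
  it are the entries used here.\<close>

definition rep :: "nat \<Rightarrow> complex \<Rightarrow> assignment \<Rightarrow> assignment \<Rightarrow> complex mat \<Rightarrow> fn \<Rightarrow> fn" where
  "rep n c q d M =
     (\<Sum>i=1..n+1. \<Sum>j=1..n+1. cscale (ent M i j) \<circ> A_op n c q d i j)
   + (\<Sum>j=1..n+1. \<Sum>i\<in>{1..<j}. cscale (ent M i (n+1+j)) \<circ> B_op n q d i j)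
   + (\<Sum>j=1..n+1. \<Sum>i\<in>{1..<j}. cscale (ent M (n+1+j) i) \<circ> C_op n c q d j i)"

text \<open>\<open>rep\<close> takes the prescribed values on all $A_{i,j}$, on $B_{i,j}$ with \<open>i \<le> n\<close> and on
  $C_{i,j}$ with \<open>j \<le> n\<close>.\<close>

lemma ent_Emat:
  assumes "k \<in> {1..2*n+2}" "l \<in> {1..2*n+2}"
  shows "ent (Emat n r s) k l = (if k = r \<and> l = s then 1 else 0)"
  using assms by (auto simp: ent_def Emat_def)

lemma ent_Emat_diff:
  assumes "k \<in> {1..2*n+2}" "l \<in> {1..2*n+2}"
  shows "ent (Emat n r s - Emat n r' s') k l =
    (if k = r \<and> l = s then 1 else 0) - (if k = r' \<and> l = s' then 1 else 0)"
  using assms by (auto simp: ent_def Emat_def)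

lemma cscale_comp_0: "cscale 0 \<circ> F = 0"
  by (simp add: fun_eq_iff cscale_def)

lemma cscale_comp_1: "cscale 1 \<circ> F = F"
  by (simp add: fun_eq_iff cscale_def)

lemma cscale_comp_minus_1: "cscale (-1) \<circ> F = - F"
  by (simp add: fun_eq_iff cscale_def)

lemma double_sum_single:
  fixes F :: "nat \<Rightarrow> nat \<Rightarrow> fn \<Rightarrow> fn"
  assumes "finite I" "\<And>k. k \<in> I \<Longrightarrow> finite (J k)" "i \<in> I" "j \<in> J i"
    and "\<And>k l. k \<in> I \<Longrightarrow> l \<in> J k \<Longrightarrow> \<not> (k = i \<and> l = j) \<Longrightarrow> F k l = 0"
  shows "(\<Sum>k\<in>I. \<Sum>l\<in>J k. F k l) = F i j"
proof -
  have "(\<Sum>k\<in>I. \<Sum>l\<in>J k. F k l) = (\<Sum>k\<in>{i}. \<Sum>l\<in>J k. F k l)"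
    using assms by (intro sum.mono_neutral_right) (auto intro!: sum.neutral)
  also have "\<dots> = (\<Sum>l\<in>{j}. F i l)"
    using assms by (simp, intro sum.mono_neutral_right[of _ "{j}", simplified]) auto
  finally show ?thesis by simp
qed

lemma rep_Amat:
  assumes "i \<in> {1..n+1}" "j \<in> {1..n+1}"
  shows "rep n c q d (Amat n i j) = A_op n c q d i j"
proof -
  have B: "(\<Sum>k=1..n+1. \<Sum>l\<in>{1..<k}. cscale (ent (Amat n i j) l (n+1+k)) \<circ> B_op n q d l k) = 0"
    using assms by (intro sum.neutral ballI) (simp add: Amat_def ent_Emat_diff cscale_comp_0)
  have C: "(\<Sum>k=1..n+1. \<Sum>l\<in>{1..<k}. cscale (ent (Amat n i j) (n+1+k) l) \<circ> C_op n c q d k l) = 0"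
    using assms by (intro sum.neutral ballI) (simp add: Amat_def ent_Emat_diff cscale_comp_0)
  have "(\<Sum>k=1..n+1. \<Sum>l=1..n+1. cscale (ent (Amat n i j) k l) \<circ> A_op n c q d k l)
      = cscale (ent (Amat n i j) i j) \<circ> A_op n c q d i j"
    using assms
    by (intro double_sum_single) (auto simp add: Amat_def ent_Emat_diff cscale_comp_0)
  also have "\<dots> = A_op n c q d i j"
    using assms by (simp add: Amat_def ent_Emat_diff cscale_comp_1)
  finally show ?thesis
    unfolding rep_def B C by simp
qed

lemma rep_Bmat:
  assumes "i \<in> {1..n}" "j \<in> {1..n+1}"
  shows "rep n c q d (Bmat n i j) = B_op n q d i j"
proof -
  have A: "(\<Sum>k=1..n+1. \<Sum>l=1..n+1. cscale (ent (Bmat n i j) k l) \<circ> A_op n c q d k l) = 0"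
    using assms by (intro sum.neutral ballI) (simp add: Bmat_def ent_Emat_diff cscale_comp_0)
  have C: "(\<Sum>k=1..n+1. \<Sum>l\<in>{1..<k}. cscale (ent (Bmat n i j) (n+1+k) l) \<circ> C_op n c q d k l) = 0"
    using assms by (intro sum.neutral ballI) (simp add: Bmat_def ent_Emat_diff cscale_comp_0)
  have "(\<Sum>k=1..n+1. \<Sum>l\<in>{1..<k}. cscale (ent (Bmat n i j) l (n+1+k)) \<circ> B_op n q d l k)
      = B_op n q d i j" (is "?S = _")
  proof (cases i j rule: linorder_cases)
    case less
    have "?S = cscale (ent (Bmat n i j) i (n+1+j)) \<circ> B_op n q d i j"
      using assms less
      by (intro double_sum_single) (auto simp add: Bmat_def ent_Emat_diff cscale_comp_0)
    then show ?thesis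
      using assms less by (simp add: Bmat_def ent_Emat_diff cscale_comp_1)
  next
    case equal
    have "?S = 0"
      using assms equal
      by (intro sum.neutral ballI) (auto simp add: Bmat_def ent_Emat_diff cscale_comp_0)
    moreover have "B_op n q d i j = 0"
      using assms equal by (simp add: B_op_def)
    ultimately show ?thesis by simp
  next
    case greater
    have "?S = cscale (ent (Bmat n i j) j (n+1+i)) \<circ> B_op n q d j i"
      using assms greater
      by (intro double_sum_single) (auto simp add: Bmat_def ent_Emat_diff cscale_comp_0)
    then show ?thesis
      using assms greater by (simp add: Bmat_def ent_Emat_diff cscale_comp_minus_1 B_op_def)
  qed
  then show ?thesis
    unfolding rep_def A C by simp
qed

lemma rep_Cmat:
  assumes "i \<in> {1..n+1}" "j \<in> {1..n}"
  shows "rep n c q d (Cmat n i j) = C_op n c q d i j"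
proof -
  have A: "(\<Sum>k=1..n+1. \<Sum>l=1..n+1. cscale (ent (Cmat n i j) k l) \<circ> A_op n c q d k l) = 0"
    using assms by (intro sum.neutral ballI) (simp add: Cmat_def ent_Emat_diff cscale_comp_0)
  have B: "(\<Sum>k=1..n+1. \<Sum>l\<in>{1..<k}. cscale (ent (Cmat n i j) l (n+1+k)) \<circ> B_op n q d l k) = 0"
    using assms by (intro sum.neutral ballI) (simp add: Cmat_def ent_Emat_diff cscale_comp_0)
  have "(\<Sum>k=1..n+1. \<Sum>l\<in>{1..<k}. cscale (ent (Cmat n i j) (n+1+k) l) \<circ> C_op n c q d k l)
      = C_op n c q d i j" (is "?S = _")
  proof (cases j i rule: linorder_cases)
    case less
    have "?S = cscale (ent (Cmat n i j) (n+1+i) j) \<circ> C_op n c q d i j"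
      using assms less
      by (intro double_sum_single) (auto simp add: Cmat_def ent_Emat_diff cscale_comp_0)
    then show ?thesis
      using assms less by (simp add: Cmat_def ent_Emat_diff cscale_comp_1)
  next
    case equal
    have "?S = 0"
      using assms equal
      by (intro sum.neutral ballI) (auto simp add: Cmat_def ent_Emat_diff cscale_comp_0)
    moreover have "C_op n c q d i j = 0"
      using assms equal by (simp add: C_op_def)
    ultimately show ?thesis by simp
  next
    case greater
    have "?S = cscale (ent (Cmat n i j) (n+1+j) i) \<circ> C_op n c q d j i"
      using assms greater
      by (intro double_sum_single) (auto simp add: Cmat_def ent_Emat_diff cscale_comp_0)
    then show ?thesis
      using assms greater by (simp add: Cmat_def ent_Emat_diff cscale_comp_minus_1 C_op_def)
  qed
  then show ?thesis
    unfolding rep_def A B by simp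
qed

definition pi_c :: "nat \<Rightarrow> complex \<Rightarrow> complex mat \<Rightarrow> fn \<Rightarrow> fn" where
  "pi_c n c = rep n c mult_var pderivative"

definition swapped_vars :: "nat \<Rightarrow> nat \<Rightarrow> nat \<Rightarrow> var set" where
  "swapped_vars n n1 n2 = X ` {1..n1} \<union> Y ` {n2+1..n}"

definition swap_q :: "var set \<Rightarrow> assignment" where
  "swap_q S v = (if v \<in> S then pderivative v else mult_var v)"

definition swap_d :: "var set \<Rightarrow> assignment" where
  "swap_d S v = (if v \<in> S then - mult_var v else pderivative v)"

definition pi_c_swap :: "nat \<Rightarrow> nat \<Rightarrow> nat \<Rightarrow> complex \<Rightarrow> complex mat \<Rightarrow> fn \<Rightarrow> fn" where
  "pi_c_swap n n1 n2 c =
     rep n c (swap_q (swapped_vars n n1 n2)) (swap_d (swapped_vars n n1 n2))"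

definition invariant_under :: "nat \<Rightarrow> (complex mat \<Rightarrow> fn \<Rightarrow> fn) \<Rightarrow> fn set \<Rightarrow> bool" where
  "invariant_under n \<rho> W \<longleftrightarrow> (\<forall>M\<in>o_alg n. \<forall>f\<in>W. \<rho> M f \<in> W)"

definition is_representation :: "nat \<Rightarrow> (complex mat \<Rightarrow> fn \<Rightarrow> fn) \<Rightarrow> fn set \<Rightarrow> bool" where
  "is_representation n \<rho> V \<longleftrightarrow>
     fn.subspace V \<and> invariant_under n \<rho> V \<and>
     (\<forall>M\<in>o_alg n. \<forall>f\<in>V. \<forall>g\<in>V. \<rho> M (f + g) = \<rho> M f + \<rho> M g) \<and>
     (\<forall>M\<in>o_alg n. \<forall>f\<in>V. \<forall>t. \<rho> M (cscale t f) = cscale t (\<rho> M f)) \<and>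
     (\<forall>M\<in>o_alg n. \<forall>N\<in>o_alg n. \<forall>f\<in>V. \<rho> (M + N) f = \<rho> M f + \<rho> N f) \<and>
     (\<forall>M\<in>o_alg n. \<forall>f\<in>V. \<forall>t. \<rho> (t \<cdot>\<^sub>m M) f = cscale t (\<rho> M f)) \<and>
     (\<forall>M\<in>o_alg n. \<forall>N\<in>o_alg n. \<forall>f\<in>V. \<rho> (bracket M N) f = \<rho> M (\<rho> N f) - \<rho> N (\<rho> M f))"

definition irreducible_rep :: "nat \<Rightarrow> (complex mat \<Rightarrow> fn \<Rightarrow> fn) \<Rightarrow> fn set \<Rightarrow> bool" where
  "irreducible_rep n \<rho> V \<longleftrightarrow>
     is_representation n \<rho> V \<and> V \<noteq> {0} \<and>
     (\<forall>W. fn.subspace W \<and> W \<subseteq> V \<and> invariant_under n \<rho> W \<longrightarrow> W = {0} \<or> W = V)"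

text \<open>The linear functionals on the Cartan subalgebra; they are \<^const>\<open>extensional\<close>, so that
  different elements of this set are different as functionals.\<close>

definition cartan_dual :: "nat \<Rightarrow> (complex mat \<Rightarrow> complex) set" where
  "cartan_dual n =
     {\<mu> \<in> extensional (cartan n).
        (\<forall>h\<in>cartan n. \<forall>k\<in>cartan n. \<mu> (h + k) = \<mu> h + \<mu> k) \<and>
        (\<forall>h\<in>cartan n. \<forall>t. \<mu> (t \<cdot>\<^sub>m h) = t * \<mu> h)}"

definition weight_space ::
    "nat \<Rightarrow> (complex mat \<Rightarrow> fn \<Rightarrow> fn) \<Rightarrow> fn set \<Rightarrow> (complex mat \<Rightarrow> complex) \<Rightarrow> fn set" where
  "weight_space n \<rho> V \<mu> = {f\<in>V. \<forall>h\<in>cartan n. \<rho> h f = cscale (\<mu> h) f}"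

definition is_direct_sum :: "'i set \<Rightarrow> ('i \<Rightarrow> fn set) \<Rightarrow> fn set \<Rightarrow> bool" where
  "is_direct_sum I U V \<longleftrightarrow>
     (\<forall>i\<in>I. fn.subspace (U i) \<and> U i \<subseteq> V) \<and>
     (\<forall>f\<in>V. \<exists>!u. (\<forall>i\<in>I. u i \<in> U i) \<and> (\<forall>i. i \<notin> I \<longrightarrow> u i = 0) \<and>
               finite {i. u i \<noteq> 0} \<and> f = (\<Sum>i | u i \<noteq> 0. u i))"

definition weight_module :: "nat \<Rightarrow> (complex mat \<Rightarrow> fn \<Rightarrow> fn) \<Rightarrow> fn set \<Rightarrow> bool" where
  "weight_module n \<rho> V \<longleftrightarrow>
     is_representation n \<rho> V \<and> is_direct_sum (cartan_dual n) (weight_space n \<rho> V) V"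

definition finite_dimensional :: "fn set \<Rightarrow> bool" where
  "finite_dimensional V \<longleftrightarrow> (\<exists>B. finite B \<and> fn.span B = V)"

end

theory Submission
  imports Defs
begin

text \<open>Let $q_v$ and $d_v$ be any operators that satisfy the canonical commutation relations, and let
  $v\mapsto\bar v$ exchange $x_i$ and $y_i$. With $D=\sum_vq_vd_v$ and $\eta=\sum_iq_{x_i}q_{y_i}$, the
  representing operators are, up to sign, $d_v$, $R_{v,w}=q_vd_w-q_{\bar w}d_{\bar v}$,
  $K_v=q_v(D+c)-\eta d_{\bar v}$ and $D+c$. Labelling the rows of the matrices by the variables and two
  more slots, all of them are values of one operator $F_{a,b}$, attached to the matrix
  $E_{a,b}-E_{\bar b,\bar a}$, and the single relation \<open>F_bracket\<close> shows that they represent the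
  Lie algebra, whatever the choice of $q$ and $d$.

  Part (i). Dividing by the exponential replaces $\partial_v$ by $\partial_v+a_v$ on polynomials
  (\<open>exp_polys_irreducible\<close>). In a nonzero submodule an element of least degree is annihilated by all
  $\partial_v$ and hence constant. Conversely the constants generate everything: since
  $\sum_va_va_{\bar v}=2\,\vec a\cdot\vec b\neq0$, a combination of the operators $R_{v,w}$ and $D$
  multiplies by a given variable up to terms of no larger degree (\<open>shifted_irreducible\<close>).

  Part (ii). The swapped variables form a set without two paired coordinates. Again an element of least
  degree in a submodule is constant: $d_u=\partial_u$ for unswapped $u$ and then $K_s=\partial_s(D+c)$ for
  swapped $s$ annihilate it, and $D+c$ is injective because $D$ has integer eigenvalues while $c$ is not
  an integer (\<open>one_mem\<close>). In the other direction multiplication by swapped variables is available, and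
  unswapped variables are multiplied in one after another (\<open>raise_middle\<close>, \<open>raise_cj\<close>,
  \<open>raise_unswapped\<close>): either some $R_{v,s}$ with $s$ swapped multiplies by $vs$, or some $K_v$ produces
  the wanted monomial with the coefficient $c$ plus an integer, up to elements that are known to lie in
  the submodule. Monomials are weight vectors,
  and a weight leaves only finitely many possibilities for the exponents
  (\<open>finite_weight_exponents\<close>), so the weight spaces are finite-dimensional.\<close>

section \<open>Monomials and coefficients\<close>

text \<open>Sums of polynomials and of operators are to be handled as elements of a vector space, so the
  pointwise evaluation rules are used only on demand.\<close>

declare plus_fun_apply [simp del] zero_fun_apply [simp del]
  minus_apply [simp del] uminus_apply [simp del]

lemmas fn_apply = plus_fun_apply zero_fun_apply minus_apply uminus_apply

text \<open>Exponents are total functions that vanish off \<^term>\<open>vars n\<close>, so that distinct exponents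
  give distinct monomials.\<close>
definition exps :: "nat \<Rightarrow> (var \<Rightarrow> nat) set" where
  "exps n = {\<alpha>. \<forall>v. v \<notin> vars n \<longrightarrow> \<alpha> v = 0}"

definition monom :: "nat \<Rightarrow> (var \<Rightarrow> nat) \<Rightarrow> fn" where
  "monom n \<alpha> = (\<lambda>p. \<Prod>v\<in>vars n. p v ^ \<alpha> v)"

definition inc :: "var \<Rightarrow> (var \<Rightarrow> nat) \<Rightarrow> var \<Rightarrow> nat" where
  "inc v \<alpha> = \<alpha>(v := Suc (\<alpha> v))"

definition dec :: "var \<Rightarrow> (var \<Rightarrow> nat) \<Rightarrow> var \<Rightarrow> nat" where
  "dec v \<alpha> = \<alpha>(v := \<alpha> v - 1)"

lemma finite_vars [simp]: "finite (vars n)"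
  by (simp add: vars_def)

lemma inc_apply: "inc v \<alpha> w = (if w = v then Suc (\<alpha> v) else \<alpha> w)"
  by (simp add: inc_def)

lemma dec_apply: "dec v \<alpha> w = (if w = v then \<alpha> v - 1 else \<alpha> w)"
  by (simp add: dec_def)

lemma dec_inc [simp]: "dec v (inc v \<alpha>) = \<alpha>"
  by (simp add: inc_def dec_def)

lemma inc_dec [simp]: "\<alpha> v > 0 \<Longrightarrow> inc v (dec v \<alpha>) = \<alpha>"
  by (simp add: inc_def dec_def)

lemma inc_commute: "inc v (inc w \<alpha>) = inc w (inc v \<alpha>)"
  by (auto simp: inc_def fun_eq_iff)

lemma dec_inc_neq: "v \<noteq> w \<Longrightarrow> dec v (inc w \<alpha>) = inc w (dec v \<alpha>)"
  by (auto simp: inc_def dec_def fun_eq_iff)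

lemma inc_exps [simp]: "\<alpha> \<in> exps n \<Longrightarrow> v \<in> vars n \<Longrightarrow> inc v \<alpha> \<in> exps n"
  by (auto simp: exps_def inc_def)

lemma dec_exps [simp]: "\<alpha> \<in> exps n \<Longrightarrow> dec v \<alpha> \<in> exps n"
  by (auto simp: exps_def dec_def)

lemma zero_exps [simp]: "(\<lambda>_. 0) \<in> exps n"
  by (auto simp: exps_def)

lemma plus_exps: "\<alpha> \<in> exps n \<Longrightarrow> \<beta> \<in> exps n \<Longrightarrow> (\<lambda>v. \<alpha> v + \<beta> v) \<in> exps n"
  by (auto simp: exps_def)

lemma monom_zero: "monom n (\<lambda>_. 0) = (\<lambda>p. 1)"
  by (simp add: monom_def)

lemma monom_remove:
  assumes "v \<in> vars n"
  shows "monom n \<alpha> p = p v ^ \<alpha> v * (\<Prod>w\<in>vars n - {v}. p w ^ \<alpha> w)"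
  using assms by (simp add: monom_def prod.remove)

lemma mult_var_monom:
  assumes "v \<in> vars n"
  shows "mult_var v (monom n \<alpha>) = monom n (inc v \<alpha>)"
proof
  fix p :: point
  have "(\<Prod>w\<in>vars n - {v}. p w ^ inc v \<alpha> w) = (\<Prod>w\<in>vars n - {v}. p w ^ \<alpha> w)"
    by (intro prod.cong) (auto simp: inc_apply)
  then show "mult_var v (monom n \<alpha>) p = monom n (inc v \<alpha>) p"
    by (simp add: mult_var_def monom_remove[OF assms] inc_apply)
qed

lemma monom_mult: "monom n \<alpha> p * monom n \<beta> p = monom n (\<lambda>v. \<alpha> v + \<beta> v) p"
  by (simp add: monom_def power_add prod.distrib)

lemma pderivative_monom:
  assumes "v \<in> vars n"
  shows "pderivative v (monom n \<alpha>) = cscale (of_nat (\<alpha> v)) (monom n (dec v \<alpha>))"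
proof
  fix p :: point
  define K where "K = (\<Prod>w\<in>vars n - {v}. p w ^ \<alpha> w)"
  have line: "monom n \<alpha> (p(v := t)) = t ^ \<alpha> v * K" for t
    unfolding monom_remove[OF assms] K_def by (auto intro!: prod.cong)
  have "((\<lambda>t. t ^ \<alpha> v * K) has_field_derivative of_nat (\<alpha> v) * p v ^ (\<alpha> v - 1) * K) (at (p v))"
    by (auto intro!: derivative_eq_intros)
  then have "pderivative v (monom n \<alpha>) p = of_nat (\<alpha> v) * p v ^ (\<alpha> v - 1) * K"
    unfolding pderivative_def line by (rule DERIV_imp_deriv)
  moreover have "(\<Prod>w\<in>vars n - {v}. p w ^ dec v \<alpha> w) = K"
    unfolding K_def by (intro prod.cong) (auto simp: dec_apply)
  ultimately show "pderivative v (monom n \<alpha>) p = cscale (of_nat (\<alpha> v)) (monom n (dec v \<alpha>)) p"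
    by (simp add: cscale_def monom_remove[OF assms] dec_apply)
qed

lemma fn_subspace_polys: "fn.subspace (polys n)"
proof -
  have "cscale t f \<in> polys n" if "f \<in> polys n" for t f
    using polys.mult[OF polys.const that] by (simp add: cscale_def)
  moreover have "f + g \<in> polys n" if "f \<in> polys n" "g \<in> polys n" for f g
    using polys.add[OF that] by (simp add: plus_fun_def)
  moreover have "0 \<in> polys n"
    using polys.const[of 0 n] by (simp add: zero_fun_def)
  ultimately show ?thesis by (simp add: fn.subspace_def)
qed

lemma mult_var_polys: "v \<in> vars n \<Longrightarrow> f \<in> polys n \<Longrightarrow> mult_var v f \<in> polys n"
  unfolding mult_var_def by (intro polys.mult polys.var)

lemma monom_polys [simp]: "monom n \<alpha> \<in> polys n"
proof -
  have pow: "(\<lambda>p. p v ^ k) \<in> polys n" if "v \<in> vars n" for v k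
    by (induction k) (simp_all add: polys.const polys.mult polys.var that)
  have "(\<lambda>p. \<Prod>v\<in>A. p v ^ \<alpha> v) \<in> polys n" if "finite A" "A \<subseteq> vars n" for A
    using that by (induction) (simp_all add: polys.const polys.mult pow)
  then show ?thesis unfolding monom_def by simp
qed

text \<open>The span of the monomials contains the constants and the variables and is closed under
  products, because a product of monomials is a monomial.\<close>

lemma polys_eq_span: "polys n = fn.span (monom n ` exps n)"
proof
  show "fn.span (monom n ` exps n) \<subseteq> polys n"
    by (intro fn.span_minimal fn_subspace_polys) auto
  let ?S = "fn.span (monom n ` exps n)"
  have one: "monom n \<alpha> \<in> ?S" if "\<alpha> \<in> exps n" for \<alpha>
    using that by (intro fn.span_base) auto
  have mm: "(\<lambda>p. f p * monom n \<beta> p) \<in> ?S" if "f \<in> ?S" "\<beta> \<in> exps n" for f \<beta>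
    using that(1)
  proof (induction rule: fn.span_induct_alt)
    case base
    have "(\<lambda>p. (0::fn) p * monom n \<beta> p) = 0" by (auto simp: fun_eq_iff fn_apply)
    then show ?case by (simp add: fn.span_zero)
  next
    case (step c x y)
    then obtain \<alpha> where a: "\<alpha> \<in> exps n" "x = monom n \<alpha>" by auto
    have "(\<lambda>p. (cscale c x + y) p * monom n \<beta> p) =
        cscale c (monom n (\<lambda>v. \<alpha> v + \<beta> v)) + (\<lambda>p. y p * monom n \<beta> p)"
      using a by (auto simp: fun_eq_iff fn_apply cscale_def monom_mult[symmetric] algebra_simps)
    then show ?case
      using step a that(2) by (auto intro!: fn.span_add fn.span_scale one plus_exps)
  qed
  have closed_mult: "(\<lambda>p. f p * g p) \<in> ?S" if "f \<in> ?S" "g \<in> ?S" for f g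
    using that(2)
  proof (induction rule: fn.span_induct_alt)
    case base
    have "(\<lambda>p. f p * (0::fn) p) = 0" by (auto simp: fun_eq_iff fn_apply)
    then show ?case by (simp add: fn.span_zero)
  next
    case (step c x y)
    then obtain \<beta> where a: "\<beta> \<in> exps n" "x = monom n \<beta>" by auto
    have "(\<lambda>p. f p * (cscale c x + y) p) =
        cscale c (\<lambda>p. f p * monom n \<beta> p) + (\<lambda>p. f p * y p)"
      using a by (auto simp: fun_eq_iff fn_apply cscale_def algebra_simps)
    then show ?case
      using step a that(1) by (auto intro!: fn.span_add fn.span_scale mm)
  qed
  show "polys n \<subseteq> ?S"
  proof
    fix f assume "f \<in> polys n"
    then show "f \<in> ?S"
    proof induction
      case (const t)
      have "(\<lambda>p. t) = cscale t (monom n (\<lambda>_. 0))" by (simp add: monom_zero cscale_def)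
      then show ?case by (simp add: fn.span_scale one)
    next
      case (var v)
      have "(\<lambda>p. p v) = mult_var v (monom n (\<lambda>_. 0))" by (simp add: monom_zero mult_var_def)
      then show ?case using var by (simp add: mult_var_monom one)
    next
      case (add f g)
      then show ?case using fn.span_add[OF add.IH] by (simp add: plus_fun_def)
    next
      case (mult f g)
      show ?case using closed_mult[OF mult.IH] .
    qed
  qed
qed

lemma polys_induct [consumes 1, case_names zero step]:
  assumes "f \<in> polys n" "P 0"
    and "\<And>t \<alpha> f. \<alpha> \<in> exps n \<Longrightarrow> f \<in> polys n \<Longrightarrow> P f \<Longrightarrow> P (cscale t (monom n \<alpha>) + f)"
  shows "P f"
proof -
  have "f \<in> fn.span (monom n ` exps n)" using assms(1) polys_eq_span by blast
  then have "f \<in> polys n \<and> P f"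
  proof (induction rule: fn.span_induct_alt)
    case base
    then show ?case using assms(2) fn_subspace_polys by (simp add: fn.subspace_0)
  next
    case (step c x y)
    then show ?case using assms(3) fn_subspace_polys
      by (auto intro!: fn.subspace_add fn.subspace_scale)
  qed
  then show ?thesis ..
qed

lemma polys_zero [simp]: "0 \<in> polys n"
  and polys_add [simp]: "f \<in> polys n \<Longrightarrow> g \<in> polys n \<Longrightarrow> f + g \<in> polys n"
  and polys_scale [simp]: "f \<in> polys n \<Longrightarrow> cscale t f \<in> polys n"
  using fn_subspace_polys by (auto simp: fn.subspace_def)

lemma polys_differentiable:
  assumes "f \<in> polys n"
  shows "(\<lambda>t. f (p(v := t))) field_differentiable at z"
  using assms
proof induction
  case (var w)
  then show ?case by (cases "w = v") auto
qed (simp_all add: field_differentiable_add field_differentiable_mult)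

lemma pderivative_add:
  assumes "f \<in> polys n" "g \<in> polys n"
  shows "pderivative v (f + g) = pderivative v f + pderivative v g"
  using polys_differentiable[OF assms(1)] polys_differentiable[OF assms(2)]
  by (auto simp: pderivative_def fun_eq_iff fn_apply intro!: deriv_add)

lemma pderivative_scale:
  assumes "f \<in> polys n"
  shows "pderivative v (cscale t f) = cscale t (pderivative v f)"
  using polys_differentiable[OF assms] by (auto simp: pderivative_def cscale_def fun_eq_iff fn_apply)

lemma pderivative_zero [simp]: "pderivative v 0 = 0"
  using pderivative_scale[of 0 0 v 0] by simp

lemma pderivative_polys [simp]:
  assumes "v \<in> vars n" "f \<in> polys n"
  shows "pderivative v f \<in> polys n"
  using assms(2)
  by (induction rule: polys_induct)
     (simp_all add: pderivative_add[of _ n] pderivative_scale[of _ n] pderivative_monom assms(1))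

lemma mult_var_add: "mult_var v (f + g) = mult_var v f + mult_var v g"
  and mult_var_scale: "mult_var v (cscale t f) = cscale t (mult_var v f)"
  and mult_var_zero [simp]: "mult_var v 0 = 0"
  by (auto simp: mult_var_def cscale_def fun_eq_iff fn_apply algebra_simps)

text \<open>Monomials are linearly independent because they are joint eigenvectors of the operators
  $x_v\partial_v$, and two different exponents \<open>\<alpha>\<close>, \<open>\<beta>\<close> are told apart by the eigenvalue of one of
  them. Applying $x_v\partial_v - \beta_v$ to a linear relation removes the term of \<open>\<beta>\<close> and keeps
  that of \<open>\<alpha>\<close>, which is the induction step.\<close>

lemma monom_coefficients_zero:
  assumes "finite A" "A \<subseteq> exps n" "(\<Sum>\<alpha>\<in>A. cscale (u \<alpha>) (monom n \<alpha>)) = 0" "\<alpha> \<in> A"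
  shows "u \<alpha> = 0"
  using assms
proof (induction "card A" arbitrary: A u \<alpha>)
  case 0
  then show ?case by simp
next
  case (Suc k)
  show ?case
  proof (cases "A = {\<alpha>}")
    case True
    then have "cscale (u \<alpha>) (monom n \<alpha>) = 0" using Suc.prems(3) by simp
    then have "cscale (u \<alpha>) (monom n \<alpha>) (\<lambda>_. 1) = 0" by (simp only: zero_fun_apply)
    then show ?thesis by (simp add: cscale_def monom_def)
  next
    case False
    then obtain \<beta> where b: "\<beta> \<in> A" "\<beta> \<noteq> \<alpha>" using Suc.prems(4) by blast
    then obtain v where v: "\<alpha> v \<noteq> \<beta> v" by (metis ext)
    have vv: "v \<in> vars n"
    proof (rule ccontr)
      assume "v \<notin> vars n"
      then have "\<alpha> v = 0" "\<beta> v = 0" using b(1) Suc.prems(2,4) unfolding exps_def by blast+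
      then show False using v by simp
    qed
    let ?T = "\<lambda>f. mult_var v (pderivative v f) + cscale (- of_nat (\<beta> v)) f"
    have T_monom: "?T (cscale t (monom n \<gamma>)) =
        cscale (t * (of_nat (\<gamma> v) - of_nat (\<beta> v))) (monom n \<gamma>)" for t \<gamma>
    proof -
      have "mult_var v (pderivative v (cscale t (monom n \<gamma>))) = cscale (t * of_nat (\<gamma> v)) (monom n \<gamma>)"
        by (cases "\<gamma> v = 0")
           (simp_all add: pderivative_scale[of _ n] pderivative_monom vv mult_var_scale mult_var_monom)
      then show ?thesis by (simp add: fn.scale_left_distrib[symmetric] algebra_simps)
    qed
    have T_sum: "?T (\<Sum>\<gamma>\<in>B. cscale (u \<gamma>) (monom n \<gamma>)) =
        (\<Sum>\<gamma>\<in>B. cscale (u \<gamma> * (of_nat (\<gamma> v) - of_nat (\<beta> v))) (monom n \<gamma>))" if "finite B" for B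
      using that
    proof (induction B)
      case empty
      then show ?case by simp
    next
      case (insert \<gamma> B)
      have "(\<Sum>\<gamma>\<in>B. cscale (u \<gamma>) (monom n \<gamma>)) \<in> polys n"
        by (intro fn.subspace_sum fn_subspace_polys polys_scale monom_polys)
      then have "?T (cscale (u \<gamma>) (monom n \<gamma>) + (\<Sum>\<gamma>\<in>B. cscale (u \<gamma>) (monom n \<gamma>))) =
          ?T (cscale (u \<gamma>) (monom n \<gamma>)) + ?T (\<Sum>\<gamma>\<in>B. cscale (u \<gamma>) (monom n \<gamma>))"
        by (simp add: pderivative_add[of _ n] mult_var_add fn.scale_right_distrib)
      then show ?case
        unfolding insert.IH T_monom sum.insert[OF insert.hyps] .
    qed
    have "(\<Sum>\<gamma>\<in>A. cscale (u \<gamma> * (of_nat (\<gamma> v) - of_nat (\<beta> v))) (monom n \<gamma>)) = 0"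
      using T_sum[OF Suc.prems(1)] Suc.prems(3) by simp
    then have "(\<Sum>\<gamma>\<in>A - {\<beta>}. cscale (u \<gamma> * (of_nat (\<gamma> v) - of_nat (\<beta> v))) (monom n \<gamma>)) = 0"
      using b(1) Suc.prems(1) by (simp add: sum.remove)
    moreover have "k = card (A - {\<beta>})" using Suc.hyps(2) Suc.prems(1) b(1) by simp
    moreover have "finite (A - {\<beta>})" "A - {\<beta>} \<subseteq> exps n" "\<alpha> \<in> A - {\<beta>}"
      using Suc.prems b by auto
    ultimately have "u \<alpha> * (of_nat (\<alpha> v) - of_nat (\<beta> v)) = 0"
      using Suc.hyps(1)[of "A - {\<beta>}" "\<lambda>\<gamma>. u \<gamma> * (of_nat (\<gamma> v) - of_nat (\<beta> v))" \<alpha>]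
      by blast
    then show ?thesis using v by simp
  qed
qed

lemma monom_inj_on: "inj_on (monom n) (exps n)"
proof (rule inj_onI, rule ccontr)
  fix \<alpha> \<beta> assume a: "\<alpha> \<in> exps n" "\<beta> \<in> exps n" "monom n \<alpha> = monom n \<beta>" "\<alpha> \<noteq> \<beta>"
  let ?u = "\<lambda>\<gamma>. if \<gamma> = \<alpha> then 1 else -1 :: complex"
  have "?u \<alpha> = 0"
    using a by (intro monom_coefficients_zero[of "{\<alpha>, \<beta>}" n ?u \<alpha>]) auto
  then show False by simp
qed

lemma monom_independent: "fn.independent (monom n ` exps n)"
proof (rule notI)
  assume "fn.dependent (monom n ` exps n)"
  then obtain t u f where t: "finite t" "t \<subseteq> monom n ` exps n" "(\<Sum>v\<in>t. cscale (u v) v) = 0"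
      "f \<in> t" "u f \<noteq> 0"
    unfolding fn.dependent_explicit by (elim exE conjE bexE) (rule that)
  then obtain A where A: "A \<subseteq> exps n" "t = monom n ` A" by (auto simp: subset_image_iff)
  have inj: "inj_on (monom n) A" using monom_inj_on A(1) by (rule inj_on_subset)
  have fin: "finite A" using inj t(1) A(2) by (simp add: finite_image_iff)
  have eq0: "(\<Sum>\<alpha>\<in>A. cscale (u (monom n \<alpha>)) (monom n \<alpha>)) = 0"
    using t(3) unfolding A(2) sum.reindex[OF inj] o_def .
  obtain \<alpha> where \<alpha>: "\<alpha> \<in> A" "f = monom n \<alpha>" using A(2) t(4) by blast
  show False
    using monom_coefficients_zero[OF fin A(1) eq0 \<alpha>(1)] t(5) \<alpha>(2) by simp
qed

definition coef :: "nat \<Rightarrow> fn \<Rightarrow> (var \<Rightarrow> nat) \<Rightarrow> complex" where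
  "coef n f \<alpha> = fn.representation (monom n ` exps n) f (monom n \<alpha>)"

lemma coef_add:
  "f \<in> polys n \<Longrightarrow> g \<in> polys n \<Longrightarrow> coef n (f + g) \<alpha> = coef n f \<alpha> + coef n g \<alpha>"
  unfolding coef_def polys_eq_span by (simp add: fn.representation_add monom_independent)

lemma coef_scale: "f \<in> polys n \<Longrightarrow> coef n (cscale t f) \<alpha> = t * coef n f \<alpha>"
  unfolding coef_def polys_eq_span by (simp add: fn.representation_scale monom_independent)

lemma coef_zero [simp]: "coef n 0 \<alpha> = 0"
  using coef_scale[of 0 n 0] by simp

lemma coef_monom:
  "\<alpha> \<in> exps n \<Longrightarrow> \<beta> \<in> exps n \<Longrightarrow> coef n (monom n \<alpha>) \<beta> = (if \<alpha> = \<beta> then 1 else 0)"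
  unfolding coef_def
  by (auto simp: fn.representation_basis monom_independent inj_on_eq_iff[OF monom_inj_on])

lemma finite_coef_support: "finite {\<alpha> \<in> exps n. coef n f \<alpha> \<noteq> 0}"
proof -
  have "finite {b. fn.representation (monom n ` exps n) f b \<noteq> 0}"
    by (rule fn.finite_representation)
  then have "finite (monom n -` {b. fn.representation (monom n ` exps n) f b \<noteq> 0} \<inter> exps n)"
    by (rule finite_vimage_IntI[OF _ monom_inj_on])
  then show ?thesis by (rule rev_finite_subset) (auto simp: coef_def)
qed

lemma polys_expansion:
  assumes "f \<in> polys n"
  shows "f = (\<Sum>\<alpha> | \<alpha> \<in> exps n \<and> coef n f \<alpha> \<noteq> 0. cscale (coef n f \<alpha>) (monom n \<alpha>))"
proof -
  let ?r = "fn.representation (monom n ` exps n) f"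
  have supp: "{b. ?r b \<noteq> 0} = monom n ` {\<alpha>. \<alpha> \<in> exps n \<and> coef n f \<alpha> \<noteq> 0}"
    using fn.representation_ne_zero[of "monom n ` exps n" f] by (auto simp: coef_def image_iff)
  have inj: "inj_on (monom n) {\<alpha>. \<alpha> \<in> exps n \<and> coef n f \<alpha> \<noteq> 0}"
    using monom_inj_on by (rule inj_on_subset) auto
  have "(\<Sum>b | ?r b \<noteq> 0. cscale (?r b) b) = f"
    using assms unfolding polys_eq_span
    by (simp add: fn.sum_nonzero_representation_eq monom_independent)
  then have "f = (\<Sum>b | ?r b \<noteq> 0. cscale (?r b) b)" by (rule sym)
  also have "(\<Sum>b | ?r b \<noteq> 0. cscale (?r b) b) =
      (\<Sum>\<alpha> | \<alpha> \<in> exps n \<and> coef n f \<alpha> \<noteq> 0. cscale (coef n f \<alpha>) (monom n \<alpha>))"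
    unfolding supp sum.reindex[OF inj] by (simp only: o_def coef_def)
  finally show ?thesis .
qed

lemma polys_eq_0I:
  assumes "f \<in> polys n" "\<And>\<alpha>. \<alpha> \<in> exps n \<Longrightarrow> coef n f \<alpha> = 0"
  shows "f = 0"
proof -
  have "{\<alpha>. \<alpha> \<in> exps n \<and> coef n f \<alpha> \<noteq> 0} = {}" using assms(2) by auto
  then show ?thesis by (subst polys_expansion[OF assms(1)]) (simp only: sum.empty)
qed

lemma coef_pderivative:
  assumes "f \<in> polys n" "v \<in> vars n" "\<alpha> \<in> exps n"
  shows "coef n (pderivative v f) \<alpha> = of_nat (Suc (\<alpha> v)) * coef n f (inc v \<alpha>)"
  using assms(1)
proof (induction rule: polys_induct)
  case (step t \<beta> f)
  have eq: "\<beta> = inc v \<alpha> \<longleftrightarrow> dec v \<beta> = \<alpha> \<and> \<beta> v > 0"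
    by (metis dec_inc inc_apply inc_dec zero_less_Suc)
  have "coef n (pderivative v (monom n \<beta>)) \<alpha> = of_nat (Suc (\<alpha> v)) * coef n (monom n \<beta>) (inc v \<alpha>)"
    using assms step.hyps
    by (cases "\<beta> v = 0"; cases "dec v \<beta> = \<alpha>")
       (auto simp: pderivative_monom coef_scale coef_monom eq dec_apply)
  then show ?case
    using step assms
    by (simp add: pderivative_add[of _ n] pderivative_scale[of _ n] coef_add coef_scale algebra_simps)
qed simp

section \<open>The commutation relations\<close>

text \<open>The coordinate paired with a given one in $\eta=\sum_i x_iy_i$.\<close>

fun cj :: "var \<Rightarrow> var" where
  "cj (X i) = Y i"
| "cj (Y i) = X i"

lemma cj_cj [simp]: "cj (cj v) = v"
  by (cases v) auto

lemma cj_eq_iff [simp]: "cj v = cj w \<longleftrightarrow> v = w"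
  by (metis cj_cj)

lemma cj_swap: "cj v = w \<longleftrightarrow> v = cj w"
  by auto

lemma cj_vars [simp]: "cj v \<in> vars n \<longleftrightarrow> v \<in> vars n"
  by (cases v) (auto simp: vars_def)

lemma cj_neq [simp]: "cj v \<noteq> v" "v \<noteq> cj v"
  by (cases v; simp)+

lemma X_vars [simp]: "X i \<in> vars n \<longleftrightarrow> i \<in> {1..n}"
  and Y_vars [simp]: "Y i \<in> vars n \<longleftrightarrow> i \<in> {1..n}"
  by (auto simp: vars_def)

lemma sum_vars: "(\<Sum>v\<in>vars n. g v) = (\<Sum>i=1..n. g (X i)) + (\<Sum>i=1..n. g (Y i))"
  for g :: "var \<Rightarrow> 'a::comm_monoid_add"
  unfolding vars_def by (subst sum.union_disjoint) (auto simp: sum.reindex inj_on_def)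

lemma sum_fun_apply: "(\<Sum>i\<in>I. F i) x = (\<Sum>i\<in>I. F i x)"
  for F :: "'i \<Rightarrow> 'a \<Rightarrow> 'b::comm_monoid_add"
  by (induction I rule: infinite_finite_induct) (simp_all add: fn_apply)

declare fn.scale_right_distrib [simp] fn.scale_right_diff_distrib [simp] fn.scale_minus_right [simp]

lemma cscale_2: "cscale 2 f = f + f"
  by (simp add: cscale_def fun_eq_iff fn_apply)

lemma euler_op_eq: "euler_op n q d f = (\<Sum>v\<in>vars n. q v (d v f))"
  by (simp add: euler_op_def fn_apply sum_fun_apply sum_vars)

lemma eta_op_eq: "eta_op n q f = (\<Sum>i=1..n. q (X i) (q (Y i) f))"
  by (simp add: eta_op_def sum_fun_apply)

text \<open>Rows and columns of the matrices in $o(2n+2,\mathbb{C})$ are labelled by the $2n$ coordinates and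
  two further slots, \<open>Inf\<close> for the index $n+1$ and \<open>Nul\<close> for the index $2n+2$. The invariant bilinear
  form pairs a slot with its \<open>bar\<close>.\<close>

datatype slot = Coord var | Inf | Nul

fun bar :: "slot \<Rightarrow> slot" where
  "bar (Coord v) = Coord (cj v)"
| "bar Inf = Nul"
| "bar Nul = Inf"

text \<open>A module over the Weyl algebra, given by the operators \<open>q v\<close> and \<open>d v\<close> for the generators $v$
  and $\partial_v$. The relations are required on \<open>V\<close> only, since \<^const>\<open>pderivative\<close> is not linear on
  arbitrary functions.\<close>

locale weyl_module =
  fixes n :: nat and c :: complex and q d :: assignment and V :: "fn set"
  assumes subspace_V: "fn.subspace V"
    and q_closed [simp]: "v \<in> vars n \<Longrightarrow> f \<in> V \<Longrightarrow> q v f \<in> V"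
    and d_closed [simp]: "v \<in> vars n \<Longrightarrow> f \<in> V \<Longrightarrow> d v f \<in> V"
    and q_add [simp]: "v \<in> vars n \<Longrightarrow> f \<in> V \<Longrightarrow> g \<in> V \<Longrightarrow> q v (f + g) = q v f + q v g"
    and d_add [simp]: "v \<in> vars n \<Longrightarrow> f \<in> V \<Longrightarrow> g \<in> V \<Longrightarrow> d v (f + g) = d v f + d v g"
    and q_scale [simp]: "v \<in> vars n \<Longrightarrow> f \<in> V \<Longrightarrow> q v (cscale t f) = cscale t (q v f)"
    and d_scale [simp]: "v \<in> vars n \<Longrightarrow> f \<in> V \<Longrightarrow> d v (cscale t f) = cscale t (d v f)"
    and q_q: "v \<in> vars n \<Longrightarrow> w \<in> vars n \<Longrightarrow> f \<in> V \<Longrightarrow> q v (q w f) = q w (q v f)"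
    and d_d: "v \<in> vars n \<Longrightarrow> w \<in> vars n \<Longrightarrow> f \<in> V \<Longrightarrow> d v (d w f) = d w (d v f)"
    and d_q: "v \<in> vars n \<Longrightarrow> w \<in> vars n \<Longrightarrow> f \<in> V \<Longrightarrow>
      d v (q w f) = q w (d v f) + (if v = w then f else 0)"
begin

lemma V_add [simp]: "f \<in> V \<Longrightarrow> g \<in> V \<Longrightarrow> f + g \<in> V"
  and V_scale [simp]: "f \<in> V \<Longrightarrow> cscale t f \<in> V"
  and V_zero [simp]: "0 \<in> V"
  and V_diff [simp]: "f \<in> V \<Longrightarrow> g \<in> V \<Longrightarrow> f - g \<in> V"
  and V_neg [simp]: "f \<in> V \<Longrightarrow> - f \<in> V"
  using subspace_V by (auto simp: fn.subspace_add fn.subspace_scale fn.subspace_0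
      fn.subspace_diff fn.subspace_neg)

lemma V_sum [simp]: "(\<And>i. i \<in> I \<Longrightarrow> g i \<in> V) \<Longrightarrow> (\<Sum>i\<in>I. g i) \<in> V"
  using subspace_V by (rule fn.subspace_sum)

lemma q_zero [simp]: "v \<in> vars n \<Longrightarrow> q v 0 = 0"
  and d_zero [simp]: "v \<in> vars n \<Longrightarrow> d v 0 = 0"
  using q_scale[of v 0 0] d_scale[of v 0 0] by simp_all

lemma q_neg [simp]: "v \<in> vars n \<Longrightarrow> f \<in> V \<Longrightarrow> q v (- f) = - q v f"
  and d_neg [simp]: "v \<in> vars n \<Longrightarrow> f \<in> V \<Longrightarrow> d v (- f) = - d v f"
  using q_scale[of v f "-1"] d_scale[of v f "-1"] by simp_all

lemma q_diff [simp]: "v \<in> vars n \<Longrightarrow> f \<in> V \<Longrightarrow> g \<in> V \<Longrightarrow> q v (f - g) = q v f - q v g"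
  and d_diff [simp]: "v \<in> vars n \<Longrightarrow> f \<in> V \<Longrightarrow> g \<in> V \<Longrightarrow> d v (f - g) = d v f - d v g"
  using q_add[of v f "- g"] d_add[of v f "- g"] by simp_all

lemma q_sum: "v \<in> vars n \<Longrightarrow> (\<And>i. i \<in> I \<Longrightarrow> g i \<in> V) \<Longrightarrow> q v (\<Sum>i\<in>I. g i) = (\<Sum>i\<in>I. q v (g i))"
  and d_sum: "v \<in> vars n \<Longrightarrow> (\<And>i. i \<in> I \<Longrightarrow> g i \<in> V) \<Longrightarrow> d v (\<Sum>i\<in>I. g i) = (\<Sum>i\<in>I. d v (g i))"
  by (induction I rule: infinite_finite_induct) simp_all

definition E :: "fn \<Rightarrow> fn" where "E f = (\<Sum>v\<in>vars n. q v (d v f))"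

definition H :: "fn \<Rightarrow> fn" where "H f = (\<Sum>i=1..n. q (X i) (q (Y i) f))"

lemma E_closed [simp]: "f \<in> V \<Longrightarrow> E f \<in> V"
  and H_closed [simp]: "f \<in> V \<Longrightarrow> H f \<in> V"
  unfolding E_def H_def by (rule V_sum; simp)+

lemma E_add [simp]: "f \<in> V \<Longrightarrow> g \<in> V \<Longrightarrow> E (f + g) = E f + E g"
  and H_add [simp]: "f \<in> V \<Longrightarrow> g \<in> V \<Longrightarrow> H (f + g) = H f + H g"
  by (simp_all add: E_def H_def sum.distrib)

lemma E_diff [simp]: "f \<in> V \<Longrightarrow> g \<in> V \<Longrightarrow> E (f - g) = E f - E g"
  and H_diff [simp]: "f \<in> V \<Longrightarrow> g \<in> V \<Longrightarrow> H (f - g) = H f - H g"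
  by (simp_all add: E_def H_def sum_subtractf)

lemma E_neg [simp]: "f \<in> V \<Longrightarrow> E (- f) = - E f"
  and H_neg [simp]: "f \<in> V \<Longrightarrow> H (- f) = - H f"
  by (simp_all add: E_def H_def sum_negf)

lemma E_zero [simp]: "E 0 = 0"
  and H_zero [simp]: "H 0 = 0"
  by (simp_all add: E_def H_def)

lemma E_scale [simp]: "f \<in> V \<Longrightarrow> E (cscale t f) = cscale t (E f)"
  and H_scale [simp]: "f \<in> V \<Longrightarrow> H (cscale t f) = cscale t (H f)"
  by (simp_all add: E_def H_def fn.scale_sum_right)

lemma E_q: "v \<in> vars n \<Longrightarrow> f \<in> V \<Longrightarrow> E (q v f) = q v (E f) + q v f"
proof -
  assume v: "v \<in> vars n" "f \<in> V"
  have "E (q v f) = (\<Sum>w\<in>vars n. q w (q v (d w f)) + (if w = v then q w f else 0))"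
    unfolding E_def by (rule sum.cong[OF refl]) (use v in \<open>simp add: d_q\<close>)
  also have "\<dots> = (\<Sum>w\<in>vars n. q v (q w (d w f))) + q v f"
    using v by (simp add: sum.distrib q_q[of _ v])
  also have "(\<Sum>w\<in>vars n. q v (q w (d w f))) = q v (E f)"
    using v by (simp add: E_def q_sum)
  finally show ?thesis .
qed

lemma d_E: "v \<in> vars n \<Longrightarrow> f \<in> V \<Longrightarrow> d v (E f) = E (d v f) + d v f"
proof -
  assume v: "v \<in> vars n" "f \<in> V"
  have "d v (E f) = (\<Sum>w\<in>vars n. d v (q w (d w f)))"
    using v by (simp add: E_def d_sum)
  also have "\<dots> = (\<Sum>w\<in>vars n. q w (d w (d v f)) + (if v = w then d w f else 0))"
    by (rule sum.cong[OF refl]) (use v in \<open>simp add: d_q d_d[of v]\<close>)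
  also have "\<dots> = E (d v f) + d v f"
    using v by (simp add: sum.distrib E_def)
  finally show ?thesis .
qed

lemma H_q: "v \<in> vars n \<Longrightarrow> f \<in> V \<Longrightarrow> H (q v f) = q v (H f)"
proof -
  assume v: "v \<in> vars n" "f \<in> V"
  have "q v (H f) = (\<Sum>i=1..n. q v (q (X i) (q (Y i) f)))"
    unfolding H_def by (rule q_sum) (use v in auto)
  also have "\<dots> = H (q v f)"
    unfolding H_def by (rule sum.cong[OF refl]) (use v in \<open>simp add: q_q[of v]\<close>)
  finally show ?thesis ..
qed

lemma d_H: "v \<in> vars n \<Longrightarrow> f \<in> V \<Longrightarrow> d v (H f) = H (d v f) + q (cj v) f"
proof -
  assume v: "v \<in> vars n" "f \<in> V"
  have "d v (H f) = (\<Sum>i=1..n. d v (q (X i) (q (Y i) f)))"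
    unfolding H_def by (rule d_sum) (use v in auto)
  also have "\<dots> = (\<Sum>i=1..n. q (X i) (q (Y i) (d v f))
      + ((if v = Y i then q (X i) f else 0) + (if v = X i then q (Y i) f else 0)))"
    by (rule sum.cong[OF refl]) (use v in \<open>simp add: d_q\<close>)
  also have "\<dots> = H (d v f) + (\<Sum>i=1..n. (if v = Y i then q (X i) f else 0) + (if v = X i then q (Y i) f else 0))"
    by (simp add: sum.distrib H_def)
  also have "(\<Sum>i=1..n. (if v = Y i then q (X i) f else 0) + (if v = X i then q (Y i) f else 0)) = q (cj v) f"
    using v by (cases v) simp_all
  finally show ?thesis .
qed

lemma E_H: "f \<in> V \<Longrightarrow> E (H f) = H (E f) + cscale 2 (H f)"
proof -
  assume f: "f \<in> V"
  have E_sum: "E (\<Sum>i\<in>I. g i) = (\<Sum>i\<in>I. E (g i))" if "\<And>i. i \<in> I \<Longrightarrow> g i \<in> V" for g and I :: "nat set"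
    using that by (induction I rule: infinite_finite_induct) simp_all
  have "E (H f) = (\<Sum>i=1..n. E (q (X i) (q (Y i) f)))"
    unfolding H_def by (rule E_sum) (use f in auto)
  also have "\<dots> = (\<Sum>i=1..n. q (X i) (q (Y i) (E f)) + cscale 2 (q (X i) (q (Y i) f)))"
    by (rule sum.cong[OF refl]) (use f in \<open>simp add: E_q cscale_2\<close>)
  also have "\<dots> = H (E f) + cscale 2 (H f)"
    by (simp add: sum.distrib H_def fn.scale_sum_right)
  finally show ?thesis .
qed

text \<open>Up to sign, the basis elements of $o(2n+2,\mathbb{C})$ act by $\partial_v$, by the rotations \<open>R v w\<close>,
  by the conformal operators \<open>K v\<close> and by $D+c$. The function \<open>F\<close> collects them: \<open>F a b\<close> is the
  operator of the matrix $E_{a,b}-E_{\bar b,\bar a}$.\<close>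

definition R :: "var \<Rightarrow> var \<Rightarrow> fn \<Rightarrow> fn" where
  "R v w f = q v (d w f) - q (cj w) (d (cj v) f)"

definition K :: "var \<Rightarrow> fn \<Rightarrow> fn" where
  "K v f = q v (E f + cscale c f) - H (d (cj v) f)"

fun F :: "slot \<Rightarrow> slot \<Rightarrow> fn \<Rightarrow> fn" where
  "F (Coord v) (Coord w) f = R v w f"
| "F (Coord v) Inf f = - K v f"
| "F (Coord v) Nul f = - d (cj v) f"
| "F Inf (Coord v) f = d v f"
| "F Nul (Coord v) f = K (cj v) f"
| "F Inf Inf f = - (E f + cscale c f)"
| "F Nul Nul f = E f + cscale c f"
| "F Inf Nul f = 0"
| "F Nul Inf f = 0"

definition slots :: "slot set" where "slots = insert Inf (insert Nul (Coord ` vars n))"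

lemma R_closed [simp]: "v \<in> vars n \<Longrightarrow> w \<in> vars n \<Longrightarrow> f \<in> V \<Longrightarrow> R v w f \<in> V"
  and K_closed [simp]: "v \<in> vars n \<Longrightarrow> f \<in> V \<Longrightarrow> K v f \<in> V"
  by (simp_all add: R_def K_def)

lemma R_add [simp]: "v \<in> vars n \<Longrightarrow> w \<in> vars n \<Longrightarrow> f \<in> V \<Longrightarrow> g \<in> V \<Longrightarrow> R v w (f + g) = R v w f + R v w g"
  and K_add [simp]: "v \<in> vars n \<Longrightarrow> f \<in> V \<Longrightarrow> g \<in> V \<Longrightarrow> K v (f + g) = K v f + K v g"
  by (simp_all add: R_def K_def fn.scale_right_distrib algebra_simps)

lemma R_scale [simp]: "v \<in> vars n \<Longrightarrow> w \<in> vars n \<Longrightarrow> f \<in> V \<Longrightarrow> R v w (cscale t f) = cscale t (R v w f)"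
  and K_scale [simp]: "v \<in> vars n \<Longrightarrow> f \<in> V \<Longrightarrow> K v (cscale t f) = cscale t (K v f)"
  by (simp_all add: R_def K_def fn.scale_right_distrib fn.scale_right_diff_distrib mult.commute)

lemma R_neg [simp]: "v \<in> vars n \<Longrightarrow> w \<in> vars n \<Longrightarrow> f \<in> V \<Longrightarrow> R v w (- f) = - R v w f"
  and K_neg [simp]: "v \<in> vars n \<Longrightarrow> f \<in> V \<Longrightarrow> K v (- f) = - K v f"
  using R_scale[of v w f "-1"] K_scale[of v f "-1"] by simp_all

lemma R_zero [simp]: "v \<in> vars n \<Longrightarrow> w \<in> vars n \<Longrightarrow> R v w 0 = 0"
  and K_zero [simp]: "v \<in> vars n \<Longrightarrow> K v 0 = 0"
  using R_scale[of v w 0 0] K_scale[of v 0 0] by simp_all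

lemma R_diff [simp]: "v \<in> vars n \<Longrightarrow> w \<in> vars n \<Longrightarrow> f \<in> V \<Longrightarrow> g \<in> V \<Longrightarrow> R v w (f - g) = R v w f - R v w g"
  and K_diff [simp]: "v \<in> vars n \<Longrightarrow> f \<in> V \<Longrightarrow> g \<in> V \<Longrightarrow> K v (f - g) = K v f - K v g"
  using R_add[of v w f "- g"] K_add[of v f "- g"] by simp_all

text \<open>The brackets of the four kinds of operators, mostly in the form of exchange rules, so that rewriting
  with them brings products of two operators to a normal form.\<close>

lemma R_R:
  assumes "v \<in> vars n" "w \<in> vars n" "x \<in> vars n" "y \<in> vars n" "f \<in> V"
  shows "R v w (R x y f) - R x y (R v w f) =
    (if w = x then R v y f else 0) - (if y = v then R x w f else 0)
    - (if w = cj y then R v (cj x) f else 0) + (if cj x = v then R (cj y) w f else 0)"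
  using assms by (simp add: R_def d_q) (auto simp: d_d q_q cj_swap)

lemma E_d: "v \<in> vars n \<Longrightarrow> f \<in> V \<Longrightarrow> E (d v f) = d v (E f) - d v f"
  by (simp add: d_E)

lemma E_R: "v \<in> vars n \<Longrightarrow> w \<in> vars n \<Longrightarrow> f \<in> V \<Longrightarrow> E (R v w f) = R v w (E f)"
  by (simp add: R_def E_q E_d)

lemma E_K: "v \<in> vars n \<Longrightarrow> f \<in> V \<Longrightarrow> E (K v f) = K v (E f) + K v f"
  by (simp add: K_def E_q E_d E_H) (simp add: cscale_2 algebra_simps)

lemma d_R: "v \<in> vars n \<Longrightarrow> w \<in> vars n \<Longrightarrow> x \<in> vars n \<Longrightarrow> f \<in> V \<Longrightarrow>
    d x (R v w f) = R v w (d x f) + (if x = v then d w f else 0) - (if x = cj w then d (cj v) f else 0)"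
  by (simp add: R_def d_q d_d[of x])

lemma d_K: "v \<in> vars n \<Longrightarrow> w \<in> vars n \<Longrightarrow> f \<in> V \<Longrightarrow>
    d w (K v f) = K v (d w f) + (if w = v then E f + cscale c f else 0) + R v w f"
  by (simp add: R_def K_def d_q d_H d_E d_d[of w] algebra_simps)

lemma R_q: "v \<in> vars n \<Longrightarrow> w \<in> vars n \<Longrightarrow> x \<in> vars n \<Longrightarrow> f \<in> V \<Longrightarrow>
    R v w (q x f) = q x (R v w f) + (if w = x then q v f else 0) - (if cj v = x then q (cj w) f else 0)"
  by (simp add: R_def d_q q_q[of x])

lemma R_H: "v \<in> vars n \<Longrightarrow> w \<in> vars n \<Longrightarrow> f \<in> V \<Longrightarrow> R v w (H f) = H (R v w f)"
  by (simp add: R_def d_H H_q q_q[of v])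

lemma R_d: "v \<in> vars n \<Longrightarrow> w \<in> vars n \<Longrightarrow> x \<in> vars n \<Longrightarrow> f \<in> V \<Longrightarrow>
    R v w (d x f) = d x (R v w f) - (if x = v then d w f else 0) + (if x = cj w then d (cj v) f else 0)"
  by (simp add: d_R)

lemma R_K: "v \<in> vars n \<Longrightarrow> w \<in> vars n \<Longrightarrow> x \<in> vars n \<Longrightarrow> f \<in> V \<Longrightarrow>
    R v w (K x f) = K x (R v w f) + (if w = x then K v f else 0) - (if cj x = v then K (cj w) f else 0)"
  unfolding K_def by (simp add: R_q R_H R_d E_R fn.scale_right_distrib fn.scale_right_diff_distrib) (auto simp: cj_swap)

lemma K_q: "v \<in> vars n \<Longrightarrow> x \<in> vars n \<Longrightarrow> f \<in> V \<Longrightarrow>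
    K v (q x f) = q x (K v f) + q v (q x f) - (if cj v = x then H f else 0)"
  by (simp add: K_def E_q d_q H_q q_q[of x] algebra_simps)

lemma K_H: "v \<in> vars n \<Longrightarrow> f \<in> V \<Longrightarrow> K v (H f) = H (K v f) + q v (H f)"
  by (simp add: K_def E_H d_H H_q) (simp add: cscale_2 algebra_simps)

text \<open>Moving \<open>K v\<close> through the factors of \<open>K w\<close> produces $q_vq_w(D+c)$, terms $\eta\,q\,d$ and, for paired
  variables, $\eta(D+c)$. Each of them occurs twice, with opposite signs.\<close>

lemma K_K:
  assumes "v \<in> vars n" "w \<in> vars n" "f \<in> V"
  shows "K v (K w f) = K w (K v f)"
proof -
  have "K v (K w f) = q w (K v (E f) + cscale c (K v f)) + q v (q w (E f + cscale c f))
     - (if cj v = w then H (E f + cscale c f) else 0)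
     - H (K v (d (cj w) f)) - q v (H (d (cj w) f))"
    using assms by (subst (2) K_def) (simp add: K_q K_H)
  also have "\<dots> = q w (E (K v f) - K v f + cscale c (K v f)) + q v (q w (E f + cscale c f))
     - H (d (cj w) (K v f) - R v (cj w) f) - q v (H (d (cj w) f))"
    using assms by (simp add: E_K d_K cj_swap)
  also have "\<dots> = K w (K v f) "
    using assms by (simp add: R_def) (simp add: K_def R_def q_q[of w] H_q d_q)
  finally show ?thesis .
qed

lemma F_closed [simp]: "a \<in> slots \<Longrightarrow> b \<in> slots \<Longrightarrow> f \<in> V \<Longrightarrow> F a b f \<in> V"
  by (auto simp: slots_def)

lemma F_add: "a \<in> slots \<Longrightarrow> b \<in> slots \<Longrightarrow> f \<in> V \<Longrightarrow> g \<in> V \<Longrightarrow> F a b (f + g) = F a b f + F a b g"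
  by (auto simp: slots_def fn.scale_right_distrib)

lemma F_scale: "a \<in> slots \<Longrightarrow> b \<in> slots \<Longrightarrow> f \<in> V \<Longrightarrow> F a b (cscale t f) = cscale t (F a b f)"
  by (auto simp: slots_def fn.scale_right_distrib mult.commute)

text \<open>One relation contains all the commutation relations of the Lie algebra, because it has the
  same form as the bracket of the matrices $E_{a,b}-E_{\bar b,\bar a}$.\<close>

lemma F_bracket:
  assumes "a \<in> slots" "b \<in> slots" "x \<in> slots" "y \<in> slots" "f \<in> V"
  shows "F a b (F x y f) - F x y (F a b f) =
    (if b = x then F a y f else 0) - (if y = a then F x b f else 0)
    - (if b = bar y then F a (bar x) f else 0) + (if bar x = a then F (bar y) b f else 0)"
proof -
  have [simp]: "Coord v \<in> slots \<longleftrightarrow> v \<in> vars n" for v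
    by (auto simp: slots_def)
  show ?thesis
    using assms
    apply (cases a; cases b; cases x; cases y)
    apply (simp_all add: R_R d_R d_K R_K E_R E_K E_d)
    apply (auto simp: cj_swap d_d K_K)
    \<comment> \<open>what is left are instances of \<open>R (cj v) (cj w) = - R w v\<close>\<close>
    apply (simp_all add: R_def)
    done
qed

end

section \<open>The matrices of the orthogonal Lie algebra\<close>

definition ibar :: "nat \<Rightarrow> nat \<Rightarrow> nat" where
  "ibar n r = (if r \<le> n + 1 then r + (n + 1) else r - (n + 1))"

definition Fmat :: "nat \<Rightarrow> nat \<Rightarrow> nat \<Rightarrow> complex mat" where
  "Fmat n r s = Emat n r s - Emat n (ibar n s) (ibar n r)"

definition slot_of :: "nat \<Rightarrow> nat \<Rightarrow> slot" where
  "slot_of n r = (if r \<le> n then Coord (X r) else if r = n + 1 then Inf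
     else if r \<le> 2 * n + 1 then Coord (Y (r - (n + 1))) else Nul)"

abbreviation ix :: "nat \<Rightarrow> nat set" where "ix n \<equiv> {1..2 * n + 2}"

lemma ibar_ix: "r \<in> ix n \<Longrightarrow> ibar n r \<in> ix n"
  and ibar_ibar: "r \<in> ix n \<Longrightarrow> ibar n (ibar n r) = r"
  by (auto simp: ibar_def)

lemmas ibar_simps [simp] = ibar_ix[simplified] ibar_ibar[simplified]

lemma bar_slot_of: "r \<in> ix n \<Longrightarrow> bar (slot_of n r) = slot_of n (ibar n r)"
  by (auto simp: slot_of_def ibar_def)

lemma slot_of_eq_iff: "r \<in> ix n \<Longrightarrow> s \<in> ix n \<Longrightarrow> slot_of n r = slot_of n s \<longleftrightarrow> r = s"
  by (auto simp: slot_of_def split: if_splits)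

lemma Emat_carrier: "Emat n r s \<in> carrier_mat (2*n+2) (2*n+2)"
  by (simp add: Emat_def)

lemma Fmat_carrier: "Fmat n r s \<in> carrier_mat (2*n+2) (2*n+2)"
  unfolding Fmat_def by (intro minus_carrier_mat Emat_carrier)

lemmas carrier_simps [simp] = Emat_carrier[simplified] Fmat_carrier[simplified]

lemma Emat_times_Emat:
  assumes "s \<in> ix n"
  shows "Emat n r s * Emat n t u = of_bool (s = t) \<cdot>\<^sub>m Emat n r u"
proof (rule eq_matI)
  fix k l assume "k < dim_row (of_bool (s = t) \<cdot>\<^sub>m Emat n r u)" "l < dim_col (of_bool (s = t) \<cdot>\<^sub>m Emat n r u)"
  then have kl: "k < 2*n+2" "l < 2*n+2" by (auto simp: Emat_def)
  have "(Emat n r s * Emat n t u) $$ (k, l) =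
      (\<Sum>j<2*n+2. (if Suc k = r \<and> Suc j = s then 1 else 0) * (if Suc j = t \<and> Suc l = u then 1 else 0))"
    using kl by (simp add: Emat_def scalar_prod_def atLeast0LessThan)
  also have "\<dots> = (\<Sum>j<2*n+2. if j = s - 1 then (if Suc k = r \<and> s = t \<and> Suc l = u then 1 else 0) else 0)"
    using assms by (intro sum.cong) auto
  also have "\<dots> = (of_bool (s = t) \<cdot>\<^sub>m Emat n r u) $$ (k, l)"
    using assms kl by (auto simp: Emat_def)
  finally show "(Emat n r s * Emat n t u) $$ (k, l) = (of_bool (s = t) \<cdot>\<^sub>m Emat n r u) $$ (k, l)" .
qed (simp_all add: Emat_def)

lemma bracket_carrier [simp]:
  "M \<in> carrier_mat k k \<Longrightarrow> N \<in> carrier_mat k k \<Longrightarrow> bracket M N \<in> carrier_mat k k"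
  unfolding bracket_def by (rule minus_carrier_mat) simp

text \<open>Of the eight products of matrix units in the bracket, those with the same Kronecker delta
  combine in pairs into the four matrices \<^const>\<open>Fmat\<close>.\<close>

lemma bracket_Fmat:
  assumes "r \<in> ix n" "s \<in> ix n" "t \<in> ix n" "u \<in> ix n"
  shows "bracket (Fmat n r s) (Fmat n t u) =
    of_bool (s = t) \<cdot>\<^sub>m Fmat n r u - of_bool (u = r) \<cdot>\<^sub>m Fmat n t s
    - of_bool (s = ibar n u) \<cdot>\<^sub>m Fmat n r (ibar n t) + of_bool (ibar n t = r) \<cdot>\<^sub>m Fmat n (ibar n u) s"
proof -
  have expand: "(A - B) * (C - D) = A * C - A * D - (B * C - B * D)"
    if "A \<in> carrier_mat k k" "B \<in> carrier_mat k k" "C \<in> carrier_mat k k" "D \<in> carrier_mat k k"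
    for A B C D :: "complex mat" and k
  proof -
    have "(A - B) * (C - D) = A * (C - D) - B * (C - D)"
      using that by (intro minus_mult_distrib_mat[of _ k k _ _ k] minus_carrier_mat)
    then show ?thesis
      using that by (simp add: mult_minus_distrib_mat[of _ k k _ k])
  qed
  have same: "(u = ibar n s) = (s = ibar n u)" "(ibar n t = r) = (ibar n r = t)"
    "(ibar n r = ibar n u) = (u = r)" "(ibar n t = ibar n s) = (s = t)"
    using assms by (metis ibar_ibar)+
  have shuffle: "x1 - x2 - (x3 - x4) - (x5 - x6 - (x7 - x8)) = x1 - x8 - (x5 - x4) - (x2 - x6) + (x7 - x3)"
    for x1 x2 x3 x4 x5 x6 x7 x8 :: complex
    by simp
  show ?thesis
  proof (rule eq_matI)
    fix k l
    assume "k < dim_row (of_bool (s = t) \<cdot>\<^sub>m Fmat n r u - of_bool (u = r) \<cdot>\<^sub>m Fmat n t s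
      - of_bool (s = ibar n u) \<cdot>\<^sub>m Fmat n r (ibar n t) + of_bool (ibar n t = r) \<cdot>\<^sub>m Fmat n (ibar n u) s)"
      "l < dim_col (of_bool (s = t) \<cdot>\<^sub>m Fmat n r u - of_bool (u = r) \<cdot>\<^sub>m Fmat n t s
      - of_bool (s = ibar n u) \<cdot>\<^sub>m Fmat n r (ibar n t) + of_bool (ibar n t = r) \<cdot>\<^sub>m Fmat n (ibar n u) s)"
    then have kl: "k < 2*n+2" "l < 2*n+2" by (simp_all add: Fmat_def Emat_def)
    have dims [simp]: "dim_row (Emat n a b) = 2*n+2" "dim_col (Emat n a b) = 2*n+2" for a b
      by (simp_all add: Emat_def)
    define e where "e a b = Emat n a b $$ (k, l)" for a b
    have "bracket (Fmat n r s) (Fmat n t u) $$ (k, l) =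
      of_bool (s = t) * e r u - of_bool (s = ibar n u) * e r (ibar n t)
      - (of_bool (ibar n r = t) * e (ibar n s) u - of_bool (ibar n r = ibar n u) * e (ibar n s) (ibar n t))
      - (of_bool (u = r) * e t s - of_bool (u = ibar n s) * e t (ibar n r)
      - (of_bool (ibar n t = r) * e (ibar n u) s - of_bool (ibar n t = ibar n s) * e (ibar n u) (ibar n r)))"
      unfolding bracket_def Fmat_def using kl assms
      by (simp add: expand[OF Emat_carrier Emat_carrier Emat_carrier Emat_carrier] Emat_times_Emat e_def
          del: index_mult_mat(1) of_bool_eq_iff)
    also have "\<dots> = of_bool (s = t) * (e r u - e (ibar n u) (ibar n r)) - of_bool (u = r) * (e t s - e (ibar n s) (ibar n t))
      - of_bool (s = ibar n u) * (e r (ibar n t) - e t (ibar n r))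
      + of_bool (ibar n t = r) * (e (ibar n u) s - e (ibar n s) u)"
      unfolding same by (simp only: right_diff_distrib) (rule shuffle)
    also have "\<dots> = (of_bool (s = t) \<cdot>\<^sub>m Fmat n r u - of_bool (u = r) \<cdot>\<^sub>m Fmat n t s
      - of_bool (s = ibar n u) \<cdot>\<^sub>m Fmat n r (ibar n t) + of_bool (ibar n t = r) \<cdot>\<^sub>m Fmat n (ibar n u) s) $$ (k, l)"
      unfolding Fmat_def e_def using kl assms(3,4)
      by (simp only: ibar_ibar index_add_mat index_minus_mat index_smult_mat dims)
    finally show "bracket (Fmat n r s) (Fmat n t u) $$ (k, l) =
      (of_bool (s = t) \<cdot>\<^sub>m Fmat n r u - of_bool (u = r) \<cdot>\<^sub>m Fmat n t s
      - of_bool (s = ibar n u) \<cdot>\<^sub>m Fmat n r (ibar n t) + of_bool (ibar n t = r) \<cdot>\<^sub>m Fmat n (ibar n u) s) $$ (k, l)" .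
  qed (simp_all add: bracket_def Fmat_def Emat_def)
qed

lemma Amat_eq_Fmat: "i \<in> {1..n+1} \<Longrightarrow> j \<in> {1..n+1} \<Longrightarrow> Amat n i j = Fmat n i j"
  and Bmat_eq_Fmat: "i \<in> {1..n+1} \<Longrightarrow> j \<in> {1..n+1} \<Longrightarrow> Bmat n i j = Fmat n i (n + 1 + j)"
  and Cmat_eq_Fmat: "i \<in> {1..n+1} \<Longrightarrow> j \<in> {1..n+1} \<Longrightarrow> Cmat n i j = Fmat n (n + 1 + i) j"
  by (simp_all add: Amat_def Bmat_def Cmat_def Fmat_def ibar_def add.commute)

lemma Fmat_antisym: "r \<in> ix n \<Longrightarrow> s \<in> ix n \<Longrightarrow> Fmat n (ibar n s) (ibar n r) = - 1 \<cdot>\<^sub>m Fmat n r s"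
  by (rule eq_matI) (simp_all add: Fmat_def Emat_def)

lemma mat_span_carrier:
  assumes "M \<in> mat_span N S" "S \<subseteq> carrier_mat N N"
  shows "M \<in> carrier_mat N N"
  using assms(1) by induction (use assms(2) in auto)

lemma mat_span_mono:
  assumes "M \<in> mat_span N S" "S \<subseteq> T"
  shows "M \<in> mat_span N T"
  using assms(1) by induction (use assms(2) in \<open>auto intro: mat_span.intros\<close>)

lemma mat_span_base:
  assumes "G \<in> S" "S \<subseteq> carrier_mat N N"
  shows "t \<cdot>\<^sub>m G \<in> mat_span N S"
  using mat_span.add_smult[OF mat_span.zero assms(1), of N t] assms by (auto simp: subset_iff)

abbreviation o_gens :: "nat \<Rightarrow> complex mat set" where
  "o_gens n \<equiv> \<Union>i\<in>{1..n+1}. \<Union>j\<in>{1..n+1}. {Amat n i j, Bmat n i j, Cmat n i j}"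

lemma o_gens_carrier: "o_gens n \<subseteq> carrier_mat (2*n+2) (2*n+2)"
  by (auto simp: Amat_eq_Fmat Bmat_eq_Fmat Cmat_eq_Fmat)

lemma o_alg_carrier: "M \<in> o_alg n \<Longrightarrow> M \<in> carrier_mat (2*n+2) (2*n+2)"
  unfolding o_alg_def by (erule mat_span_carrier) (rule o_gens_carrier)

lemmas o_alg_carrier_simp [simp] = o_alg_carrier[simplified]

text \<open>Induction over the span of the matrices \<^const>\<open>Fmat\<close>, into which all three families of
  generators have been merged.\<close>

lemma o_alg_induct [consumes 1, case_names zero step]:
  assumes "M \<in> o_alg n" "P (0\<^sub>m (2*n+2) (2*n+2))"
    and "\<And>M r s t. M \<in> o_alg n \<Longrightarrow> r \<in> ix n \<Longrightarrow> s \<in> ix n \<Longrightarrow> P M \<Longrightarrow> P (M + t \<cdot>\<^sub>m Fmat n r s)"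
  shows "P M"
  using assms(1) unfolding o_alg_def
proof induction
  case zero
  then show ?case by (rule assms(2))
next
  case (add_smult M G t)
  obtain i j where ij: "i \<in> {1..n+1}" "j \<in> {1..n+1}" "G \<in> {Amat n i j, Bmat n i j, Cmat n i j}"
    using add_smult(2) by blast
  then have "G \<in> {Fmat n i j, Fmat n i (n + 1 + j), Fmat n (n + 1 + i) j}"
    by (simp only: Amat_eq_Fmat Bmat_eq_Fmat Cmat_eq_Fmat)
  moreover have "i \<in> ix n" "j \<in> ix n" "n + 1 + i \<in> ix n" "n + 1 + j \<in> ix n"
    using ij(1,2) by auto
  ultimately obtain r s where "r \<in> ix n" "s \<in> ix n" "G = Fmat n r s"
    by blast
  then show ?case using assms(3) add_smult by (simp add: o_alg_def)
qed

lemma generators_o_gens: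
  assumes "i \<in> {1..n+1}" "j \<in> {1..n+1}"
  shows "Amat n i j \<in> o_gens n" "Bmat n i j \<in> o_gens n" "Cmat n i j \<in> o_gens n"
  by (rule UN_I[OF assms(1)], rule UN_I[OF assms(2)], simp)+

lemma Fmat_o_alg:
  assumes "r \<in> ix n" "s \<in> ix n"
  shows "Fmat n r s \<in> o_alg n"
proof -
  have gen: "t \<cdot>\<^sub>m G \<in> o_alg n" if "G \<in> o_gens n" for t G
    unfolding o_alg_def using that o_gens_carrier by (rule mat_span_base)
  have one: "1 \<cdot>\<^sub>m Fmat n r s = Fmat n r s" by (rule eq_matI) auto
  show ?thesis
  proof (cases "r \<le> n + 1"; cases "s \<le> n + 1")
    assume "r \<le> n + 1" "s \<le> n + 1"
    then have "r \<in> {1..n+1}" "s \<in> {1..n+1}" using assms by auto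
    from gen[OF generators_o_gens(1)[OF this], of 1] one show ?thesis
      by (simp only: Amat_eq_Fmat[OF \<open>r \<in> {1..n+1}\<close> \<open>s \<in> {1..n+1}\<close>])
  next
    assume *: "r \<le> n + 1" "\<not> s \<le> n + 1"
    then have rs: "r \<in> {1..n+1}" "s - (n + 1) \<in> {1..n+1}" "n + 1 + (s - (n + 1)) = s" using assms by auto
    from gen[OF generators_o_gens(2)[OF rs(1,2)], of 1] one show ?thesis
      by (simp only: Bmat_eq_Fmat[OF rs(1,2)] rs(3))
  next
    assume *: "\<not> r \<le> n + 1" "s \<le> n + 1"
    then have rs: "r - (n + 1) \<in> {1..n+1}" "s \<in> {1..n+1}" "n + 1 + (r - (n + 1)) = r" using assms by auto
    from gen[OF generators_o_gens(3)[OF rs(1,2)], of 1] one show ?thesis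
      by (simp only: Cmat_eq_Fmat[OF rs(1,2)] rs(3))
  next
    assume *: "\<not> r \<le> n + 1" "\<not> s \<le> n + 1"
    then have rs: "ibar n s \<in> {1..n+1}" "ibar n r \<in> {1..n+1}" using assms by (auto simp: ibar_def)
    have "Fmat n r s = - 1 \<cdot>\<^sub>m Fmat n (ibar n s) (ibar n r)"
      using Fmat_antisym[OF ibar_ix[OF assms(2)] ibar_ix[OF assms(1)]]
      by (simp only: ibar_ibar[OF assms(1)] ibar_ibar[OF assms(2)])
    with gen[OF generators_o_gens(1)[OF rs], of "-1"] show ?thesis
      by (simp only: Amat_eq_Fmat[OF rs])
  qed
qed

lemma bracket_add_smult:
  assumes "L \<in> carrier_mat k k" "M \<in> carrier_mat k k" "N \<in> carrier_mat k k"
  shows "bracket L (M + t \<cdot>\<^sub>m N) = bracket L M + t \<cdot>\<^sub>m bracket L N"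
  and "bracket (M + t \<cdot>\<^sub>m N) L = bracket M L + t \<cdot>\<^sub>m bracket N L"
  unfolding bracket_def using assms
  by (simp_all add: mult_add_distrib_mat[of _ k k] add_mult_distrib_mat[of _ k k]
      mult_smult_distrib[of _ k k] mult_smult_assoc_mat[of _ k k])
     (rule eq_matI; simp add: algebra_simps)+

section \<open>The operators form a representation\<close>

lemma rep_apply:
  "rep n c q d M f =
     (\<Sum>i=1..n+1. \<Sum>j=1..n+1. cscale (ent M i j) (A_op n c q d i j f))
   + (\<Sum>j=1..n+1. \<Sum>i\<in>{1..<j}. cscale (ent M i (n+1+j)) (B_op n q d i j f))
   + (\<Sum>j=1..n+1. \<Sum>i\<in>{1..<j}. cscale (ent M (n+1+j) i) (C_op n c q d j i f))"
  by (simp only: rep_def fn_apply sum_fun_apply o_def)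

lemma ent_add_smult:
  assumes "M \<in> carrier_mat (2*n+2) (2*n+2)" "N \<in> carrier_mat (2*n+2) (2*n+2)" "r \<in> ix n" "s \<in> ix n"
  shows "ent (M + t \<cdot>\<^sub>m N) r s = ent M r s + t * ent N r s"
  using assms by (auto simp: ent_def)

lemma rep_add_smult:
  assumes M: "M \<in> carrier_mat (2*n+2) (2*n+2)" "N \<in> carrier_mat (2*n+2) (2*n+2)"
  shows "rep n c q d (M + t \<cdot>\<^sub>m N) f = rep n c q d M f + cscale t (rep n c q d N f)"
proof -
  have split: "(\<Sum>i\<in>I. \<Sum>j\<in>J i. cscale (ent (M + t \<cdot>\<^sub>m N) (a i j) (b i j)) (g i j)) =
      (\<Sum>i\<in>I. \<Sum>j\<in>J i. cscale (ent M (a i j) (b i j)) (g i j)) +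
      cscale t (\<Sum>i\<in>I. \<Sum>j\<in>J i. cscale (ent N (a i j) (b i j)) (g i j))"
    if "\<And>i j. i \<in> I \<Longrightarrow> j \<in> J i \<Longrightarrow> a i j \<in> ix n \<and> b i j \<in> ix n"
    for I :: "nat set" and J :: "nat \<Rightarrow> nat set" and a b :: "nat \<Rightarrow> nat \<Rightarrow> nat" and g :: "nat \<Rightarrow> nat \<Rightarrow> fn"
  proof -
    have "(\<Sum>i\<in>I. \<Sum>j\<in>J i. cscale (ent (M + t \<cdot>\<^sub>m N) (a i j) (b i j)) (g i j)) =
      (\<Sum>i\<in>I. \<Sum>j\<in>J i. cscale (ent M (a i j) (b i j)) (g i j) + cscale t (cscale (ent N (a i j) (b i j)) (g i j)))"
      using that by (intro sum.cong refl) (simp add: ent_add_smult[OF M] fn.scale_left_distrib)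
    then show ?thesis by (simp add: sum.distrib fn.scale_sum_right)
  qed
  show ?thesis
    unfolding rep_apply
    by (subst split, fastforce)+ (simp add: algebra_simps)
qed

lemma rep_zero: "rep n c q d (0\<^sub>m (2*n+2) (2*n+2)) f = 0"
  using rep_add_smult[of "0\<^sub>m (2*n+2) (2*n+2)" n "0\<^sub>m (2*n+2) (2*n+2)" c q d 1 f] by simp

lemma rep_smult:
  assumes "M \<in> carrier_mat (2*n+2) (2*n+2)"
  shows "rep n c q d (t \<cdot>\<^sub>m M) f = cscale t (rep n c q d M f)"
proof -
  have "0\<^sub>m (2*n+2) (2*n+2) + t \<cdot>\<^sub>m M = t \<cdot>\<^sub>m M"
    using assms by (intro left_add_zero_mat) simp
  then show ?thesis
    using rep_add_smult[OF zero_carrier_mat assms, of c q d t f] by (simp only: rep_zero add_0)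
qed

lemma rep_add:
  assumes "M \<in> carrier_mat (2*n+2) (2*n+2)" "N \<in> carrier_mat (2*n+2) (2*n+2)"
  shows "rep n c q d (M + N) f = rep n c q d M f + rep n c q d N f"
proof -
  have "1 \<cdot>\<^sub>m N = N" by (rule eq_matI) auto
  then show ?thesis using rep_add_smult[OF assms, of c q d 1 f] by simp
qed

context weyl_module
begin

lemma Coord_slots [simp]: "Coord v \<in> slots \<longleftrightarrow> v \<in> vars n"
  and Inf_slots [simp]: "Inf \<in> slots"
  and Nul_slots [simp]: "Nul \<in> slots"
  by (auto simp: slots_def)

lemma slots_eq_slot_of: "slots = slot_of n ` ix n"
proof
  show "slot_of n ` ix n \<subseteq> slots"
    by (auto simp: slot_of_def)
  show "slots \<subseteq> slot_of n ` ix n"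
  proof
    fix a assume "a \<in> slots"
    then consider i where "i \<in> {1..n}" "a = Coord (X i)" | i where "i \<in> {1..n}" "a = Coord (Y i)"
      | "a = Inf" | "a = Nul"
      by (auto simp: slots_def vars_def)
    then show "a \<in> slot_of n ` ix n"
    proof cases
      case 1
      then show ?thesis by (intro image_eqI[of _ _ i]) (auto simp: slot_of_def)
    next
      case 2
      then show ?thesis by (intro image_eqI[of _ _ "n + 1 + i"]) (auto simp: slot_of_def)
    next
      case 3
      then show ?thesis by (intro image_eqI[of _ _ "n + 1"]) (auto simp: slot_of_def)
    next
      case 4
      then show ?thesis by (intro image_eqI[of _ _ "2 * n + 2"]) (auto simp: slot_of_def)
    qed
  qed
qed

lemma slot_of_slots: "r \<in> ix n \<Longrightarrow> slot_of n r \<in> slots"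
  unfolding slots_eq_slot_of by (rule imageI)

lemma F_antisym: "F (bar b) (bar a) f = - F a b f"
  by (cases a; cases b) (simp_all add: R_def)

lemma rep_Fmat_antisym:
  assumes "r \<in> ix n" "s \<in> ix n"
  shows "rep n c q d (Fmat n r s) f = - rep n c q d (Fmat n (ibar n s) (ibar n r)) f"
  unfolding Fmat_antisym[OF assms] rep_smult[OF Fmat_carrier] by simp

lemma euler_E: "euler_op n q d f = E f"
  and eta_H: "eta_op n q f = H f"
  by (simp_all add: euler_op_eq eta_op_eq E_def H_def)

text \<open>The prescribed values on $A_{i,j}$, $B_{i,j}$ for $i\le n$ and $C_{i,j}$ for $j\le n$ agree with
  \<^const>\<open>F\<close>; the remaining index pairs are reduced to these by the antisymmetry
  $(a,b)\mapsto(\bar b,\bar a)$, which both sides share.\<close>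

lemma rep_Fmat:
  assumes rs: "r \<in> ix n" "s \<in> ix n"
  shows "rep n c q d (Fmat n r s) f = F (slot_of n r) (slot_of n s) f"
proof -
  have A: "rep n c q d (Fmat n i j) f = F (slot_of n i) (slot_of n j) f"
    if ij: "i \<in> {1..n+1}" "j \<in> {1..n+1}" for i j
  proof -
    have "rep n c q d (Fmat n i j) f = A_op n c q d i j f"
      using rep_Amat[OF ij, of c q d] by (simp only: Amat_eq_Fmat[OF ij])
    also have "\<dots> = F (slot_of n i) (slot_of n j) f"
      using ij by (auto simp: A_op_def slot_of_def fn_apply euler_E eta_H R_def K_def)
    finally show ?thesis .
  qed
  have B: "rep n c q d (Fmat n i (n + 1 + j)) f = F (slot_of n i) (slot_of n (n + 1 + j)) f"
    if ij: "i \<in> {1..n}" "j \<in> {1..n+1}" for i j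
  proof -
    have "i \<in> {1..n+1}" using ij by simp
    then have "rep n c q d (Fmat n i (n + 1 + j)) f = B_op n q d i j f"
      using rep_Bmat[OF ij, of c q d] by (simp only: Bmat_eq_Fmat[OF _ ij(2)])
    also have "\<dots> = F (slot_of n i) (slot_of n (n + 1 + j)) f"
      using ij by (auto simp: B_op_def slot_of_def fn_apply R_def)
    finally show ?thesis .
  qed
  have C: "rep n c q d (Fmat n (n + 1 + i) j) f = F (slot_of n (n + 1 + i)) (slot_of n j) f"
    if ij: "i \<in> {1..n+1}" "j \<in> {1..n}" for i j
  proof -
    have "j \<in> {1..n+1}" using ij by simp
    then have "rep n c q d (Fmat n (n + 1 + i) j) f = C_op n c q d i j f"
      using rep_Cmat[OF ij, of c q d] by (simp only: Cmat_eq_Fmat[OF ij(1)])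
    also have "\<dots> = F (slot_of n (n + 1 + i)) (slot_of n j) f"
      using ij by (auto simp: C_op_def slot_of_def fn_apply R_def K_def euler_E eta_H)
    finally show ?thesis .
  qed
  have flip: "rep n c q d (Fmat n r s) f = F (slot_of n r) (slot_of n s) f"
    if "rep n c q d (Fmat n (ibar n s) (ibar n r)) f = F (slot_of n (ibar n s)) (slot_of n (ibar n r)) f"
  proof -
    have "rep n c q d (Fmat n r s) f = - F (bar (slot_of n s)) (bar (slot_of n r)) f"
      unfolding rep_Fmat_antisym[OF rs] that by (simp only: bar_slot_of rs)
    then show ?thesis by (simp add: F_antisym)
  qed
  have zero: "rep n c q d (Fmat n r s) f = 0" if "s = ibar n r"
  proof -
    have "Fmat n r s = 0\<^sub>m (2*n+2) (2*n+2)"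
      using rs by (intro eq_matI) (simp_all add: that Fmat_def Emat_def)
    then show ?thesis by (simp only: rep_zero)
  qed
  show ?thesis
  proof (cases "r \<le> n + 1"; cases "s \<le> n + 1")
    assume "r \<le> n + 1" "s \<le> n + 1"
    then show ?thesis using rs A by simp
  next
    assume *: "\<not> r \<le> n + 1" "\<not> s \<le> n + 1"
    then have "ibar n s \<in> {1..n+1}" "ibar n r \<in> {1..n+1}" using rs by (auto simp: ibar_def)
    then show ?thesis by (intro flip A)
  next
    assume *: "r \<le> n + 1" "\<not> s \<le> n + 1"
    define j where "j = s - (n + 1)"
    have j: "s = n + 1 + j" "j \<in> {1..n+1}" "ibar n s = j" using * rs by (auto simp: j_def ibar_def)
    consider "r \<le> n" | "r = n + 1" "j \<le> n" | "r = n + 1" "j = n + 1" using * j by fastforce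
    then show ?thesis
    proof cases
      case 1
      then show ?thesis unfolding j(1) using rs j by (intro B) auto
    next
      case 2
      have "ibar n r = n + 1 + (n + 1)" using 2 by (simp add: ibar_def)
      then show ?thesis using 2 j by (intro flip) (simp only: j(3), intro B, auto)
    next
      case 3
      then show ?thesis using j zero by (simp add: ibar_def slot_of_def)
    qed
  next
    assume *: "\<not> r \<le> n + 1" "s \<le> n + 1"
    define i where "i = r - (n + 1)"
    have i: "r = n + 1 + i" "i \<in> {1..n+1}" "ibar n r = i" using * rs by (auto simp: i_def ibar_def)
    consider "s \<le> n" | "s = n + 1" "i \<le> n" | "s = n + 1" "i = n + 1" using * i by fastforce
    then show ?thesis
    proof cases
      case 1
      then show ?thesis unfolding i(1) using rs i by (intro C) auto
    next
      case 2
      have "ibar n s = n + 1 + (n + 1)" using 2 by (simp add: ibar_def)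
      then show ?thesis using 2 i by (intro flip) (simp only: i(3), intro C, auto)
    next
      case 3
      then show ?thesis using i zero by (simp add: ibar_def slot_of_def)
    qed
  qed
qed

lemma rep_step:
  assumes "M \<in> o_alg n" "r \<in> ix n" "s \<in> ix n"
  shows "rep n c q d (M + t \<cdot>\<^sub>m Fmat n r s) f =
    rep n c q d M f + cscale t (F (slot_of n r) (slot_of n s) f)"
  by (simp only: rep_add_smult[OF o_alg_carrier[OF assms(1)] Fmat_carrier] rep_Fmat[OF assms(2,3)])

lemma rep_closed:
  assumes "M \<in> o_alg n" "f \<in> V"
  shows "rep n c q d M f \<in> V"
  using assms(1) by (induction rule: o_alg_induct)
    (simp_all only: rep_zero rep_step V_zero V_add V_scale F_closed slot_of_slots assms(2))

lemma rep_plus: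
  assumes "M \<in> o_alg n" "f \<in> V" "g \<in> V"
  shows "rep n c q d M (f + g) = rep n c q d M f + rep n c q d M g"
  using assms(1)
proof (induction rule: o_alg_induct)
  case zero
  show ?case by (simp only: rep_zero add_0)
next
  case (step M r s t)
  then show ?case
    unfolding rep_step[OF step(1-3)] using assms(2,3) by (simp add: F_add slot_of_slots)
qed

lemma rep_scale:
  assumes "M \<in> o_alg n" "f \<in> V"
  shows "rep n c q d M (cscale t f) = cscale t (rep n c q d M f)"
  using assms(1)
proof (induction rule: o_alg_induct)
  case zero
  show ?case by (simp only: rep_zero fn.scale_zero_right)
next
  case (step M r s x)
  then show ?case
    unfolding rep_step[OF step(1-3)] using assms(2) by (simp add: F_scale slot_of_slots mult.commute)
qed

lemma F_zero: "a \<in> slots \<Longrightarrow> b \<in> slots \<Longrightarrow> F a b 0 = 0"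
  using F_scale[of a b 0 0] by simp

lemma rep_bracket_Fmat:
  assumes "r \<in> ix n" "s \<in> ix n" "t \<in> ix n" "u \<in> ix n" "f \<in> V"
  shows "rep n c q d (bracket (Fmat n r s) (Fmat n t u)) f =
    F (slot_of n r) (slot_of n s) (F (slot_of n t) (slot_of n u) f)
    - F (slot_of n t) (slot_of n u) (F (slot_of n r) (slot_of n s) f)"
proof -
  have minus: "A - x \<cdot>\<^sub>m B = A + (- x) \<cdot>\<^sub>m B"
    if "A \<in> carrier_mat (2*n+2) (2*n+2)" "B \<in> carrier_mat (2*n+2) (2*n+2)" for A B :: "complex mat" and x
    using that by (intro eq_matI) auto
  have car: "A + x \<cdot>\<^sub>m B \<in> carrier_mat (2*n+2) (2*n+2)"
    if "A \<in> carrier_mat (2*n+2) (2*n+2)" "B \<in> carrier_mat (2*n+2) (2*n+2)" for A B :: "complex mat" and x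
    using that by auto
  have scale: "x \<cdot>\<^sub>m B \<in> carrier_mat (2*n+2) (2*n+2)"
    if "B \<in> carrier_mat (2*n+2) (2*n+2)" for B :: "complex mat" and x
    using that by auto
  have "rep n c q d (bracket (Fmat n r s) (Fmat n t u)) f =
    cscale (of_bool (s = t)) (rep n c q d (Fmat n r u) f)
    + cscale (- of_bool (u = r)) (rep n c q d (Fmat n t s) f)
    + cscale (- of_bool (s = ibar n u)) (rep n c q d (Fmat n r (ibar n t)) f)
    + cscale (of_bool (ibar n t = r)) (rep n c q d (Fmat n (ibar n u) s) f)"
    unfolding bracket_Fmat[OF assms(1-4)]
    by (simp only: minus car scale Fmat_carrier rep_add_smult rep_smult)
  also have "\<dots> = (if slot_of n s = slot_of n t then F (slot_of n r) (slot_of n u) f else 0)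
    - (if slot_of n u = slot_of n r then F (slot_of n t) (slot_of n s) f else 0)
    - (if slot_of n s = bar (slot_of n u) then F (slot_of n r) (bar (slot_of n t)) f else 0)
    + (if bar (slot_of n t) = slot_of n r then F (bar (slot_of n u)) (slot_of n s) f else 0)"
    using assms by (simp only: bar_slot_of slot_of_eq_iff rep_Fmat ibar_ix) simp
  also have "\<dots> = F (slot_of n r) (slot_of n s) (F (slot_of n t) (slot_of n u) f)
    - F (slot_of n t) (slot_of n u) (F (slot_of n r) (slot_of n s) f)"
    using assms by (intro F_bracket[symmetric] slot_of_slots)
  finally show ?thesis .
qed

text \<open>Bilinearity reduces the bracket relation to \<^const>\<open>Fmat\<close> in both arguments.\<close>

lemma rep_bracket:
  assumes "M \<in> o_alg n" "N \<in> o_alg n" "f \<in> V"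
  shows "rep n c q d (bracket M N) f =
    rep n c q d M (rep n c q d N f) - rep n c q d N (rep n c q d M f)"
proof -
  note carrier = o_alg_carrier Fmat_carrier bracket_carrier
  have right: "rep n c q d (bracket L (N + x \<cdot>\<^sub>m Fmat n r s)) f =
      rep n c q d (bracket L N) f + cscale x (rep n c q d (bracket L (Fmat n r s)) f)"
    and left: "rep n c q d (bracket (N + x \<cdot>\<^sub>m Fmat n r s) L) f =
      rep n c q d (bracket N L) f + cscale x (rep n c q d (bracket (Fmat n r s) L) f)"
    if "L \<in> carrier_mat (2*n+2) (2*n+2)" "N \<in> o_alg n" for L N x r s f
    using that
    by (simp_all only: bracket_add_smult[OF _ o_alg_carrier Fmat_carrier] rep_add_smult carrier)
  have zero: "bracket L (0\<^sub>m (2*n+2) (2*n+2)) = 0\<^sub>m (2*n+2) (2*n+2)"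
    "bracket (0\<^sub>m (2*n+2) (2*n+2)) L = 0\<^sub>m (2*n+2) (2*n+2)"
    if "L \<in> carrier_mat (2*n+2) (2*n+2)" for L
    using that by (simp_all add: bracket_def left_mult_zero_mat[of _ "2*n+2" "2*n+2", simplified]
        right_mult_zero_mat[of _ "2*n+2" "2*n+2", simplified])
  have gen: "rep n c q d (bracket (Fmat n r s) N) f =
      rep n c q d (Fmat n r s) (rep n c q d N f) - rep n c q d N (rep n c q d (Fmat n r s) f)"
    if rs: "r \<in> ix n" "s \<in> ix n" for r s
    using assms(2)
  proof (induction rule: o_alg_induct)
    case zero
    show ?case
      using rs by (simp only: \<open>\<And>L. _ \<Longrightarrow> bracket L _ = _\<close>[OF Fmat_carrier] rep_zero rep_Fmat
          F_zero slot_of_slots diff_self)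
  next
    case (step N t u x)
    have fN: "rep n c q d N f \<in> V" using step assms(3) by (intro rep_closed)
    have G: "rep n c q d (Fmat n r s) g = F (slot_of n r) (slot_of n s) g" for g
      by (rule rep_Fmat[OF rs])
    have ab: "slot_of n r \<in> slots" "slot_of n s \<in> slots" "slot_of n t \<in> slots" "slot_of n u \<in> slots"
      using rs step by (auto intro!: slot_of_slots)
    show ?case
      unfolding right[OF Fmat_carrier step(1)] step(4) rep_step[OF step(1-3)]
        rep_bracket_Fmat[OF rs step(2,3) assms(3)] G
      using fN ab assms(3) by (simp add: F_add F_scale algebra_simps)
  qed
  show ?thesis
    using assms(1)
  proof (induction rule: o_alg_induct)
    case zero
    show ?case
      using rep_scale[OF assms(2) V_zero, of 0]
      by (simp only: \<open>\<And>L. _ \<Longrightarrow> bracket _ L = _\<close>[OF o_alg_carrier[OF assms(2)]] rep_zero) simp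
  next
    case (step M r s x)
    have ab: "slot_of n r \<in> slots" "slot_of n s \<in> slots"
      using step by (auto intro!: slot_of_slots)
    have fM: "rep n c q d M f \<in> V" "F (slot_of n r) (slot_of n s) f \<in> V"
      using step ab assms(3) by (auto intro!: rep_closed)
    show ?case
      unfolding left[OF o_alg_carrier[OF assms(2)] step(1)] step(4) gen[OF step(2,3)]
        rep_step[OF step(1-3)] rep_Fmat[OF step(2,3)]
      using fM ab by (simp add: rep_plus[OF assms(2)] rep_scale[OF assms(2)] algebra_simps)
  qed
qed

lemma is_representation: "is_representation n (rep n c q d) V"
  unfolding is_representation_def invariant_under_def
  by (intro conjI ballI allI)
     (simp_all only: subspace_V rep_closed rep_plus rep_scale rep_bracket rep_add rep_smult o_alg_carrier)

lemma invariant_F: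
  assumes "invariant_under n (rep n c q d) W" "f \<in> W" "a \<in> slots" "b \<in> slots"
  shows "F a b f \<in> W"
proof -
  obtain r s where rs: "r \<in> ix n" "s \<in> ix n" "a = slot_of n r" "b = slot_of n s"
    using assms(3,4) unfolding slots_eq_slot_of by blast
  have "rep n c q d (Fmat n r s) f \<in> W"
    using assms(1,2) Fmat_o_alg[OF rs(1,2)] unfolding invariant_under_def by blast
  then show ?thesis by (simp only: rep_Fmat[OF rs(1,2)] rs(3,4))
qed

lemma invariant_ops:
  assumes "invariant_under n (rep n c q d) W" "fn.subspace W" "f \<in> W" "v \<in> vars n" "w \<in> vars n"
  shows "R v w f \<in> W" "K v f \<in> W" "d v f \<in> W" "E f + cscale c f \<in> W" "E f \<in> W"
proof -
  note inv = invariant_F[OF assms(1,3)]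
  show "R v w f \<in> W" "d v f \<in> W" "E f + cscale c f \<in> W"
    using inv[of "Coord v" "Coord w"] inv[of Inf "Coord v"] inv[of Nul Nul] assms(4,5) by simp_all
  show "K v f \<in> W"
    using inv[of Nul "Coord (cj v)"] assms(4) by simp
  show "E f \<in> W"
    using fn.subspace_diff[OF assms(2) \<open>E f + cscale c f \<in> W\<close> fn.subspace_scale[OF assms(2,3), of c]]
    by simp
qed

text \<open>A linear bijection that intertwines the operators \<open>q\<close> and \<open>d\<close> intertwines every word in them,
  hence the representations.\<close>

lemma irreducible_transport:
  assumes irr: "irreducible_rep n (rep n c q d) V"
    and image: "V' = \<Phi> ` V" and inj: "inj_on \<Phi> V"
    and add: "\<And>f g. f \<in> V \<Longrightarrow> g \<in> V \<Longrightarrow> \<Phi> (f + g) = \<Phi> f + \<Phi> g"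
    and scale: "\<And>t f. f \<in> V \<Longrightarrow> \<Phi> (cscale t f) = cscale t (\<Phi> f)"
    and q': "\<And>v f. v \<in> vars n \<Longrightarrow> f \<in> V \<Longrightarrow> q' v (\<Phi> f) = \<Phi> (q v f)"
    and d': "\<And>v f. v \<in> vars n \<Longrightarrow> f \<in> V \<Longrightarrow> d' v (\<Phi> f) = \<Phi> (d v f)"
  shows "irreducible_rep n (rep n c q' d') V'"
proof -
  have \<Phi>0: "\<Phi> 0 = 0" using scale[OF V_zero, of 0] by simp
  have neg: "\<Phi> (- f) = - \<Phi> f" if "f \<in> V" for f using scale[OF that, of "-1"] by simp
  have diff: "\<Phi> (f - g) = \<Phi> f - \<Phi> g" if "f \<in> V" "g \<in> V" for f g
    using add[OF that(1), of "- g"] neg[OF that(2)] that by simp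
  have sum_var: "\<Phi> (\<Sum>i\<in>I. g i) = (\<Sum>i\<in>I. \<Phi> (g i))" if "\<And>i. i \<in> I \<Longrightarrow> g i \<in> V" for I :: "var set" and g
    using that by (induction I rule: infinite_finite_induct) (simp_all add: \<Phi>0 add)
  have sum_nat: "\<Phi> (\<Sum>i\<in>I. g i) = (\<Sum>i\<in>I. \<Phi> (g i))" if "\<And>i. i \<in> I \<Longrightarrow> g i \<in> V" for I :: "nat set" and g
    using that by (induction I rule: infinite_finite_induct) (simp_all add: \<Phi>0 add)
  have "fn.subspace V'"
    unfolding fn.subspace_def image
    by (auto simp: add[symmetric] scale[symmetric] intro!: image_eqI[of 0 \<Phi> 0, OF \<Phi>0[symmetric]])
  then interpret M': weyl_module n c q' d' V'
    by unfold_locales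
      (auto simp: image q' d' add scale q_q[of _ _ ] d_d d_q, auto simp: add[symmetric] scale[symmetric] q' d' q_q d_d)
  have mem: "\<Phi> f \<in> V'" if "f \<in> V" for f using that image by blast
  have E': "M'.E (\<Phi> f) = \<Phi> (E f)" if "f \<in> V" for f
  proof -
    have "\<Phi> (E f) = (\<Sum>v\<in>vars n. \<Phi> (q v (d v f)))"
      unfolding E_def by (rule sum_var) (use that in auto)
    also have "\<dots> = M'.E (\<Phi> f)"
      unfolding M'.E_def by (rule sum.cong[OF refl]) (use that in \<open>simp add: q' d'\<close>)
    finally show ?thesis ..
  qed
  have H': "M'.H (\<Phi> f) = \<Phi> (H f)" if "f \<in> V" for f
  proof -
    have "\<Phi> (H f) = (\<Sum>i=1..n. \<Phi> (q (X i) (q (Y i) f)))"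
      unfolding H_def by (rule sum_nat) (use that in auto)
    also have "\<dots> = M'.H (\<Phi> f)"
      unfolding M'.H_def by (rule sum.cong[OF refl]) (use that in \<open>simp add: q'\<close>)
    finally show ?thesis ..
  qed
  have F': "M'.F a b (\<Phi> f) = \<Phi> (F a b f)" if "a \<in> slots" "b \<in> slots" "f \<in> V" for a b f
    using that
    by (cases a; cases b) (simp_all add: M'.R_def M'.K_def R_def K_def E' H' q' d' add scale neg diff \<Phi>0 mem)
  have rep': "rep n c q' d' M (\<Phi> f) = \<Phi> (rep n c q d M f)" if "M \<in> o_alg n" "f \<in> V" for M f
    using that(1)
  proof (induction rule: o_alg_induct)
    case zero
    show ?case by (simp only: rep_zero \<Phi>0)
  next
    case (step M r s t)
    then show ?case
      unfolding rep_step[OF step(1-3)] M'.rep_step[OF step(1-3)]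
      using that(2) by (simp add: F' slot_of_slots add scale rep_closed)
  qed
  have "V' \<noteq> {0}"
  proof
    assume "V' = {0}"
    then have "\<Phi> f = \<Phi> 0" if "f \<in> V" for f using that image \<Phi>0 by auto
    then have "V \<subseteq> {0}" using inj_onD[OF inj] V_zero by blast
    then show False using irr V_zero by (auto simp: irreducible_rep_def)
  qed
  moreover have "W = {0} \<or> W = V'"
    if W: "fn.subspace W" "W \<subseteq> V'" "invariant_under n (rep n c q' d') W" for W
  proof -
    define U where "U = {f \<in> V. \<Phi> f \<in> W}"
    have "fn.subspace U"
      using W(1) by (auto simp: U_def fn.subspace_def \<Phi>0 add scale)
    moreover have "invariant_under n (rep n c q d) U"
      using W(3) rep_closed rep' by (auto simp: U_def invariant_under_def) metis
    ultimately have "U = {0} \<or> U = V"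
      using irr by (auto simp: irreducible_rep_def U_def)
    moreover have "W = \<Phi> ` U" using W(2) image by (auto simp: U_def)
    ultimately show ?thesis using image \<Phi>0 by auto
  qed
  ultimately show ?thesis
    using M'.is_representation unfolding irreducible_rep_def by blast
qed

end

section \<open>Polynomials of bounded degree\<close>

definition tdeg :: "nat \<Rightarrow> (var \<Rightarrow> nat) \<Rightarrow> nat" where
  "tdeg n \<alpha> = (\<Sum>v\<in>vars n. \<alpha> v)"

text \<open>The bound is strict, so that \<^term>\<open>low n 0\<close> is zero and a derivative lowers the index even
  from \<^term>\<open>low n 1\<close>.\<close>

definition low :: "nat \<Rightarrow> nat \<Rightarrow> fn set" where
  "low n k = fn.span (monom n ` {\<alpha> \<in> exps n. tdeg n \<alpha> < k})"

lemma tdeg_inc: "v \<in> vars n \<Longrightarrow> tdeg n (inc v \<alpha>) = Suc (tdeg n \<alpha>)"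
proof -
  assume v: "v \<in> vars n"
  have "(\<Sum>w\<in>vars n - {v}. inc v \<alpha> w) = (\<Sum>w\<in>vars n - {v}. \<alpha> w)"
    by (intro sum.cong) (auto simp: inc_apply)
  then show ?thesis using v by (simp add: tdeg_def sum.remove[of _ v] inc_apply)
qed

lemma subspace_low: "fn.subspace (low n k)"
  unfolding low_def by (rule fn.subspace_span)

lemma low_mono: "j \<le> k \<Longrightarrow> low n j \<subseteq> low n k"
  unfolding low_def by (intro fn.span_mono image_mono) auto

lemma monom_low: "\<alpha> \<in> exps n \<Longrightarrow> tdeg n \<alpha> < k \<Longrightarrow> monom n \<alpha> \<in> low n k"
  unfolding low_def by (intro fn.span_base) auto

lemma low_polys: "low n k \<subseteq> polys n"
  unfolding low_def polys_eq_span by (intro fn.span_mono) auto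

lemma low_induct [consumes 1, case_names zero step]:
  assumes "f \<in> low n k" "P 0"
    and "\<And>t \<alpha> f. \<alpha> \<in> exps n \<Longrightarrow> tdeg n \<alpha> < k \<Longrightarrow> f \<in> polys n \<Longrightarrow> P f \<Longrightarrow> P (cscale t (monom n \<alpha>) + f)"
  shows "P f"
proof -
  have "f \<in> polys n \<and> P f"
    using assms(1) unfolding low_def
  proof (induction rule: fn.span_induct_alt)
    case base
    then show ?case using assms(2) by simp
  next
    case (step c x y)
    then show ?case using assms(3) by auto
  qed
  then show ?thesis ..
qed

lemma polys_low:
  assumes "f \<in> polys n"
  shows "\<exists>k. f \<in> low n k"
  using assms
proof (induction rule: polys_induct)
  case zero
  show ?case using fn.subspace_0[OF subspace_low] by blast
next
  case (step t \<alpha> f)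
  then obtain k where "f \<in> low n k" by blast
  then have "cscale t (monom n \<alpha>) + f \<in> low n (max k (Suc (tdeg n \<alpha>)))"
    using step(1) low_mono[of k "max k (Suc (tdeg n \<alpha>))" n]
    by (intro fn.subspace_add[OF subspace_low] fn.subspace_scale[OF subspace_low] monom_low) auto
  then show ?case by blast
qed

lemma pderivative_low:
  assumes "f \<in> low n (Suc k)" "v \<in> vars n"
  shows "pderivative v f \<in> low n k"
  using assms(1)
proof (induction rule: low_induct)
  case zero
  show ?case using fn.subspace_0[OF subspace_low] by simp
next
  case (step t \<alpha> f)
  have "pderivative v (monom n \<alpha>) \<in> low n k"
  proof (cases "\<alpha> v = 0")
    case True
    then show ?thesis using fn.subspace_0[OF subspace_low] by (simp add: pderivative_monom assms(2))
  next
    case False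
    then have "tdeg n \<alpha> = Suc (tdeg n (dec v \<alpha>))"
      using tdeg_inc[OF assms(2), of "dec v \<alpha>"] by simp
    then show ?thesis
      using step(1,2) by (auto simp: pderivative_monom assms(2) intro!: monom_low fn.subspace_scale[OF subspace_low])
  qed
  then show ?case
    using step by (simp add: pderivative_add[of _ n] pderivative_scale[of _ n]
        fn.subspace_add[OF subspace_low] fn.subspace_scale[OF subspace_low])
qed

lemma mult_var_low:
  assumes "f \<in> low n k" "v \<in> vars n"
  shows "mult_var v f \<in> low n (Suc k)"
  using assms(1)
proof (induction rule: low_induct)
  case zero
  show ?case using fn.subspace_0[OF subspace_low] by simp
next
  case (step t \<alpha> f)
  then show ?case
    using assms(2)
    by (auto simp: mult_var_add mult_var_scale mult_var_monom tdeg_inc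
        intro!: fn.subspace_add[OF subspace_low] fn.subspace_scale[OF subspace_low] monom_low)
qed

text \<open>In both irreducibility proofs an element of least degree in a submodule is constant, since every
  operator that lowers the degree must annihilate it.\<close>

lemma minimal_degree:
  assumes "fn.subspace W" "W \<subseteq> polys n" "W \<noteq> {0}"
  obtains f k where "f \<in> W" "f \<noteq> 0" "f \<in> low n (Suc k)" "\<And>g. g \<in> W \<Longrightarrow> g \<in> low n k \<Longrightarrow> g = 0"
proof -
  have ex: "\<exists>k f. f \<in> W \<and> f \<noteq> 0 \<and> f \<in> low n k"
  proof -
    obtain f where f: "f \<in> W" "f \<noteq> 0" using assms(3) fn.subspace_0[OF assms(1)] by blast
    then obtain k where "f \<in> low n k" using polys_low assms(2) by blast
    then show ?thesis using f by blast
  qed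
  define k where "k = (LEAST k. \<exists>f. f \<in> W \<and> f \<noteq> 0 \<and> f \<in> low n k)"
  have least: "\<exists>f. f \<in> W \<and> f \<noteq> 0 \<and> f \<in> low n k"
    unfolding k_def by (rule LeastI_ex[OF ex])
  then obtain f where f: "f \<in> W" "f \<noteq> 0" "f \<in> low n k" by blast
  have "low n 0 = {0}" by (simp add: low_def)
  then have "k \<noteq> 0" using f(2,3) by (metis singletonD)
  then obtain j where j: "k = Suc j" by (cases k) auto
  have "g = 0" if "g \<in> W" "g \<in> low n j" for g
  proof (rule ccontr)
    assume "g \<noteq> 0"
    then have "k \<le> j" unfolding k_def using that by (intro Least_le exI[of _ g] conjI)
    then show False using j by simp
  qed
  with f(1,2) f(3)[unfolded j] show ?thesis by (rule that)
qed

lemma coef_const: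
  assumes "f \<in> polys n" "\<And>v \<alpha>. v \<in> vars n \<Longrightarrow> \<alpha> \<in> exps n \<Longrightarrow> \<alpha> v > 0 \<Longrightarrow> coef n f \<alpha> = 0"
  shows "f = cscale (coef n f (\<lambda>_. 0)) (monom n (\<lambda>_. 0))"
proof -
  have "f - cscale (coef n f (\<lambda>_. 0)) (monom n (\<lambda>_. 0)) = 0"
  proof (rule polys_eq_0I)
    show "f - cscale (coef n f (\<lambda>_. 0)) (monom n (\<lambda>_. 0)) \<in> polys n"
      using assms(1) by (intro fn.subspace_diff[OF fn_subspace_polys]) simp_all
    fix \<alpha> assume a: "\<alpha> \<in> exps n"
    have "coef n (f + cscale (- coef n f (\<lambda>_. 0)) (monom n (\<lambda>_. 0))) \<alpha> = 0"
    proof (cases "\<alpha> = (\<lambda>_. 0)")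
      case True
      then show ?thesis using assms(1) by (simp add: coef_add coef_scale coef_monom del: fn.scale_minus_left)
    next
      case False
      then obtain v where v: "\<alpha> v > 0" by (metis ext gr0I)
      then have "v \<in> vars n" using a by (force simp: exps_def)
      then show ?thesis
        using False assms(1) assms(2)[OF _ a v] a
        by (simp add: coef_add coef_scale coef_monom del: fn.scale_minus_left)
    qed
    then show "coef n (f - cscale (coef n f (\<lambda>_. 0)) (monom n (\<lambda>_. 0))) \<alpha> = 0" by simp
  qed
  then show ?thesis by simp
qed

lemma polys_subset:
  assumes "fn.subspace W" "\<And>\<alpha>. \<alpha> \<in> exps n \<Longrightarrow> monom n \<alpha> \<in> W"
  shows "polys n \<subseteq> W"
  unfolding polys_eq_span using assms by (intro fn.span_minimal) auto

section \<open>The canonical commutation relations for polynomials\<close>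

lemma mult_var_commute: "mult_var v (mult_var w f) = mult_var w (mult_var v f)"
  by (simp add: mult_var_def fun_eq_iff)

lemma pderivative_commute:
  assumes "f \<in> polys n" "v \<in> vars n" "w \<in> vars n"
  shows "pderivative v (pderivative w f) = pderivative w (pderivative v f)"
  using assms(1)
proof (induction rule: polys_induct)
  case (step t \<alpha> f)
  have "dec v (dec w \<alpha>) = dec w (dec v \<alpha>)" by (auto simp: dec_def fun_eq_iff)
  then have "pderivative v (pderivative w (monom n \<alpha>)) = pderivative w (pderivative v (monom n \<alpha>))"
    using assms(2,3) by (auto simp: pderivative_monom pderivative_scale[of _ n] dec_apply mult.commute)
  then show ?case
    using step assms(2,3) by (simp add: pderivative_add[of _ n] pderivative_scale[of _ n])
qed simp

lemma pderivative_mult_var: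
  assumes "f \<in> polys n" "v \<in> vars n" "w \<in> vars n"
  shows "pderivative v (mult_var w f) = mult_var w (pderivative v f) + (if v = w then f else 0)"
  using assms(1)
proof (induction rule: polys_induct)
  case (step t \<alpha> f)
  have "pderivative v (mult_var w (monom n \<alpha>)) =
      mult_var w (pderivative v (monom n \<alpha>)) + (if v = w then monom n \<alpha> else 0)"
  proof (cases "v = w")
    case True
    then show ?thesis
      using assms(2,3)
      by (cases "\<alpha> v = 0") (simp_all add: mult_var_monom pderivative_monom mult_var_scale inc_apply
          fn.scale_left_distrib)
  next
    case False
    then show ?thesis
      using assms(2,3)
      by (simp add: mult_var_monom pderivative_monom mult_var_scale inc_apply dec_inc_neq)
  qed
  then show ?case
    using step assms(2,3)
    by (simp add: pderivative_add[of _ n] pderivative_scale[of _ n] mult_var_add mult_var_scale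
        mult_var_polys algebra_simps split: if_splits)
qed simp

section \<open>Irreducibility of the modules of polynomials times an exponential\<close>

text \<open>Multiplication by $e^{\sum_v a_vv}$ conjugates $\partial_v$ into $\partial_v+a_v$. This turns the
  problem into one about polynomials.\<close>

definition shifted_d :: "(var \<Rightarrow> complex) \<Rightarrow> assignment" where
  "shifted_d a v f = pderivative v f + cscale (a v) f"

lemma weyl_shifted: "weyl_module n mult_var (shifted_d a) (polys n)"
  by unfold_locales
     (auto simp: fn_subspace_polys mult_var_polys mult_var_add mult_var_scale shifted_d_def
       pderivative_add[of _ n] pderivative_scale[of _ n] mult_var_commute pderivative_mult_var[of _ n]
       pderivative_commute[of _ n] algebra_simps)

lemma monom_nonzero: "monom n \<alpha> \<noteq> 0"
proof
  assume "monom n \<alpha> = 0"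
  then have "monom n \<alpha> (\<lambda>_. 1) = 0" by (simp only: zero_fun_apply)
  then show False by (simp add: monom_def)
qed

lemma coef_zero_of_pderivative_zero:
  assumes "f \<in> polys n" "v \<in> vars n" "pderivative v f = 0" "\<alpha> \<in> exps n" "\<alpha> v > 0"
  shows "coef n f \<alpha> = 0"
proof -
  have "of_nat (Suc (dec v \<alpha> v)) * coef n f (inc v (dec v \<alpha>)) = (0 :: complex)"
    using coef_pderivative[OF assms(1,2) dec_exps[OF assms(4)], of v] assms(3) by simp
  then show ?thesis using assms(5) by (simp del: of_nat_Suc)
qed

lemma one_mem_of_constant:
  assumes W: "fn.subspace W" and f: "f \<in> W" "f \<in> polys n" "f \<noteq> 0"
    and coefs: "\<And>v \<alpha>. v \<in> vars n \<Longrightarrow> \<alpha> \<in> exps n \<Longrightarrow> \<alpha> v > 0 \<Longrightarrow> coef n f \<alpha> = 0"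
  shows "monom n (\<lambda>_. 0) \<in> W"
proof -
  define t where "t = coef n f (\<lambda>_. 0)"
  have eq: "f = cscale t (monom n (\<lambda>_. 0))"
    unfolding t_def using f(2) coefs by (rule coef_const)
  then have "t \<noteq> 0" using f(3) by (metis fn.scale_zero_left)
  moreover have "cscale (1 / t) f \<in> W" by (rule fn.subspace_scale[OF W f(1)])
  ultimately show ?thesis by (simp add: eq)
qed

lemma polys_nonzero: "polys n \<noteq> {0}"
  using monom_polys monom_nonzero by (metis singletonD)

text \<open>The operators $d_v-a_v=\partial_v$ lower the degree, so a nonzero submodule contains 1. To return
  from 1 to all polynomials it suffices to multiply by each variable $v$ up to terms of no larger degree.
  The operator $\sum_w a_{\bar w}R_{v,w}+a_{\bar v}D$ does this: writing $\ell=\sum_w a_ww$, its part of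
  degree one is
  $\sum_w a_{\bar w}(a_wv-a_{\bar v}\bar w)+a_{\bar v}\ell=\bigl(\sum_wa_wa_{\bar w}\bigr)v$, because
  $\sum_wa_{\bar w}\bar w=\ell$.\<close>

theorem shifted_irreducible:
  assumes N: "(\<Sum>v\<in>vars n. a v * a (cj v)) \<noteq> 0"
  shows "irreducible_rep n (rep n c mult_var (shifted_d a)) (polys n)"
proof -
  interpret M: weyl_module n c mult_var "shifted_d a" "polys n"
    by (rule weyl_shifted)
  have "polys n \<subseteq> W"
    if W: "fn.subspace W" "W \<subseteq> polys n" "invariant_under n (rep n c mult_var (shifted_d a)) W" "W \<noteq> {0}" for W
  proof -
    note ops = M.invariant_ops[OF W(3,1)]
    have one: "monom n (\<lambda>_. 0) \<in> W"
    proof -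
      obtain f k where f: "f \<in> W" "f \<noteq> 0" "f \<in> low n (Suc k)" "\<And>g. g \<in> W \<Longrightarrow> g \<in> low n k \<Longrightarrow> g = 0"
        using minimal_degree[OF W(1,2,4)] by metis
      have fp: "f \<in> polys n" using f(1) W(2) by blast
      have "pderivative v f = 0" if v: "v \<in> vars n" for v
      proof (rule f(4))
        have "shifted_d a v f - cscale (a v) f \<in> W"
          using ops(3)[OF f(1) v v] f(1) W(1) by (intro fn.subspace_diff fn.subspace_scale)
        then show "pderivative v f \<in> W" by (simp add: shifted_d_def)
        show "pderivative v f \<in> low n k" using f(3) v by (rule pderivative_low)
      qed
      then show ?thesis
        using coef_zero_of_pderivative_zero[OF fp] f(1,2) fp W(1) by (intro one_mem_of_constant[of W f]) auto
    qed
    have raise: "mult_var v m \<in> W" if v: "v \<in> vars n" and m: "m \<in> low n k" "low n k \<subseteq> W" for v m k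
    proof -
      define N where "N = (\<Sum>v\<in>vars n. a v * a (cj v))"
      have mp: "m \<in> polys n" "m \<in> W" using m low_polys by blast+
      have euler: "mult_var u (pderivative w m) \<in> W" if "u \<in> vars n" "w \<in> vars n" for u w
      proof (cases k)
        case 0
        then have "m = 0" using m(1) by (simp add: low_def)
        then show ?thesis using fn.subspace_0[OF W(1)] by simp
      next
        case (Suc j)
        then show ?thesis
          using mult_var_low[OF pderivative_low] m that by blast
      qed
      have reindex: "(\<Sum>w\<in>vars n. a (cj w) * (p (cj w) * (a (cj v) * m p))) =
          (\<Sum>w\<in>vars n. a (cj v) * (p w * (a w * m p)))" for p
        by (rule sum.reindex_bij_witness[of _ cj cj]) (auto simp: algebra_simps)
      \<comment> \<open>the sums over \<open>w\<close> on the right other than those of \<open>R\<close> and \<open>E\<close> preserve the degree\<close>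
      have "cscale N (mult_var v m) =
        (\<Sum>w\<in>vars n. cscale (a (cj w)) (M.R v w m)) + cscale (a (cj v)) (M.E m)
        - (\<Sum>w\<in>vars n. cscale (a (cj w)) (mult_var v (pderivative w m)))
        + (\<Sum>w\<in>vars n. cscale (a (cj w)) (mult_var (cj w) (pderivative (cj v) m)))
        - cscale (a (cj v)) (\<Sum>w\<in>vars n. mult_var w (pderivative w m))"
      proof
        fix p
        show "cscale N (mult_var v m) p =
          ((\<Sum>w\<in>vars n. cscale (a (cj w)) (M.R v w m)) + cscale (a (cj v)) (M.E m)
          - (\<Sum>w\<in>vars n. cscale (a (cj w)) (mult_var v (pderivative w m)))
          + (\<Sum>w\<in>vars n. cscale (a (cj w)) (mult_var (cj w) (pderivative (cj v) m)))
          - cscale (a (cj v)) (\<Sum>w\<in>vars n. mult_var w (pderivative w m))) p"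
          unfolding M.R_def M.E_def N_def shifted_d_def mult_var_def cscale_def fn_apply sum_fun_apply
          using reindex[of p]
          by (simp add: sum_distrib_left sum_distrib_right sum.distrib sum_subtractf algebra_simps)
      qed
      also have "\<dots> \<in> W"
        using ops(1)[OF mp(2) v] ops(5)[OF mp(2) v v] euler v W(1)
        by (intro fn.subspace_add fn.subspace_diff fn.subspace_sum fn.subspace_scale) auto
      finally have "cscale (1 / N) (cscale N (mult_var v m)) \<in> W"
        by (rule fn.subspace_scale[OF W(1)])
      moreover have "N \<noteq> 0" using assms by (simp add: N_def)
      ultimately show ?thesis by simp
    qed
    have "low n k \<subseteq> W" for k
    proof (induction k)
      case 0
      then show ?case using fn.subspace_0[OF W(1)] by (simp add: low_def)
    next
      case (Suc k)
      have "monom n \<alpha> \<in> W" if \<alpha>: "\<alpha> \<in> exps n" "tdeg n \<alpha> < Suc k" for \<alpha>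
      proof (cases "\<alpha> = (\<lambda>_. 0)")
        case True
        then show ?thesis using one by simp
      next
        case False
        then obtain v where v: "\<alpha> v > 0" by (metis ext gr0I)
        then have vn: "v \<in> vars n" using \<alpha>(1) by (force simp: exps_def)
        have "tdeg n \<alpha> = Suc (tdeg n (dec v \<alpha>))"
          using tdeg_inc[OF vn, of "dec v \<alpha>"] v by simp
        then have "monom n (dec v \<alpha>) \<in> low n k" using \<alpha> by (intro monom_low) auto
        then have "mult_var v (monom n (dec v \<alpha>)) \<in> W" using Suc by (intro raise[OF vn])
        then show ?thesis using v by (simp add: mult_var_monom vn)
      qed
      then show ?case unfolding low_def by (intro fn.span_minimal W(1)) auto
    qed
    then show ?thesis using polys_low by blast
  qed
  then show ?thesis
    using M.is_representation polys_nonzero unfolding irreducible_rep_def by blast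
qed

theorem exp_polys_irreducible:
  assumes "(\<Sum>i=1..n. a i * b i) \<noteq> 0"
  shows "irreducible_rep n (pi_c n c) (exp_polys n a b)"
proof -
  define e where "e v = (case v of X i \<Rightarrow> a i | Y i \<Rightarrow> b i)" for v
  define L where "L p = (\<Sum>i=1..n. a i * p (X i)) + (\<Sum>i=1..n. b i * p (Y i))" for p :: point
  define \<Phi> where "\<Phi> f = (\<lambda>p. f p * exp (L p))" for f :: fn
  have L_vars: "L p = (\<Sum>v\<in>vars n. e v * p v)" for p
    by (simp add: L_def e_def sum_vars)
  have "(\<Sum>v\<in>vars n. e v * e (cj v)) = 2 * (\<Sum>i=1..n. a i * b i)"
    by (simp add: sum_vars e_def mult.commute)
  then have irr: "irreducible_rep n (rep n c mult_var (shifted_d e)) (polys n)"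
    using assms by (intro shifted_irreducible) simp
  interpret M: weyl_module n c mult_var "shifted_d e" "polys n"
    by (rule weyl_shifted)
  have deriv: "pderivative v (\<Phi> f) = \<Phi> (shifted_d e v f)" if v: "v \<in> vars n" and f: "f \<in> polys n" for v f
  proof
    fix p
    define r where "r = (\<Sum>w\<in>vars n - {v}. e w * p w)"
    have line: "L (p(v := t)) = e v * t + r" for t
      unfolding L_vars r_def using v by (auto simp: sum.remove[of _ v] intro!: sum.cong)
    have "((\<lambda>t. f (p(v := t))) has_field_derivative pderivative v f p) (at (p v))"
      unfolding pderivative_def using polys_differentiable[OF f] by (simp add: DERIV_deriv_iff_field_differentiable)
    then have "((\<lambda>t. f (p(v := t)) * exp (e v * t + r)) has_field_derivative
        pderivative v f p * exp (e v * p v + r) + e v * exp (e v * p v + r) * f (p(v := p v))) (at (p v))"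
      by (auto intro!: derivative_eq_intros)
    then have "pderivative v (\<Phi> f) p =
        pderivative v f p * exp (e v * p v + r) + e v * exp (e v * p v + r) * f p"
      unfolding \<Phi>_def pderivative_def[of v "\<lambda>p. f p * exp (L p)"] line by (simp add: DERIV_imp_deriv)
    then show "pderivative v (\<Phi> f) p = \<Phi> (shifted_d e v f) p"
      using line[of "p v"] by (simp add: \<Phi>_def shifted_d_def fn_apply cscale_def algebra_simps)
  qed
  show ?thesis
    unfolding pi_c_def
  proof (rule M.irreducible_transport[OF irr])
    show "exp_polys n a b = \<Phi> ` polys n"
      by (auto simp: exp_polys_def \<Phi>_def L_def)
    show "inj_on \<Phi> (polys n)"
      by (rule inj_onI) (simp add: \<Phi>_def fun_eq_iff)
    show "pderivative v (\<Phi> f) = \<Phi> (shifted_d e v f)" if "v \<in> vars n" "f \<in> polys n" for v f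
      using that by (rule deriv)
  qed (auto simp: \<Phi>_def mult_var_def cscale_def fn_apply fun_eq_iff algebra_simps)
qed

section \<open>Irreducibility of the modules with swapped variables\<close>

lemma weyl_swap: "weyl_module n (swap_q S) (swap_d S) (polys n)"
proof unfold_locales
  fix v w f assume *: "v \<in> vars n" "w \<in> vars n" "f \<in> polys n"
  show "swap_d S v (swap_q S w f) = swap_q S w (swap_d S v f) + (if v = w then f else 0)"
    using * pderivative_mult_var[OF *(3,1,2)] pderivative_mult_var[OF *(3,2,1)]
      pderivative_commute[OF *(3,1,2)] mult_var_commute[of v w f]
      pderivative_scale[OF mult_var_polys[OF *(1,3)], of w "-1"] mult_var_scale[of w "-1" "mult_var v f"]
    by (auto simp: swap_q_def swap_d_def fn_apply)
next
  fix v w f assume *: "v \<in> vars n" "w \<in> vars n" "f \<in> polys n"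
  show "swap_q S v (swap_q S w f) = swap_q S w (swap_q S v f)"
    using * pderivative_mult_var[OF *(3,1,2)] pderivative_mult_var[OF *(3,2,1)]
      pderivative_commute[OF *(3,1,2)] mult_var_commute[of v w f]
    by (auto simp: swap_q_def)
next
  fix v w f assume *: "v \<in> vars n" "w \<in> vars n" "f \<in> polys n"
  have neg: "mult_var u (- g) = - mult_var u g" for u g
    using mult_var_scale[of u "-1" g] by simp
  show "swap_d S v (swap_d S w f) = swap_d S w (swap_d S v f)"
    using * pderivative_mult_var[OF *(3,1,2)] pderivative_mult_var[OF *(3,2,1)]
      pderivative_commute[OF *(3,1,2)] mult_var_commute[of v w f]
      pderivative_scale[OF mult_var_polys[OF *(1,3)], of w "-1"]
      pderivative_scale[OF mult_var_polys[OF *(2,3)], of v "-1"]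
    by (auto simp: swap_d_def fn_apply neg)
qed (auto simp: swap_q_def swap_d_def fn_apply fn_subspace_polys mult_var_polys mult_var_add mult_var_scale
    pderivative_add[of _ n] pderivative_scale[of _ n] fn.subspace_neg[OF fn_subspace_polys])

text \<open>The variables in \<open>S\<close> are swapped. All that matters about \<open>S\<close> is that it is not empty and
  contains no two paired coordinates, so that $\eta$ pairs every swapped variable with an unswapped one.
  The eigenvalues that have to be inverted below all have the form $c+k$ with an integer $k$.\<close>

locale swapped_module =
  fixes n :: nat and c :: complex and S :: "var set"
  assumes S_vars: "S \<subseteq> vars n"
    and isotropic: "v \<in> S \<Longrightarrow> cj v \<notin> S"
    and S_nonempty: "S \<noteq> {}"
    and c_nonint: "c \<notin> \<int>"
begin

sublocale weyl_module n c "swap_q S" "swap_d S" "polys n"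
  by (rule weyl_swap)

abbreviation m :: "(var \<Rightarrow> nat) \<Rightarrow> fn" where "m \<equiv> monom n"

lemma S_in_vars [simp]: "v \<in> S \<Longrightarrow> v \<in> vars n"
  using S_vars by blast

lemma cj_not_S [simp]: "v \<in> S \<Longrightarrow> cj v \<notin> S"
  by (rule isotropic)

lemma q_S: "v \<in> S \<Longrightarrow> swap_q S v (m \<alpha>) = cscale (of_nat (\<alpha> v)) (m (dec v \<alpha>))"
  and q_not_S: "v \<in> vars n \<Longrightarrow> v \<notin> S \<Longrightarrow> swap_q S v (m \<alpha>) = m (inc v \<alpha>)"
  and d_S: "v \<in> S \<Longrightarrow> swap_d S v (m \<alpha>) = - m (inc v \<alpha>)"
  and d_not_S: "v \<in> vars n \<Longrightarrow> v \<notin> S \<Longrightarrow> swap_d S v (m \<alpha>) = cscale (of_nat (\<alpha> v)) (m (dec v \<alpha>))"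
  by (simp_all add: swap_q_def swap_d_def fn_apply pderivative_monom mult_var_monom)

text \<open>The eigenvalue of \<open>q v \<circ> d v\<close> on a monomial; for a swapped variable this operator is
  $-\partial_vv=-v\partial_v-1$.\<close>

definition eig :: "var \<Rightarrow> (var \<Rightarrow> nat) \<Rightarrow> int" where
  "eig v \<alpha> = (if v \<in> S then - int (\<alpha> v) - 1 else int (\<alpha> v))"

lemma q_d_monom:
  assumes "v \<in> vars n"
  shows "swap_q S v (swap_d S v (m \<alpha>)) = cscale (of_int (eig v \<alpha>)) (m \<alpha>)"
proof (cases "v \<in> S")
  case True
  then show ?thesis by (simp add: d_S q_S eig_def inc_apply algebra_simps flip: fn.scale_minus_left)
next
  case False
  then show ?thesis using assms by (cases "\<alpha> v = 0") (simp_all add: d_not_S q_not_S eig_def)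
qed

definition euler_eig :: "(var \<Rightarrow> nat) \<Rightarrow> int" where
  "euler_eig \<alpha> = (\<Sum>v\<in>vars n. eig v \<alpha>)"

lemma E_monom: "E (m \<alpha>) = cscale (of_int (euler_eig \<alpha>)) (m \<alpha>)"
  by (simp add: E_def q_d_monom euler_eig_def fn.scale_sum_left)

text \<open>In the induction below $\eta$ is applied to monomials, and each of its $n$ summands turns out to be
  an integer multiple of one monomial \<open>T\<close> modulo the submodule. Only the integrality of the
  multiples enters, so their values are never computed.\<close>

lemma H_integral:
  assumes "fn.subspace W"
    and "\<And>v. v \<in> vars n \<Longrightarrow> \<exists>k::int. swap_q S v (swap_q S (cj v) g) - cscale (of_int k) T \<in> W"
  shows "\<exists>k::int. H g - cscale (of_int k) T \<in> W"
proof -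
  have "\<forall>i. \<exists>k::int. i \<in> {1..n} \<longrightarrow> swap_q S (X i) (swap_q S (Y i) g) - cscale (of_int k) T \<in> W"
    using assms(2)[of "X _"] by (metis X_vars cj.simps(1))
  then obtain k :: "nat \<Rightarrow> int" where
    k: "\<And>i. i \<in> {1..n} \<Longrightarrow> swap_q S (X i) (swap_q S (Y i) g) - cscale (of_int (k i)) T \<in> W"
    by metis
  have "H g - cscale (of_int (\<Sum>i=1..n. k i)) T =
      (\<Sum>i=1..n. swap_q S (X i) (swap_q S (Y i) g) - cscale (of_int (k i)) T)"
    by (simp add: H_def sum_subtractf fn.scale_sum_left)
  also have "\<dots> \<in> W"
    using assms(1) k by (intro fn.subspace_sum) auto
  finally show ?thesis by blast
qed

lemma nonint: "of_int j + c \<noteq> 0"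
proof
  assume "of_int j + c = 0"
  then have "c = of_int (- j)" by (metis add.commute eq_neg_iff_add_eq_0 of_int_minus)
  then show False using c_nonint Ints_of_int by metis
qed

text \<open>The two memberships combine to that of $(c+j+lk)T$, and the coefficient cannot vanish.\<close>

lemma cancel_nonint:
  assumes W: "fn.subspace W" and "f - cscale (of_int k) T \<in> W" "cscale (of_int j + c) T + cscale (of_int l) f \<in> W"
  shows "T \<in> W"
proof -
  have "cscale (of_int j + c) T + cscale (of_int l) f - cscale (of_int l) (f - cscale (of_int k) T) \<in> W"
    by (rule fn.subspace_diff[OF W assms(3) fn.subspace_scale[OF W assms(2)]])
  moreover have "cscale (of_int j + c) T + cscale (of_int l) f - cscale (of_int l) (f - cscale (of_int k) T)
      = cscale (of_int (j + l * k) + c) T"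
    by (simp add: fn.scale_left_distrib algebra_simps)
  ultimately have "cscale (inverse (of_int (j + l * k) + c)) (cscale (of_int (j + l * k) + c) T) \<in> W"
    using fn.subspace_scale[OF W] by metis
  moreover have "of_int (j + l * k) + c \<noteq> 0" by (rule nonint)
  ultimately show ?thesis by (simp del: of_int_add of_int_mult)
qed

text \<open>The degree in the unswapped variables. It is the induction parameter because multiplication by a
  swapped variable, being $-d_v$, is available in every submodule.\<close>

definition udeg :: "(var \<Rightarrow> nat) \<Rightarrow> nat" where
  "udeg \<alpha> = (\<Sum>v\<in>vars n - S. \<alpha> v)"

lemma udeg_inc_S: "v \<in> S \<Longrightarrow> udeg (inc v \<alpha>) = udeg \<alpha>"
  by (auto simp: udeg_def inc_apply intro!: sum.cong)

lemma udeg_inc: "v \<in> vars n \<Longrightarrow> v \<notin> S \<Longrightarrow> udeg (inc v \<alpha>) = Suc (udeg \<alpha>)"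
proof -
  assume v: "v \<in> vars n" "v \<notin> S"
  have "(\<Sum>w\<in>vars n - S - {v}. inc v \<alpha> w) = (\<Sum>w\<in>vars n - S - {v}. \<alpha> w)"
    by (intro sum.cong) (auto simp: inc_apply)
  then show ?thesis using v by (simp add: udeg_def sum.remove[of _ v] inc_apply)
qed

lemma udeg_dec_S: "v \<in> S \<Longrightarrow> udeg (dec v \<alpha>) = udeg \<alpha>"
  by (auto simp: udeg_def dec_apply intro!: sum.cong)

lemma udeg_dec: "v \<in> vars n \<Longrightarrow> v \<notin> S \<Longrightarrow> \<alpha> v > 0 \<Longrightarrow> udeg \<alpha> = Suc (udeg (dec v \<alpha>))"
  using udeg_inc[of v "dec v \<alpha>"] by simp

lemma R_monom_not_S_S:
  assumes "v \<in> vars n" "v \<notin> S" "cj v \<notin> S" "s \<in> S"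
  shows "R v s (m \<alpha>) = - m (inc v (inc s \<alpha>)) - cscale (of_nat (\<alpha> (cj v))) (m (inc (cj s) (dec (cj v) \<alpha>)))"
  using assms by (simp add: R_def d_S q_not_S d_not_S)

lemma R_monom_cj_S:
  assumes "s \<in> S" "r \<in> S"
  shows "R (cj s) r (m \<alpha>) = m (inc (cj r) (inc s \<alpha>)) - m (inc (cj s) (inc r \<alpha>))"
  using assms by (simp add: R_def d_S q_not_S)

context
  fixes W :: "fn set"
  assumes W: "fn.subspace W" "W \<subseteq> polys n" "invariant_under n (rep n c (swap_q S) (swap_d S)) W"
begin

lemmas ops = invariant_ops[OF W(3,1)]

lemma neg_mem: "- f \<in> W \<Longrightarrow> f \<in> W"
  using fn.subspace_neg[OF W(1), of "- f"] by simp

lemma inc_S_mem: "m \<alpha> \<in> W \<Longrightarrow> v \<in> S \<Longrightarrow> m (inc v \<alpha>) \<in> W"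
  by (rule neg_mem) (use ops(3)[of "m \<alpha>" v v] in \<open>simp add: d_S\<close>)

text \<open>An element of least degree is annihilated by $\partial_u$ for unswapped \<open>u\<close>, hence involves swapped
  variables only. On such elements \<open>K s\<close> with \<open>s\<close> swapped is $\partial_s(D+c)$, which lowers the
  degree as well; since $D+c$ is diagonal without the eigenvalue 0, no swapped variable occurs
  either.\<close>

lemma one_mem:
  assumes "W \<noteq> {0}"
  shows "m (\<lambda>_. 0) \<in> W"
proof -
  obtain f k where f: "f \<in> W" "f \<noteq> 0" "f \<in> low n (Suc k)" "\<And>g. g \<in> W \<Longrightarrow> g \<in> low n k \<Longrightarrow> g = 0"
    using minimal_degree[OF W(1,2) assms] by metis
  have fp: "f \<in> polys n" using f(1) W(2) by blast
  have d_zero: "pderivative v f = 0" if v: "v \<in> vars n" "v \<notin> S" for v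
  proof (rule f(4))
    show "pderivative v f \<in> W"
      using ops(3)[OF f(1) v(1) v(1)] v by (simp add: swap_d_def)
    show "pderivative v f \<in> low n k" using f(3) v(1) by (rule pderivative_low)
  qed
  have E_low: "E g \<in> low n j" if "g \<in> low n j" for g j
    using that
  proof (induction rule: low_induct)
    case zero
    show ?case using fn.subspace_0[OF subspace_low] by simp
  next
    case (step t \<alpha> f)
    then show ?case
      by (auto simp: E_monom intro!: fn.subspace_add[OF subspace_low] fn.subspace_scale[OF subspace_low] monom_low)
  qed
  have coef_E: "coef n (E g) \<alpha> = of_int (euler_eig \<alpha>) * coef n g \<alpha>" if "g \<in> polys n" "\<alpha> \<in> exps n" for g \<alpha>
    using that(1)
  proof (induction rule: polys_induct)
    case (step t \<beta> f)
    then show ?case using that(2) by (auto simp: E_monom coef_add coef_scale coef_monom algebra_simps)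
  qed simp
  have K_zero: "pderivative v (E f + cscale c f) = 0" if v: "v \<in> S" for v
  proof (rule f(4))
    have "K v f = pderivative v (E f + cscale c f)"
      using v d_zero[of "cj v"] by (simp add: K_def swap_q_def swap_d_def)
    then show "pderivative v (E f + cscale c f) \<in> W"
      using ops(2)[OF f(1), of v v] v by simp
    have "E f + cscale c f \<in> low n (Suc k)"
      using f(3) E_low by (intro fn.subspace_add[OF subspace_low] fn.subspace_scale[OF subspace_low])
    then show "pderivative v (E f + cscale c f) \<in> low n k" using v by (intro pderivative_low) auto
  qed
  have "coef n f \<alpha> = 0" if v: "v \<in> vars n" "\<alpha> \<in> exps n" "\<alpha> v > 0" for v \<alpha>
  proof (cases "v \<in> S")
    case False
    then show ?thesis using coef_zero_of_pderivative_zero[OF fp v(1) _ v(2,3)] d_zero v(1) by blast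
  next
    case True
    have "coef n (E f + cscale c f) \<alpha> = 0"
      using coef_zero_of_pderivative_zero[OF _ v(1) K_zero[OF True] v(2,3)] fp by simp
    then have "(of_int (euler_eig \<alpha>) + c) * coef n f \<alpha> = 0"
      using fp v(2) by (simp add: coef_add coef_scale coef_E algebra_simps)
    moreover have "of_int (euler_eig \<alpha>) + c \<noteq> 0" by (rule nonint)
    ultimately show ?thesis by simp
  qed
  then show ?thesis using one_mem_of_constant[OF W(1) f(1) fp f(2)] by blast
qed

context
  fixes k :: nat
  assumes IH: "\<And>\<alpha>. \<alpha> \<in> exps n \<Longrightarrow> udeg \<alpha> \<le> k \<Longrightarrow> m \<alpha> \<in> W"
begin

text \<open>The next lemmas multiply a monomial of unswapped degree at most \<open>k\<close> by one further unswapped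
  variable, first in the presence of a swapped variable. If neither \<open>v\<close> nor its partner is swapped, the
  rotation \<open>R v s\<close> multiplies by $-vs$ up to a term of the same unswapped degree.\<close>

lemma raise_middle:
  assumes "\<alpha> \<in> exps n" "udeg \<alpha> \<le> k" "v \<in> vars n" "v \<notin> S" "cj v \<notin> S" "s \<in> S"
  shows "m (inc v (inc s \<alpha>)) \<in> W"
proof -
  have "cscale (of_nat (\<alpha> (cj v))) (m (inc (cj s) (dec (cj v) \<alpha>))) \<in> W"
  proof (cases "\<alpha> (cj v) = 0")
    case True
    then show ?thesis using fn.subspace_0[OF W(1)] by simp
  next
    case False
    then have "udeg (inc (cj s) (dec (cj v) \<alpha>)) \<le> k"
      using assms udeg_dec[of "cj v" \<alpha>] by (simp add: udeg_inc)
    then show ?thesis using assms by (intro fn.subspace_scale[OF W(1)] IH) auto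
  qed
  moreover have "R v s (m \<alpha>) \<in> W"
    using ops(1) IH assms by simp
  ultimately have "R v s (m \<alpha>) + cscale (of_nat (\<alpha> (cj v))) (m (inc (cj s) (dec (cj v) \<alpha>))) \<in> W"
    by (intro fn.subspace_add[OF W(1)])
  then have "- m (inc v (inc s \<alpha>)) \<in> W"
    using assms by (simp add: R_monom_not_S_S)
  then show ?thesis by (rule neg_mem)
qed

text \<open>The rotations cannot isolate the partner of a swapped variable: they only identify
  $\bar s\,v\gamma$ with $\bar v\,s\gamma$. But \<open>K (cj s)\<close> applied to $t\alpha$ gives an integer plus \<open>c\<close>
  times $T=\bar s\,t\alpha$, plus $\eta$ applied to $\beta=s\,t\alpha$. Modulo the submodule, the
  summands of $\eta\beta$ are integer multiples of \<open>T\<close>, by those identifications for the pairs with a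
  swapped variable, and by \<open>R v s\<close> for the pairs $v,\bar v$ without one.\<close>

lemma raise_cj:
  assumes \<alpha>: "\<alpha> \<in> exps n" "udeg \<alpha> \<le> k" and st: "s \<in> S" "t \<in> S"
  shows "m (inc (cj s) (inc t \<alpha>)) \<in> W"
proof -
  define \<beta> where "\<beta> = inc s (inc t \<alpha>)"
  define T where "T = m (inc (cj s) (inc t \<alpha>))"
  have term_S: "swap_q S (cj v) (swap_q S v (m \<beta>)) - cscale (of_int (int (\<beta> v))) T \<in> W"
    if v: "v \<in> S" for v
  proof -
    have eq: "swap_q S (cj v) (swap_q S v (m \<beta>)) = cscale (of_nat (\<beta> v)) (m (inc (cj v) (dec v \<beta>)))"
      using v by (simp add: q_S q_not_S)
    consider "v = s" | "\<beta> v = 0" | "v \<noteq> s" "\<beta> v > 0" by blast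
    then have "cscale (of_nat (\<beta> v)) (m (inc (cj v) (dec v \<beta>)) - T) \<in> W"
    proof cases
      case 1
      then show ?thesis using fn.subspace_0[OF W(1)] by (simp add: \<beta>_def T_def)
    next
      case 2
      then show ?thesis using fn.subspace_0[OF W(1)] by simp
    next
      case 3
      define \<gamma> where "\<gamma> = dec v (inc t \<alpha>)"
      have inc\<gamma>: "inc v \<gamma> = inc t \<alpha>"
        using 3 unfolding \<gamma>_def by (intro inc_dec) (simp add: \<beta>_def inc_apply[of s])
      have "m \<gamma> \<in> W"
        using \<alpha> st v by (intro IH) (simp_all add: \<gamma>_def udeg_dec_S udeg_inc_S)
      then have "R (cj s) v (m \<gamma>) \<in> W" using ops(1) st v by simp
      moreover have "dec v \<beta> = inc s \<gamma>" using 3 by (simp add: \<beta>_def \<gamma>_def dec_inc_neq)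
      ultimately have "m (inc (cj v) (dec v \<beta>)) - T \<in> W"
        by (simp add: R_monom_cj_S st v inc\<gamma> T_def)
      then show ?thesis by (rule fn.subspace_scale[OF W(1)])
    qed
    then show ?thesis unfolding eq by simp
  qed
  have "\<exists>j::int. H (m \<beta>) - cscale (of_int j) T \<in> W"
  proof (rule H_integral[OF W(1)])
    fix v assume v: "v \<in> vars n"
    consider "v \<in> S" | "cj v \<in> S" | "v \<notin> S" "cj v \<notin> S" by blast
    then show "\<exists>j::int. swap_q S v (swap_q S (cj v) (m \<beta>)) - cscale (of_int j) T \<in> W"
    proof cases
      case 1
      have "swap_q S v (swap_q S (cj v) (m \<beta>)) = swap_q S (cj v) (swap_q S v (m \<beta>))"
        using v by (intro q_q) simp_all
      then show ?thesis using term_S[OF 1] by metis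
    next
      case 2
      show ?thesis by (intro exI[of _ "int (\<beta> (cj v))"] term_S[OF 2, unfolded cj_cj])
    next
      case 3
      have "m (inc (cj v) (inc t \<alpha>)) \<in> W"
        using \<alpha> st v 3 by (intro raise_middle) auto
      then have "R v s (m (inc (cj v) (inc t \<alpha>))) \<in> W" using ops(1) st v by simp
      moreover have "inc t \<alpha> (cj v) = \<alpha> (cj v)" using st 3 by (auto simp: inc_apply)
      moreover have "inc v (inc s (inc (cj v) (inc t \<alpha>))) = inc v (inc (cj v) \<beta>)"
        unfolding \<beta>_def by (simp only: inc_commute[of s])
      ultimately have "- m (inc v (inc (cj v) \<beta>)) - cscale (of_nat (Suc (\<alpha> (cj v)))) T \<in> W"
        using v 3 st by (simp add: R_monom_not_S_S inc_apply[of "cj v"] T_def del: of_nat_Suc)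
      then have "- (m (inc v (inc (cj v) \<beta>)) - cscale (of_int (- int (Suc (\<alpha> (cj v))))) T) \<in> W"
        by (simp del: of_nat_Suc)
      then have "m (inc v (inc (cj v) \<beta>)) - cscale (of_int (- int (Suc (\<alpha> (cj v))))) T \<in> W"
        by (rule neg_mem)
      then show ?thesis
        using v 3 by (intro exI[of _ "- int (Suc (\<alpha> (cj v)))"]) (simp add: q_not_S del: of_int_minus of_nat_Suc)
    qed
  qed
  then obtain j :: int where j: "H (m \<beta>) - cscale (of_int j) T \<in> W" by blast
  have "m (inc t \<alpha>) \<in> W" using \<alpha> st by (intro IH) (simp_all add: udeg_inc_S)
  then have "K (cj s) (m (inc t \<alpha>)) \<in> W" using ops(2)[of _ _ s] st by simp
  moreover have "K (cj s) (m (inc t \<alpha>)) = cscale (of_int (euler_eig (inc t \<alpha>)) + c) T + cscale (of_int 1) (H (m \<beta>))"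
    using st by (simp add: K_def E_monom d_S q_not_S T_def \<beta>_def fn.scale_left_distrib)
  ultimately have "T \<in> W" using cancel_nonint[OF W(1) j] by metis
  then show ?thesis by (simp add: T_def)
qed

lemma raise_mixed:
  assumes "\<alpha> \<in> exps n" "udeg \<alpha> \<le> k" "u \<in> vars n" "u \<notin> S" "t \<in> S"
  shows "m (inc u (inc t \<alpha>)) \<in> W"
proof (cases "cj u \<in> S")
  case True
  then show ?thesis using raise_cj[OF assms(1,2) True assms(5)] by simp
next
  case False
  then show ?thesis using assms by (intro raise_middle)
qed

text \<open>To treat a monomial without swapped variables, multiply it by a swapped variable \<open>s\<close>, which leads
  into the submodule by the preceding lemmas, and remove \<open>s\<close> again by \<open>K s\<close>, that is by $\partial_s(D+c)$
  minus $\eta\,\partial_{\bar s}$. The first part is $c$ plus an integer times the monomial. The summands of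
  the second are integer multiples of it modulo the submodule: for the pairs $v,\bar v$ without a swapped
  variable this is seen by applying \<open>R v s\<close> to a monomial with a smaller exponent of $\bar s$, hence the
  induction on that exponent.\<close>

lemma raise_unswapped:
  assumes "\<alpha> \<in> exps n" "udeg \<alpha> = Suc k" "\<And>v. v \<in> S \<Longrightarrow> \<alpha> v = 0" "s \<in> S"
  shows "m \<alpha> \<in> W"
  using assms(1-3)
proof (induction "\<alpha> (cj s)" arbitrary: \<alpha> rule: less_induct)
  case less
  have "m (inc s \<alpha>) \<in> W"
  proof -
    obtain u where u: "u \<in> vars n" "u \<notin> S" "\<alpha> u > 0"
      using less.prems(2) unfolding udeg_def by (metis DiffD1 DiffD2 gr0I nat.distinct(1) sum.neutral)
    have "m (inc u (inc s (dec u \<alpha>))) \<in> W"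
      using less.prems u assms(4) udeg_dec[OF u(1,2), of \<alpha>] u(3) by (intro raise_mixed) auto
    then show ?thesis using u by (simp add: inc_commute[of u])
  qed
  then have "K s (m (inc s \<alpha>)) \<in> W" using ops(2)[of _ _ s] assms(4) by simp
  moreover have "K s (m (inc s \<alpha>)) = cscale (of_int (euler_eig (inc s \<alpha>)) + c) (m \<alpha>)
      + cscale (of_int (- int (\<alpha> (cj s)))) (H (m (inc s (dec (cj s) \<alpha>))))"
    using assms(4) less.prems(3)
    by (simp add: K_def E_monom d_not_S q_S inc_apply dec_inc_neq fn.scale_left_distrib)
  moreover have "\<exists>j::int. H (m (inc s (dec (cj s) \<alpha>))) - cscale (of_int j) (m \<alpha>) \<in> W" if pos: "\<alpha> (cj s) > 0"
  proof (rule H_integral[OF W(1)])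
    define \<gamma> where "\<gamma> = dec (cj s) \<alpha>"
    have \<alpha>: "\<alpha> = inc (cj s) \<gamma>" using pos by (simp add: \<gamma>_def)
    have \<gamma>S: "\<gamma> v = 0" if "v \<in> S" for v using less.prems(3)[OF that] by (auto simp: \<gamma>_def dec_apply)
    have term_S: "\<exists>j::int. swap_q S (cj v) (swap_q S v (m (inc s \<gamma>))) - cscale (of_int j) (m \<alpha>) \<in> W"
      if v: "v \<in> S" for v
    proof (cases "v = s")
      case True
      then show ?thesis
        using v \<gamma>S[OF v] fn.subspace_0[OF W(1)]
        by (intro exI[of _ 1]) (simp add: q_S q_not_S inc_apply[of s] \<alpha>)
    next
      case False
      then show ?thesis
        using v \<gamma>S[OF v] fn.subspace_0[OF W(1)]
        by (intro exI[of _ 0]) (simp add: q_S inc_apply[of s])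
    qed
    fix v assume v: "v \<in> vars n"
    consider "v \<in> S" | "cj v \<in> S" | "v \<notin> S" "cj v \<notin> S" by blast
    then show "\<exists>j::int. swap_q S v (swap_q S (cj v) (m (inc s (dec (cj s) \<alpha>)))) - cscale (of_int j) (m \<alpha>) \<in> W"
      unfolding \<gamma>_def[symmetric]
    proof cases
      case 1
      then show "\<exists>j::int. swap_q S v (swap_q S (cj v) (m (inc s \<gamma>))) - cscale (of_int j) (m \<alpha>) \<in> W"
        using term_S[OF 1] q_q[OF v, of "cj v" "m (inc s \<gamma>)"] v by simp
    next
      case 2
      show "\<exists>j::int. swap_q S v (swap_q S (cj v) (m (inc s \<gamma>))) - cscale (of_int j) (m \<alpha>) \<in> W"
        by (rule term_S[OF 2, unfolded cj_cj])
    next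
      case 3
      have ne: "cj s \<noteq> cj v" "s \<noteq> cj v" using 3 assms(4) by auto
      have "m (inc (cj v) \<gamma>) \<in> W"
      proof (rule less.hyps)
        show "inc (cj v) \<gamma> (cj s) < \<alpha> (cj s)" using ne pos by (simp add: inc_apply \<gamma>_def dec_apply)
        show "inc (cj v) \<gamma> \<in> exps n" using v less.prems(1) by (simp add: \<gamma>_def)
        show "udeg (inc (cj v) \<gamma>) = Suc k"
          using v 3 less.prems(2) assms(4) by (simp add: udeg_inc \<alpha>)
        show "inc (cj v) \<gamma> w = 0" if "w \<in> S" for w
          using \<gamma>S[OF that] 3 that by (auto simp: inc_apply)
      qed
      then have "R v s (m (inc (cj v) \<gamma>)) \<in> W" using ops(1) assms(4) v by simp
      moreover have "inc v (inc s (inc (cj v) \<gamma>)) = inc v (inc (cj v) (inc s \<gamma>))"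
        by (simp only: inc_commute[of s])
      ultimately have "- m (inc v (inc (cj v) (inc s \<gamma>))) - cscale (of_nat (Suc (\<gamma> (cj v)))) (m \<alpha>) \<in> W"
        using v 3 assms(4) by (simp add: R_monom_not_S_S inc_apply[of "cj v"] \<alpha> del: of_nat_Suc)
      then have "- (m (inc v (inc (cj v) (inc s \<gamma>))) - cscale (of_int (- int (Suc (\<gamma> (cj v))))) (m \<alpha>)) \<in> W"
        by (simp del: of_nat_Suc)
      then have "m (inc v (inc (cj v) (inc s \<gamma>))) - cscale (of_int (- int (Suc (\<gamma> (cj v))))) (m \<alpha>) \<in> W"
        by (rule neg_mem)
      then show "\<exists>j::int. swap_q S v (swap_q S (cj v) (m (inc s \<gamma>))) - cscale (of_int j) (m \<alpha>) \<in> W"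
        using v 3 by (intro exI[of _ "- int (Suc (\<gamma> (cj v)))"]) (simp add: q_not_S del: of_int_minus of_nat_Suc)
    qed
  qed
  ultimately show ?case
  proof (cases "\<alpha> (cj s) = 0")
    case True
    have "0 - cscale (of_int 0) (m \<alpha>) \<in> W" using fn.subspace_0[OF W(1)] by simp
    then show ?thesis
      using cancel_nonint[OF W(1), of 0 0 "m \<alpha>" "euler_eig (inc s \<alpha>)" 0] True
        \<open>K s (m (inc s \<alpha>)) \<in> W\<close> \<open>K s (m (inc s \<alpha>)) = _\<close> by simp
  next
    case False
    then obtain j :: int where "H (m (inc s (dec (cj s) \<alpha>))) - cscale (of_int j) (m \<alpha>) \<in> W"
      using \<open>0 < \<alpha> (cj s) \<Longrightarrow> _\<close> by blast
    then show ?thesis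
      using cancel_nonint[OF W(1)] \<open>K s (m (inc s \<alpha>)) \<in> W\<close> \<open>K s (m (inc s \<alpha>)) = _\<close> by metis
  qed
qed

lemma raise_all:
  assumes "\<alpha> \<in> exps n" "udeg \<alpha> = Suc k"
  shows "m \<alpha> \<in> W"
proof (cases "\<exists>t\<in>S. \<alpha> t > 0")
  case True
  then obtain t where t: "t \<in> S" "\<alpha> t > 0" by blast
  obtain u where u: "u \<in> vars n" "u \<notin> S" "\<alpha> u > 0"
    using assms(2) unfolding udeg_def by (metis DiffD1 DiffD2 gr0I nat.distinct(1) sum.neutral)
  have tu: "u \<noteq> t" using t u by blast
  have "m (inc u (inc t (dec t (dec u \<alpha>)))) \<in> W"
    using assms u t udeg_dec[OF u(1,2), of \<alpha>] u(3) by (intro raise_mixed) (auto simp: udeg_dec_S)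
  moreover have "inc t (dec t (dec u \<alpha>)) = dec u \<alpha>" using t tu by (intro inc_dec) (simp add: dec_apply)
  ultimately show ?thesis using u by simp
next
  case False
  then have "\<alpha> v = 0" if "v \<in> S" for v using that by auto
  moreover obtain s where "s \<in> S" using S_nonempty by blast
  ultimately show ?thesis by (rule raise_unswapped[OF assms])
qed

end

lemma all_monomials:
  assumes "W \<noteq> {0}" "\<alpha> \<in> exps n"
  shows "m \<alpha> \<in> W"
proof -
  have "\<forall>\<alpha>\<in>exps n. udeg \<alpha> \<le> k \<longrightarrow> m \<alpha> \<in> W" for k
  proof (induction k)
    case 0
    have "m \<alpha> \<in> W" if "\<alpha> \<in> exps n" "udeg \<alpha> = 0" for \<alpha>
      using that
    proof (induction "tdeg n \<alpha>" arbitrary: \<alpha>)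
      case 0
      then have "\<alpha> = (\<lambda>_. 0)" by (auto simp: tdeg_def exps_def fun_eq_iff)
      then show ?case using one_mem[OF assms(1)] by simp
    next
      case (Suc j)
      then obtain v where v: "v \<in> vars n" "\<alpha> v > 0"
        unfolding tdeg_def by (metis gr0I nat.distinct(1) sum.neutral)
      then have vS: "v \<in> S" using Suc.prems(2) by (force simp: udeg_def)
      have "m (dec v \<alpha>) \<in> W"
        using Suc v vS tdeg_inc[OF v(1), of "dec v \<alpha>"] by (intro Suc.hyps(1)) (simp_all add: udeg_dec_S)
      then show ?case using inc_S_mem[OF _ vS, of "dec v \<alpha>"] v by simp
    qed
    then show ?case by blast
  next
    case (Suc k)
    then show ?case using raise_all[of k] le_Suc_eq by blast
  qed
  then show ?thesis using assms(2) by blast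
qed

end

theorem irreducible: "irreducible_rep n (rep n c (swap_q S) (swap_d S)) (polys n)"
proof -
  have "polys n \<subseteq> W"
    if "fn.subspace W" "W \<subseteq> polys n" "invariant_under n (rep n c (swap_q S) (swap_d S)) W" "W \<noteq> {0}" for W
    using that by (intro polys_subset all_monomials)
  then show ?thesis
    using is_representation polys_nonzero unfolding irreducible_rep_def by blast
qed

end

section \<open>Weights\<close>

lemma cartan_gens_carrier: "(\<lambda>i. Amat n i i) ` {1..n+1} \<subseteq> carrier_mat (2*n+2) (2*n+2)"
proof
  fix G assume "G \<in> (\<lambda>i. Amat n i i) ` {1..n+1}"
  then obtain i where i: "i \<in> {1..n+1}" "G = Amat n i i" by (rule imageE)
  then have "G = Fmat n i i" by (simp only: Amat_eq_Fmat[OF i(1) i(1)])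
  then show "G \<in> carrier_mat (2*n+2) (2*n+2)" by (simp only: Fmat_carrier)
qed

lemma cartan_carrier: "M \<in> cartan n \<Longrightarrow> M \<in> carrier_mat (2*n+2) (2*n+2)"
  unfolding cartan_def by (erule mat_span_carrier) (rule cartan_gens_carrier)

lemma cartan_o_alg: "M \<in> cartan n \<Longrightarrow> M \<in> o_alg n"
  unfolding cartan_def o_alg_def by (erule mat_span_mono) blast

lemma Amat_cartan:
  assumes "i \<in> {1..n+1}"
  shows "Amat n i i \<in> cartan n"
proof -
  have "1 \<cdot>\<^sub>m Amat n i i \<in> cartan n"
    unfolding cartan_def by (rule mat_span_base[OF imageI[OF assms] cartan_gens_carrier])
  moreover have "1 \<cdot>\<^sub>m Amat n i i = Amat n i i" by (rule eq_matI) auto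
  ultimately show ?thesis by simp
qed

lemma mat_span_add:
  assumes "M \<in> mat_span N S" "L \<in> mat_span N S" "S \<subseteq> carrier_mat N N"
  shows "M + L \<in> mat_span N S"
  using assms(2)
proof induction
  case zero
  have "M + 0\<^sub>m N N = M" using mat_span_carrier[OF assms(1,3)] by (rule right_add_zero_mat)
  then show ?case using assms(1) by simp
next
  case (add_smult L G t)
  have "M + (L + t \<cdot>\<^sub>m G) = M + L + t \<cdot>\<^sub>m G"
    using mat_span_carrier[OF assms(1,3)] mat_span_carrier[OF add_smult(1) assms(3)] add_smult(2) assms(3)
    by (intro assoc_add_mat[symmetric, of _ N N]) auto
  then show ?case using mat_span.add_smult[OF add_smult(3,2)] by simp
qed

lemma mat_span_smult:
  assumes "M \<in> mat_span N S" "S \<subseteq> carrier_mat N N"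
  shows "t \<cdot>\<^sub>m M \<in> mat_span N S"
  using assms(1)
proof induction
  case zero
  have "t \<cdot>\<^sub>m 0\<^sub>m N N = 0\<^sub>m N N" by (rule eq_matI) auto
  then show ?case by (simp add: mat_span.zero)
next
  case (add_smult M G x)
  have "M \<in> carrier_mat N N" "G \<in> carrier_mat N N"
    using mat_span_carrier[OF add_smult(1) assms(2)] add_smult(2) assms(2) by auto
  then have "t \<cdot>\<^sub>m (M + x \<cdot>\<^sub>m G) = t \<cdot>\<^sub>m M + (t * x) \<cdot>\<^sub>m G"
    by (intro eq_matI) (auto simp: algebra_simps)
  then show ?case using mat_span.add_smult[OF add_smult(3,2)] by simp
qed

lemma cartan_add: "M \<in> cartan n \<Longrightarrow> N \<in> cartan n \<Longrightarrow> M + N \<in> cartan n"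
  and cartan_smult: "M \<in> cartan n \<Longrightarrow> t \<cdot>\<^sub>m M \<in> cartan n"
  unfolding cartan_def by (rule mat_span_add mat_span_smult; (assumption | rule cartan_gens_carrier))+

lemma infinite_exps:
  assumes "n \<ge> 1"
  shows "infinite (exps n)"
proof -
  have "inj (\<lambda>k::nat. (\<lambda>_. 0)(X 1 := k))" by (auto simp: inj_on_def fun_eq_iff)
  then have "infinite (range (\<lambda>k::nat. (\<lambda>_. 0)(X 1 := k)))" using finite_imageD by blast
  moreover have "range (\<lambda>k::nat. (\<lambda>_. 0)(X 1 := k)) \<subseteq> exps n" using assms by (auto simp: exps_def)
  ultimately show ?thesis using finite_subset by blast
qed

lemma polys_infinite_dimensional:
  assumes "n \<ge> 1"
  shows "\<not> finite_dimensional (polys n)"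
proof
  assume "finite_dimensional (polys n)"
  then obtain B where B: "finite B" "fn.span B = polys n" by (auto simp: finite_dimensional_def)
  have "monom n ` exps n \<subseteq> fn.span B" unfolding B(2) by (rule image_subsetI) (rule monom_polys)
  then have "finite (monom n ` exps n)"
    by (rule conjunct1[OF fn.independent_span_bound[OF B(1) monom_independent]])
  then have "finite (exps n)" by (rule finite_imageD[OF _ monom_inj_on])
  then show False using infinite_exps[OF assms] by (rule notE[rotated])
qed

context swapped_module
begin

abbreviation "\<rho> \<equiv> rep n c (swap_q S) (swap_d S)"

lemma rep_Amat_monom:
  assumes "i \<in> {1..n}"
  shows "\<rho> (Amat n i i) (m \<alpha>) = cscale (of_int (eig (X i) \<alpha> - eig (Y i) \<alpha>)) (m \<alpha>)"
proof -
  have "i \<in> {1..n+1}" "i \<in> ix n" using assms by auto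
  then have "\<rho> (Amat n i i) (m \<alpha>) = R (X i) (X i) (m \<alpha>)"
    using assms by (simp only: Amat_eq_Fmat rep_Fmat) (simp add: slot_of_def)
  then show ?thesis
    using assms by (simp add: R_def q_d_monom fn.scale_left_diff_distrib)
qed

lemma rep_Amat_last_monom:
  "\<rho> (Amat n (n+1) (n+1)) (m \<alpha>) = cscale (- (of_int (euler_eig \<alpha>) + c)) (m \<alpha>)"
proof -
  have "n + 1 \<in> {1..n+1}" "n + 1 \<in> ix n" by auto
  then have "\<rho> (Amat n (n+1) (n+1)) (m \<alpha>) = - (E (m \<alpha>) + cscale c (m \<alpha>))"
    by (simp only: Amat_eq_Fmat rep_Fmat) (simp add: slot_of_def)
  then show ?thesis
    by (simp add: E_monom fn.scale_left_diff_distrib)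
qed

text \<open>The weight of a monomial, read off as a coefficient; restricting it to the Cartan subalgebra makes
  equality of weights equality of functions.\<close>

definition wt :: "(var \<Rightarrow> nat) \<Rightarrow> complex mat \<Rightarrow> complex" where
  "wt \<alpha> = restrict (\<lambda>M. coef n (\<rho> M (m \<alpha>)) \<alpha>) (cartan n)"

lemma rep_cartan_monom:
  assumes "\<alpha> \<in> exps n" "M \<in> cartan n"
  shows "\<rho> M (m \<alpha>) = cscale (wt \<alpha> M) (m \<alpha>)"
proof -
  have "\<exists>x. \<rho> M (m \<alpha>) = cscale x (m \<alpha>)"
    using assms(2) unfolding cartan_def
  proof induction
    case zero
    show ?case by (rule exI[of _ 0]) (simp only: rep_zero fn.scale_zero_left)
  next
    case (add_smult M G t)
    then obtain i where i: "i \<in> {1..n+1}" "G = Amat n i i" by blast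
    have "\<exists>y. \<rho> G (m \<alpha>) = cscale y (m \<alpha>)"
    proof (cases "i = n + 1")
      case True
      then show ?thesis using rep_Amat_last_monom i(2) by blast
    next
      case False
      then have "i \<in> {1..n}" using i(1) by auto
      then show ?thesis using rep_Amat_monom i(2) by blast
    qed
    then obtain x y where xy: "\<rho> M (m \<alpha>) = cscale x (m \<alpha>)" "\<rho> G (m \<alpha>) = cscale y (m \<alpha>)"
      using add_smult(3) by blast
    have "M \<in> carrier_mat (2*n+2) (2*n+2)" "G \<in> carrier_mat (2*n+2) (2*n+2)"
      using mat_span_carrier[OF add_smult(1) cartan_gens_carrier] subsetD[OF cartan_gens_carrier add_smult(2)]
      by auto
    then have "\<rho> (M + t \<cdot>\<^sub>m G) (m \<alpha>) = cscale x (m \<alpha>) + cscale t (cscale y (m \<alpha>))"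
      by (simp only: rep_add_smult xy)
    then have "\<rho> (M + t \<cdot>\<^sub>m G) (m \<alpha>) = cscale (x + t * y) (m \<alpha>)"
      by (simp add: fn.scale_left_distrib)
    then show ?case by blast
  qed
  then obtain x where x: "\<rho> M (m \<alpha>) = cscale x (m \<alpha>)" by blast
  then have "wt \<alpha> M = x" using assms by (simp add: wt_def coef_scale coef_monom)
  then show ?thesis using x by simp
qed

lemma wt_cartan_dual:
  assumes "\<alpha> \<in> exps n"
  shows "wt \<alpha> \<in> cartan_dual n"
proof -
  have closed: "\<rho> M (m \<alpha>) \<in> polys n" if "M \<in> cartan n" for M
    using that by (intro rep_closed cartan_o_alg monom_polys)
  have "wt \<alpha> (M + N) = wt \<alpha> M + wt \<alpha> N" if "M \<in> cartan n" "N \<in> cartan n" for M N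
    using that cartan_add[OF that]
    by (simp add: wt_def rep_add[OF cartan_carrier cartan_carrier] coef_add closed)
  moreover have "wt \<alpha> (t \<cdot>\<^sub>m M) = t * wt \<alpha> M" if "M \<in> cartan n" for t M
    using that cartan_smult[OF that]
    by (simp add: wt_def rep_smult[OF cartan_carrier] coef_scale closed)
  ultimately show ?thesis
    unfolding cartan_dual_def by (simp add: wt_def)
qed

lemma coef_rep_cartan:
  assumes "f \<in> polys n" "\<alpha> \<in> exps n" "M \<in> cartan n"
  shows "coef n (\<rho> M f) \<alpha> = wt \<alpha> M * coef n f \<alpha>"
  using assms(1)
proof (induction rule: polys_induct)
  case zero
  show ?case using rep_scale[OF cartan_o_alg[OF assms(3)] polys_zero, of 0] by simp
next
  case (step t \<beta> f)
  note M = cartan_o_alg[OF assms(3)]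
  have "coef n (\<rho> M (m \<beta>)) \<alpha> = wt \<alpha> M * coef n (m \<beta>) \<alpha>"
    using step(1) assms(2,3) by (simp add: rep_cartan_monom coef_scale coef_monom)
  then show ?case
    using step
    by (simp add: rep_plus[OF M] rep_scale[OF M] coef_add coef_scale rep_closed[OF M] algebra_simps)
qed

text \<open>Since the Cartan subalgebra acts diagonally on coefficients, a weight space is spanned by the
  monomials of that weight.\<close>
lemma weight_space_iff:
  assumes "\<mu> \<in> cartan_dual n"
  shows "f \<in> weight_space n \<rho> (polys n) \<mu> \<longleftrightarrow>
    f \<in> polys n \<and> (\<forall>\<alpha>\<in>exps n. coef n f \<alpha> \<noteq> 0 \<longrightarrow> wt \<alpha> = \<mu>)"
proof (intro iffI conjI ballI impI)
  assume f: "f \<in> weight_space n \<rho> (polys n) \<mu>"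
  then show fp: "f \<in> polys n" by (simp add: weight_space_def)
  fix \<alpha> assume \<alpha>: "\<alpha> \<in> exps n" "coef n f \<alpha> \<noteq> 0"
  have "wt \<alpha> M = \<mu> M" if M: "M \<in> cartan n" for M
  proof -
    have "coef n (\<rho> M f) \<alpha> = \<mu> M * coef n f \<alpha>"
      using f M fp by (simp add: weight_space_def coef_scale)
    then show ?thesis using coef_rep_cartan[OF fp \<alpha>(1) M] \<alpha>(2) by simp
  qed
  moreover have "\<mu> \<in> extensional (cartan n)" using assms by (simp add: cartan_dual_def)
  moreover have "wt \<alpha> \<in> extensional (cartan n)" by (simp add: wt_def)
  ultimately show "wt \<alpha> = \<mu>" by (intro extensionalityI)
next
  assume f: "f \<in> polys n \<and> (\<forall>\<alpha>\<in>exps n. coef n f \<alpha> \<noteq> 0 \<longrightarrow> wt \<alpha> = \<mu>)"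
  have "\<rho> M f = cscale (\<mu> M) f" if M: "M \<in> cartan n" for M
  proof -
    have "\<rho> M f - cscale (\<mu> M) f = 0"
    proof (rule polys_eq_0I)
      show "\<rho> M f - cscale (\<mu> M) f \<in> polys n"
        using f M by (intro V_diff V_scale rep_closed cartan_o_alg) auto
      fix \<alpha> assume \<alpha>: "\<alpha> \<in> exps n"
      have "coef n (\<rho> M f + cscale (- \<mu> M) f) \<alpha> = 0"
        using f M \<alpha>
        by (cases "coef n f \<alpha> = 0")
           (simp_all add: coef_add coef_scale coef_rep_cartan rep_closed cartan_o_alg del: fn.scale_minus_left)
      then show "coef n (\<rho> M f - cscale (\<mu> M) f) \<alpha> = 0" by simp
    qed
    then show ?thesis by simp
  qed
  then show "f \<in> weight_space n \<rho> (polys n) \<mu>" using f by (simp add: weight_space_def)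
qed

lemma subspace_weight_space: "fn.subspace (weight_space n \<rho> (polys n) \<mu>)"
  unfolding fn.subspace_def weight_space_def
  using rep_scale[OF cartan_o_alg V_zero, where t = 0]
  by (auto simp: rep_plus[OF cartan_o_alg] rep_scale[OF cartan_o_alg] mult.commute)

lemma coef_sum:
  "(\<And>i. i \<in> I \<Longrightarrow> g i \<in> polys n) \<Longrightarrow> coef n (\<Sum>i\<in>I. g i) \<alpha> = (\<Sum>i\<in>I. coef n (g i) \<alpha>)"
  by (induction I rule: infinite_finite_induct) (simp_all add: coef_add)

lemma direct_sum_weight_spaces: "is_direct_sum (cartan_dual n) (weight_space n \<rho> (polys n)) (polys n)"
  unfolding is_direct_sum_def
proof (intro conjI ballI)
  show "fn.subspace (weight_space n \<rho> (polys n) \<mu>)" for \<mu> by (rule subspace_weight_space)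
  show "weight_space n \<rho> (polys n) \<mu> \<subseteq> polys n" for \<mu> by (auto simp: weight_space_def)
next
  fix f assume f: "f \<in> polys n"
  define A where "A = {\<alpha>. \<alpha> \<in> exps n \<and> coef n f \<alpha> \<noteq> 0}"
  have fin: "finite A" unfolding A_def by (rule finite_coef_support)
  define g where "g \<alpha> = cscale (coef n f \<alpha>) (m \<alpha>)" for \<alpha>
  define u where "u \<mu> = (\<Sum>\<alpha> | \<alpha> \<in> A \<and> wt \<alpha> = \<mu>. g \<alpha>)" for \<mu>
  have A_exps: "A \<subseteq> exps n" by (auto simp: A_def)
  define P where "P u \<longleftrightarrow> (\<forall>i\<in>cartan_dual n. u i \<in> weight_space n \<rho> (polys n) i) \<and>
      (\<forall>i. i \<notin> cartan_dual n \<longrightarrow> u i = 0) \<and> finite {i. u i \<noteq> 0} \<and> f = (\<Sum>i | u i \<noteq> 0. u i)"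
    for u :: "(complex mat \<Rightarrow> complex) \<Rightarrow> fn"
  have P_u: "P u"
  proof -
    have u_zero: "u \<mu> = 0" if "\<mu> \<notin> wt ` A" for \<mu>
    proof -
      have "{\<alpha>. \<alpha> \<in> A \<and> wt \<alpha> = \<mu>} = {}" using that by auto
      then show ?thesis unfolding u_def by (simp only: sum.empty)
    qed
    then have supp: "{\<mu>. u \<mu> \<noteq> 0} \<subseteq> wt ` A" by blast
    have "f = (\<Sum>\<alpha>\<in>A. g \<alpha>)"
      unfolding A_def g_def using f by (rule polys_expansion)
    also have "\<dots> = (\<Sum>\<mu>\<in>wt ` A. u \<mu>)"
      unfolding u_def by (rule sum.image_gen[OF fin])
    also have "\<dots> = (\<Sum>\<mu> | u \<mu> \<noteq> 0. u \<mu>)"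
      using fin supp by (intro sum.mono_neutral_right) auto
    finally have "f = (\<Sum>\<mu> | u \<mu> \<noteq> 0. u \<mu>)" .
    moreover have "u \<mu> \<in> weight_space n \<rho> (polys n) \<mu>" for \<mu>
      unfolding u_def
    proof (intro fn.subspace_sum subspace_weight_space)
      fix \<alpha> assume "\<alpha> \<in> {\<alpha>. \<alpha> \<in> A \<and> wt \<alpha> = \<mu>}"
      then have \<alpha>: "\<alpha> \<in> exps n" "wt \<alpha> = \<mu>" using A_exps by auto
      have "m \<alpha> \<in> weight_space n \<rho> (polys n) \<mu>"
        using rep_cartan_monom[OF \<alpha>(1)] \<alpha>(2) by (simp add: weight_space_def)
      then show "g \<alpha> \<in> weight_space n \<rho> (polys n) \<mu>"
        unfolding g_def by (rule fn.subspace_scale[OF subspace_weight_space])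
    qed
    moreover have "u \<mu> = 0" if "\<mu> \<notin> cartan_dual n" for \<mu>
      using that wt_cartan_dual A_exps by (intro u_zero) auto
    moreover have "finite {\<mu>. u \<mu> \<noteq> 0}" using supp fin finite_subset by blast
    ultimately show ?thesis unfolding P_def by blast
  qed
  \<comment> \<open>The coefficients of a component are those of \<open>f\<close> at the exponents of its weight.\<close>
  have member: "w \<nu> \<in> polys n" if "P w" for w \<nu>
    using that weight_space_iff[of \<nu> "w \<nu>"] by (cases "\<nu> \<in> cartan_dual n") (auto simp: P_def)
  have component: "coef n (w \<mu>) \<alpha> = (if wt \<alpha> = \<mu> then coef n f \<alpha> else 0)"
    if w: "P w" and \<alpha>: "\<alpha> \<in> exps n" for w \<mu> \<alpha>
  proof -
    have off: "coef n (w \<nu>) \<alpha> = 0" if "\<nu> \<noteq> wt \<alpha>" for \<nu>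
      using that w \<alpha> weight_space_iff[of \<nu> "w \<nu>"] by (cases "\<nu> \<in> cartan_dual n") (auto simp: P_def)
    have "coef n f \<alpha> = coef n (\<Sum>\<nu> | w \<nu> \<noteq> 0. w \<nu>) \<alpha>"
      using w unfolding P_def by metis
    also have "\<dots> = (\<Sum>\<nu> | w \<nu> \<noteq> 0. coef n (w \<nu>) \<alpha>)"
      using member[OF w] by (intro coef_sum)
    also have "\<dots> = (\<Sum>\<nu>\<in>{wt \<alpha>}. coef n (w \<nu>) \<alpha>)"
      using w off by (intro sum.mono_neutral_cong) (auto simp: P_def)
    finally show ?thesis using off[of \<mu>] by auto
  qed
  have unique: "w = u" if w: "P w" for w
  proof
    fix \<mu>
    have "w \<mu> - u \<mu> = 0"
    proof (rule polys_eq_0I)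
      show "w \<mu> - u \<mu> \<in> polys n" using member w P_u by (intro V_diff)
      fix \<alpha> assume \<alpha>: "\<alpha> \<in> exps n"
      have "coef n (w \<mu> + cscale (-1) (u \<mu>)) \<alpha> = 0"
        using member[OF w] member[OF P_u] component[OF w \<alpha>] component[OF P_u \<alpha>]
        by (simp add: coef_add coef_scale del: fn.scale_minus_left)
      then show "coef n (w \<mu> - u \<mu>) \<alpha> = 0" by simp
    qed
    then show "w \<mu> = u \<mu>" by simp
  qed
  have "\<exists>!u. P u" using P_u unique by (rule ex1I)
  then show "\<exists>!u. (\<forall>i\<in>cartan_dual n. u i \<in> weight_space n \<rho> (polys n) i) \<and>
      (\<forall>i. i \<notin> cartan_dual n \<longrightarrow> u i = 0) \<and> finite {i. u i \<noteq> 0} \<and> f = (\<Sum>i | u i \<noteq> 0. u i)"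
    unfolding P_def .
qed

theorem weight_module: "weight_module n \<rho> (polys n)"
  unfolding weight_module_def using is_representation direct_sum_weight_spaces ..

text \<open>The weight determines the eigenvalues of $A_{i,i}$ for $i\le n$ and, through $A_{n+1,n+1}$, that of
  the Euler operator.\<close>
lemma wt_eq_imp:
  assumes "\<alpha> \<in> exps n" "\<beta> \<in> exps n" "wt \<alpha> = wt \<beta>"
  shows "i \<in> {1..n} \<Longrightarrow> eig (X i) \<alpha> - eig (Y i) \<alpha> = eig (X i) \<beta> - eig (Y i) \<beta>"
    and "euler_eig \<alpha> = euler_eig \<beta>"
proof -
  have scalar: "wt \<gamma> M = x" if "\<gamma> \<in> exps n" "M \<in> cartan n" "\<rho> M (m \<gamma>) = cscale x (m \<gamma>)" for \<gamma> M x
    using that by (simp add: wt_def coef_scale coef_monom)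
  show "eig (X i) \<alpha> - eig (Y i) \<alpha> = eig (X i) \<beta> - eig (Y i) \<beta>" if i: "i \<in> {1..n}"
  proof -
    have M: "Amat n i i \<in> cartan n" using i by (intro Amat_cartan) auto
    have "(of_int (eig (X i) \<alpha> - eig (Y i) \<alpha>) :: complex) = of_int (eig (X i) \<beta> - eig (Y i) \<beta>)"
      using scalar[OF assms(1) M rep_Amat_monom[OF i]] scalar[OF assms(2) M rep_Amat_monom[OF i]] assms(3)
      by simp
    then show ?thesis by (simp only: of_int_eq_iff)
  qed
  have M: "Amat n (n+1) (n+1) \<in> cartan n" by (intro Amat_cartan) auto
  show "euler_eig \<alpha> = euler_eig \<beta>"
    using scalar[OF assms(1) M rep_Amat_last_monom] scalar[OF assms(2) M rep_Amat_last_monom] assms(3)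
    by simp
qed

text \<open>For a pair with a swapped variable the eigenvalue of $A_{i,i}$ is, up to sign, the sum of the two
  exponents plus 1, which bounds both. For the other pairs it is only their difference, but the sum of
  all exponents over these pairs is the Euler eigenvalue minus the contribution of the pairs already
  bounded.\<close>
lemma exponent_bound:
  assumes v: "v \<in> vars n"
  shows "int (\<alpha> v) \<le> \<bar>euler_eig \<alpha>\<bar> + (\<Sum>i=1..n. \<bar>eig (X i) \<alpha> - eig (Y i) \<alpha>\<bar>)"
proof -
  define l where "l i = \<bar>eig (X i) \<alpha> - eig (Y i) \<alpha>\<bar>" for i
  obtain i where i: "i \<in> {1..n}" "v = X i \<or> v = Y i" using v by (auto simp: vars_def)
  have swap: "X j \<in> S \<Longrightarrow> Y j \<notin> S" for j using isotropic[of "X j"] by simp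
  have pair: "- (eig (X j) \<alpha> + eig (Y j) \<alpha>) \<le> l j" for j
    using swap[of j] by (auto simp: eig_def l_def)
  show ?thesis
  proof (cases "X i \<in> S \<or> Y i \<in> S")
    case True
    then have "int (\<alpha> v) \<le> l i" using i(2) swap[of i] by (auto simp: eig_def l_def)
    also have "\<dots> \<le> (\<Sum>i=1..n. l i)" using i(1) by (intro member_le_sum) (auto simp: l_def)
    finally show ?thesis by (simp add: l_def)
  next
    case False
    have "euler_eig \<alpha> = (\<Sum>j=1..n. eig (X j) \<alpha> + eig (Y j) \<alpha>)"
      by (simp add: euler_eig_def sum_vars sum.distrib)
    also have "\<dots> = (eig (X i) \<alpha> + eig (Y i) \<alpha>) + (\<Sum>j\<in>{1..n} - {i}. eig (X j) \<alpha> + eig (Y j) \<alpha>)"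
      using i(1) by (simp add: sum.remove)
    finally have "eig (X i) \<alpha> + eig (Y i) \<alpha> = euler_eig \<alpha> + (\<Sum>j\<in>{1..n} - {i}. - (eig (X j) \<alpha> + eig (Y j) \<alpha>))"
      by (simp only: sum_negf)
    also have "\<dots> \<le> euler_eig \<alpha> + (\<Sum>j\<in>{1..n} - {i}. l j)"
      by (intro add_left_mono sum_mono pair)
    also have "\<dots> \<le> \<bar>euler_eig \<alpha>\<bar> + (\<Sum>j=1..n. l j)"
      by (intro add_mono sum_mono2) (auto simp: l_def)
    finally have "eig (X i) \<alpha> + eig (Y i) \<alpha> \<le> \<bar>euler_eig \<alpha>\<bar> + (\<Sum>j=1..n. l j)" .
    then show ?thesis using False i(2) by (auto simp: eig_def l_def)
  qed
qed

lemma finite_weight_exponents: "finite {\<alpha> \<in> exps n. wt \<alpha> = \<mu>}"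
proof (cases "{\<alpha> \<in> exps n. wt \<alpha> = \<mu>} = {}")
  case False
  then obtain \<beta> where \<beta>: "\<beta> \<in> exps n" "wt \<beta> = \<mu>" by blast
  define B where "B = nat (\<bar>euler_eig \<beta>\<bar> + (\<Sum>i=1..n. \<bar>eig (X i) \<beta> - eig (Y i) \<beta>\<bar>))"
  have "\<alpha> v \<in> {..B}" if \<alpha>: "\<alpha> \<in> exps n" "wt \<alpha> = \<mu>" and v: "v \<in> vars n" for \<alpha> v
  proof -
    have same: "wt \<alpha> = wt \<beta>" using \<alpha>(2) \<beta>(2) by simp
    have "int (\<alpha> v) \<le> \<bar>euler_eig \<alpha>\<bar> + (\<Sum>i=1..n. \<bar>eig (X i) \<alpha> - eig (Y i) \<alpha>\<bar>)"
      using v by (rule exponent_bound)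
    also have "(\<Sum>i=1..n. \<bar>eig (X i) \<alpha> - eig (Y i) \<alpha>\<bar>) = (\<Sum>i=1..n. \<bar>eig (X i) \<beta> - eig (Y i) \<beta>\<bar>)"
      by (rule sum.cong[OF refl]) (simp only: wt_eq_imp(1)[OF \<alpha>(1) \<beta>(1) same])
    finally show ?thesis by (simp add: B_def wt_eq_imp(2)[OF \<alpha>(1) \<beta>(1) same])
  qed
  then have "{\<alpha> \<in> exps n. wt \<alpha> = \<mu>} \<subseteq> {\<alpha>. (\<forall>v\<in>vars n. \<alpha> v \<in> {..B}) \<and> (\<forall>v. v \<notin> vars n \<longrightarrow> \<alpha> v = 0)}"
    by (auto simp: exps_def)
  moreover have "finite {\<alpha>. (\<forall>v\<in>vars n. \<alpha> v \<in> {..B}) \<and> (\<forall>v. v \<notin> vars n \<longrightarrow> \<alpha> v = 0)}"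
    using finite_set_of_finite_funs[of "vars n" "{..B}" 0]
    by (rule finite_subset[rotated]) auto
  ultimately show ?thesis by (rule finite_subset)
qed (simp only: finite.emptyI)

theorem finite_dimensional_weight_space:
  assumes "\<mu> \<in> cartan_dual n"
  shows "finite_dimensional (weight_space n \<rho> (polys n) \<mu>)"
proof -
  let ?B = "m ` {\<alpha> \<in> exps n. wt \<alpha> = \<mu>}"
  have "fn.span ?B = weight_space n \<rho> (polys n) \<mu>"
  proof
    show "fn.span ?B \<subseteq> weight_space n \<rho> (polys n) \<mu>"
      using rep_cartan_monom
      by (intro fn.span_minimal subspace_weight_space) (auto simp: weight_space_def)
    show "weight_space n \<rho> (polys n) \<mu> \<subseteq> fn.span ?B"
    proof
      fix f assume "f \<in> weight_space n \<rho> (polys n) \<mu>"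
      then have f: "f \<in> polys n" "\<And>\<alpha>. \<alpha> \<in> exps n \<Longrightarrow> coef n f \<alpha> \<noteq> 0 \<Longrightarrow> wt \<alpha> = \<mu>"
        using weight_space_iff[OF assms] by auto
      have "(\<Sum>\<alpha> | \<alpha> \<in> exps n \<and> coef n f \<alpha> \<noteq> 0. cscale (coef n f \<alpha>) (m \<alpha>)) \<in> fn.span ?B"
        using f(2) by (intro fn.span_sum fn.span_scale fn.span_base) auto
      then show "f \<in> fn.span ?B" by (subst polys_expansion[OF f(1)])
    qed
  qed
  then show ?thesis
    unfolding finite_dimensional_def using finite_weight_exponents by blast
qed

end

lemma swapped_module_swapped_vars:
  fixes c :: complex
  assumes "n1 \<in> {1..n}" "n2 \<in> {1..n}" "n1 \<le> n2" "c \<notin> {of_int m / 2 | m. True}"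
  shows "swapped_module n c (swapped_vars n n1 n2)"
proof
  show "swapped_vars n n1 n2 \<subseteq> vars n" using assms by (auto simp: swapped_vars_def vars_def)
  show "cj v \<notin> swapped_vars n n1 n2" if "v \<in> swapped_vars n n1 n2" for v
    using that assms(3) by (auto simp: swapped_vars_def)
  show "swapped_vars n n1 n2 \<noteq> {}" using assms(1) by (auto simp: swapped_vars_def)
  show "c \<notin> \<int>"
  proof
    assume "c \<in> \<int>"
    then obtain k where "c = of_int k" by (auto elim: Ints_cases)
    then have "c = of_int (2 * k) / 2" by simp
    then show False using assms(4) by blast
  qed
qed

theorem theorem1:
  fixes n :: nat
  assumes "n \<ge> 1"
  shows "(\<forall>(a :: nat \<Rightarrow> complex) b. (\<Sum>i=1..n. a i * b i) \<noteq> 0 \<longrightarrow>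
            (\<forall>c. irreducible_rep n (pi_c n c) (exp_polys n a b)))
       \<and> (\<forall>n1\<in>{1..n}. \<forall>n2\<in>{1..n}. \<forall>c. n1 \<le> n2 \<and> c \<notin> {of_int m / 2 | m. True} \<longrightarrow>
            irreducible_rep n (pi_c_swap n n1 n2 c) (polys n)
          \<and> \<not> finite_dimensional (polys n)
          \<and> weight_module n (pi_c_swap n n1 n2 c) (polys n)
          \<and> (\<forall>\<mu>\<in>cartan_dual n.
               finite_dimensional (weight_space n (pi_c_swap n n1 n2 c) (polys n) \<mu>)))"
proof (intro conjI allI ballI impI)
  fix a b :: "nat \<Rightarrow> complex" and c
  assume "(\<Sum>i=1..n. a i * b i) \<noteq> 0"
  then show "irreducible_rep n (pi_c n c) (exp_polys n a b)" by (rule exp_polys_irreducible)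
next
  fix n1 n2 and c :: complex
  assume "n1 \<in> {1..n}" "n2 \<in> {1..n}" "n1 \<le> n2 \<and> c \<notin> {of_int m / 2 | m. True}"
  then interpret swapped_module n c "swapped_vars n n1 n2"
    by (intro swapped_module_swapped_vars) auto
  show "irreducible_rep n (pi_c_swap n n1 n2 c) (polys n)"
    unfolding pi_c_swap_def by (rule irreducible)
  show "\<not> finite_dimensional (polys n)" using assms by (rule polys_infinite_dimensional)
  show "weight_module n (pi_c_swap n n1 n2 c) (polys n)"
    unfolding pi_c_swap_def by (rule weight_module)
  show "finite_dimensional (weight_space n (pi_c_swap n n1 n2 c) (polys n) \<mu>)" if "\<mu> \<in> cartan_dual n" for \<mu>
    using that unfolding pi_c_swap_def by (rule finite_dimensional_weight_space)
qed

end
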